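(* Let $n\ge 1$, $\theta>1/2$, and $u_1\in L^2(\mathbf{R}^n)\cap L^{1,1}(\mathbf{R}^n)$. Let $u$ be the unique (mild) solution of $$u_{tt}-\Delta u+L_\theta u_t=0\ \text{ in }(0,\infty)\times\mathbf{R}^n,\qquad u(0,x)=0,\quad u_t(0,x)=u_1(x).$$ Put $P_1=\int_{\mathbf{R}^n}u_1(x)\,dx$ and $I_0=\|u_1\|_{1,1}+\|u_1\|_{L^2}$. Then there is a constant $C_n>0$, depending on $n$ and $\theta$ but not on $t$ or $u_1$, such that for all sufficiently large $t$: (i) if $n\ge 3$, then $C_n|P_1|\,t^{-\frac{n-2}{4\theta}}\le\|u(t,\cdot)\|_{L^2}\le C_n^{-1}I_0\,t^{-\frac{n-2}{4\theta}}$; (ii) if $n=2$, then $C_2|P_1|\sqrt{\log t}\le\|u(t,\cdot)\|_{L^2}\le C_2^{-1}I_0\sqrt{\log t}$; (iii) if $n=1$, then $C_1|P_1|\sqrt t\le\|u(t,\cdot)\|_{L^2}\le C_1^{-1}I_0\sqrt t$.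
   Context: The Fourier transform is $\hat f(\xi)=\int_{\mathbf{R}^n}e^{-ix\cdot\xi}f(x)\,dx$, with inverse $\mathcal{F}^{-1}_{\xi\to x}$. For $\theta>0$, $L_\theta$ is the nonnegative self-adjoint operator on $L^2(\mathbf{R}^n)$ given by $L_\theta f=\mathcal{F}^{-1}_{\xi\to x}\big(\log(1+|\xi|^{2\theta})\hat f(\xi)\big)$, with domain $\{f\in L^2:\int_{\mathbf{R}^n}(\log(1+|\xi|^{2\theta}))^2|\hat f(\xi)|^2d\xi<\infty\}$. For $u_1\in L^2(\mathbf{R}^n)$ the Cauchy problem has a unique mild solution $u\in C([0,\infty);H^1(\mathbf{R}^n))\cap C^1([0,\infty);L^2(\mathbf{R}^n))$; its Fourier transform in $x$ solves, for a.e. $\xi$, $\hat u_{tt}+|\xi|^2\hat u+\log(1+|\xi|^{2\theta})\hat u_t=0$, $\hat u(0,\xi)=0$, $\hat u_t(0,\xi)=\hat u_1(\xi)$. The space $L^{1,1}(\mathbf{R}^n)$ consists of $f\in L^1(\mathbf{R}^n)$ with $\|f\|_{1,1}:=\int_{\mathbf{R}^n}(1+|x|)|f(x)|\,dx<\infty$. "For all sufficiently large $t$" (the paper's "$t\gg1$") means for all $t\ge t_0$ for some $t_0$, which may depend on $n$, $\theta$ and $u_1$. *)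

theory Defs
  imports "HOL-Analysis.Analysis"
begin

text \<open>
  Elements of \<open>L\<^sup>2\<close> are represented by Borel functions; every notion below is invariant under
  changing them on null sets. Functions are complex valued, which covers real data.
\<close>

definition in_L2 :: "('a::euclidean_space \<Rightarrow> complex) \<Rightarrow> bool" where
  "in_L2 f \<longleftrightarrow> f \<in> borel_measurable lborel \<and> integrable lborel (\<lambda>x. (norm (f x))\<^sup>2)"

definition L2_norm :: "('a::euclidean_space \<Rightarrow> complex) \<Rightarrow> real" where
  "L2_norm f = sqrt (LINT x|lborel. (norm (f x))\<^sup>2)"

text \<open>
  The membership clauses matter: the Bochner integral in \<open>L2_norm\<close> is 0 for a function that is
  not square integrable.
\<close>

definition L2_tendsto ::
  "('b \<Rightarrow> 'a::euclidean_space \<Rightarrow> complex) \<Rightarrow> ('a \<Rightarrow> complex) \<Rightarrow> 'b filter \<Rightarrow> bool" where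
  "L2_tendsto f l F \<longleftrightarrow> (\<forall>\<^sub>F y in F. in_L2 (f y)) \<and> in_L2 l \<and>
     ((\<lambda>y. L2_norm (\<lambda>x. f y x - l x)) \<longlongrightarrow> 0) F"

definition in_L11 :: "('a::euclidean_space \<Rightarrow> complex) \<Rightarrow> bool" where
  "in_L11 f \<longleftrightarrow> integrable lborel f \<and> integrable lborel (\<lambda>x. (1 + norm x) * norm (f x))"

definition L11_norm :: "('a::euclidean_space \<Rightarrow> complex) \<Rightarrow> real" where
  "L11_norm f = (LINT x|lborel. (1 + norm x) * norm (f x))"

definition fourier_integral :: "('a::euclidean_space \<Rightarrow> complex) \<Rightarrow> 'a \<Rightarrow> complex" where
  "fourier_integral f \<xi> = (LINT x|lborel. exp (- (\<i> * complex_of_real (x \<bullet> \<xi>))) * f x)"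

text \<open>
  The Fourier transform on \<open>L\<^sup>2\<close> is the extension by continuity of the integral transform from
  the dense subspace \<open>L\<^sup>1 \<inter> L\<^sup>2\<close>. As a relation it is functional and bijective on \<open>L\<^sup>2\<close> up to
  null sets (Plancherel), so the choices below pick representatives of unique classes.
\<close>

definition is_L2_fourier ::
  "('a::euclidean_space \<Rightarrow> complex) \<Rightarrow> ('a \<Rightarrow> complex) \<Rightarrow> bool" where
  "is_L2_fourier f g \<longleftrightarrow> (\<exists>\<phi> :: nat \<Rightarrow> 'a \<Rightarrow> complex.
     (\<forall>k. integrable lborel (\<phi> k)) \<and>
     L2_tendsto \<phi> f sequentially \<and>
     L2_tendsto (\<lambda>k. fourier_integral (\<phi> k)) g sequentially)"

definition L2_fourier :: "('a::euclidean_space \<Rightarrow> complex) \<Rightarrow> 'a \<Rightarrow> complex" where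
  "L2_fourier f = (SOME g. is_L2_fourier f g)"

definition L2_inverse_fourier :: "('a::euclidean_space \<Rightarrow> complex) \<Rightarrow> 'a \<Rightarrow> complex" where
  "L2_inverse_fourier g = (SOME f. is_L2_fourier f g)"

text \<open>Sobolev spaces \<open>H\<^sup>s\<close> for \<open>s \<ge> 0\<close>.\<close>

definition sobolev_weighted :: "real \<Rightarrow> ('a::euclidean_space \<Rightarrow> complex) \<Rightarrow> 'a \<Rightarrow> complex" where
  "sobolev_weighted s f \<xi> = complex_of_real ((1 + (norm \<xi>)\<^sup>2) powr (s / 2)) * L2_fourier f \<xi>"

definition in_H :: "real \<Rightarrow> ('a::euclidean_space \<Rightarrow> complex) \<Rightarrow> bool" where
  "in_H s f \<longleftrightarrow> in_L2 f \<and> in_L2 (sobolev_weighted s f)"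

definition H_norm :: "real \<Rightarrow> ('a::euclidean_space \<Rightarrow> complex) \<Rightarrow> real" where
  "H_norm s f = L2_norm (sobolev_weighted s f)"

text \<open>The Laplacian with domain \<open>H\<^sup>2\<close>.\<close>

definition laplacian :: "('a::euclidean_space \<Rightarrow> complex) \<Rightarrow> 'a \<Rightarrow> complex" where
  "laplacian f =
     L2_inverse_fourier (\<lambda>\<xi>. - complex_of_real ((norm \<xi>)\<^sup>2) * L2_fourier f \<xi>)"

definition log_symbol :: "real \<Rightarrow> 'a::euclidean_space \<Rightarrow> real" where
  "log_symbol \<theta> \<xi> = ln (1 + norm \<xi> powr (2 * \<theta>))"

definition in_dom_L :: "real \<Rightarrow> ('a::euclidean_space \<Rightarrow> complex) \<Rightarrow> bool" where
  "in_dom_L \<theta> f \<longleftrightarrow> in_L2 f \<and> in_L2 (\<lambda>\<xi>. complex_of_real (log_symbol \<theta> \<xi>) * L2_fourier f \<xi>)"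

definition L_op :: "real \<Rightarrow> ('a::euclidean_space \<Rightarrow> complex) \<Rightarrow> 'a \<Rightarrow> complex" where
  "L_op \<theta> f = L2_inverse_fourier (\<lambda>\<xi>. complex_of_real (log_symbol \<theta> \<xi>) * L2_fourier f \<xi>)"

text \<open>Curves on \<open>[0, \<infinity>)\<close>; at \<open>t = 0\<close> limits are one-sided.\<close>

definition continuous_into_H :: "real \<Rightarrow> (real \<Rightarrow> 'a::euclidean_space \<Rightarrow> complex) \<Rightarrow> bool" where
  "continuous_into_H s u \<longleftrightarrow> (\<forall>t\<ge>0. in_H s (u t)) \<and>
     (\<forall>t\<ge>0. ((\<lambda>r. H_norm s (\<lambda>x. u r x - u t x)) \<longlongrightarrow> 0) (at t within {0..}))"

definition continuous_into_L2 :: "(real \<Rightarrow> 'a::euclidean_space \<Rightarrow> complex) \<Rightarrow> bool" where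
  "continuous_into_L2 u \<longleftrightarrow> (\<forall>t\<ge>0. in_L2 (u t) \<and> L2_tendsto u (u t) (at t within {0..}))"

definition has_L2_derivative ::
  "(real \<Rightarrow> 'a::euclidean_space \<Rightarrow> complex) \<Rightarrow> (real \<Rightarrow> 'a \<Rightarrow> complex) \<Rightarrow> bool" where
  "has_L2_derivative u v \<longleftrightarrow> (\<forall>t\<ge>0. in_L2 (u t) \<and>
     L2_tendsto (\<lambda>r x. (u r x - u t x) / complex_of_real (r - t)) (v t) (at t within {0..}))"

text \<open>
  With \<open>U = (u, u\<^sub>t)\<close> the problem reads \<open>U' = A U\<close>, \<open>U(0) = (0, u\<^sub>1)\<close> in \<open>H\<^sup>1 \<times> L\<^sup>2\<close>, where
  \<open>A (u, v) = (v, \<Delta> u - L\<^sub>\<theta> v)\<close> has domain \<open>H\<^sup>2 \<times> H\<^sup>1\<close>. As usual for semigroups, \<open>U\<close> is a mild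
  solution if it is continuous, \<open>\<integral>\<^sub>0\<^sup>t U(s) ds\<close> lies in the domain of \<open>A\<close>, and
  \<open>U(t) = U(0) + A \<integral>\<^sub>0\<^sup>t U(s) ds\<close> for all \<open>t \<ge> 0\<close>. Below \<open>v = u\<^sub>t\<close>, and
  \<open>w(t) = \<integral>\<^sub>0\<^sup>t u(s) ds\<close> is described as the \<open>L\<^sup>2\<close> primitive of \<open>u\<close>; moreover
  \<open>\<integral>\<^sub>0\<^sup>t v(s) ds = u(t)\<close> because \<open>u(0) = 0\<close>. So the last line is the equation integrated
  over \<open>[0, t]\<close>. The condition \<open>in_dom_L \<theta> (u t)\<close> follows from \<open>u(t) \<in> H\<^sup>1\<close>.
\<close>

definition mild_solution ::
  "real \<Rightarrow> ('a::euclidean_space \<Rightarrow> complex) \<Rightarrow> (real \<Rightarrow> 'a \<Rightarrow> complex) \<Rightarrow> bool" where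
  "mild_solution \<theta> u1 u \<longleftrightarrow> continuous_into_H 1 u \<and>
     (\<exists>v w. has_L2_derivative u v \<and> continuous_into_L2 v \<and>
        (AE x in lborel. u 0 x = 0) \<and> (AE x in lborel. v 0 x = u1 x) \<and>
        has_L2_derivative w u \<and> (AE x in lborel. w 0 x = 0) \<and>
        (\<forall>t\<ge>0. in_H 2 (w t) \<and> in_dom_L \<theta> (u t) \<and>
           (AE x in lborel. v t x = u1 x + laplacian (w t) x - L_op \<theta> (u t) x)))"

end

theory Submission
  imports Defs "HOL-Probability.Characteristic_Functions"
begin

text \<open>
  On the Fourier side the problem decouples into damped oscillators
  \<open>y'' + l y' + r\<^sup>2 y = 0\<close> with \<open>r = |\<xi>|\<close> and \<open>l = log (1 + r\<^sup>2\<^sup>\<theta>)\<close>. For \<open>r \<ge> 1\<close> a modified energy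
  \<open>|y'|\<^sup>2 + r\<^sup>2|y|\<^sup>2 + 2 a Re (y \<bar>y')\<close> with a suitable constant \<open>a > 0\<close> decays
  exponentially, so only \<open>r < 1\<close> matters. There \<open>l \<le> r\<close> because \<open>\<theta> > 1/2\<close>, hence the
  roots are complex and the solution is \<open>e\<^sup>-\<^sup>l\<^sup>t\<^sup>/\<^sup>2 sin (\<omega> t) / \<omega>\<close> times the transform of
  \<open>u\<^sub>1\<close>, with \<open>\<omega>\<^sup>2 = r\<^sup>2 - l\<^sup>2/4\<close>. As this transform is bounded by the \<open>L\<^sup>1\<close> norm and tends to \<open>P\<^sub>1\<close>
  at the origin, both bounds reduce to the radial integral of
  \<open>r\<^sup>n\<^sup>-\<^sup>1 e\<^sup>-\<^sup>l\<^sup>t sin\<^sup>2 (\<omega> t) / \<omega>\<^sup>2\<close>, whose mass sits at \<open>r ~ t\<^sup>-\<^sup>1\<^sup>/\<^sup>2\<^sup>\<theta>\<close> for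
  \<open>n \<ge> 3\<close>, at \<open>r ~ 1/t\<close> for \<open>n = 1\<close>, and is spread logarithmically in between for \<open>n = 2\<close>.
  Well-definedness of the transform on \<open>L\<^sup>2\<close> (Plancherel, inversion) comes from Gaussian
  damping: the inverse transform of the damped transform of \<open>f\<close> is a Gaussian mean of \<open>f\<close>.
\<close>

text \<open>A mild solution satisfies the equation only after integration in time, and its transform
  at each time is a class modulo null sets, so no ordinary differential equation is available at a
  fixed frequency. The problem is therefore kept as a pair of curves in L^2 and cut to annuli, where
  |xi|^2 and the damping are bounded multipliers and the cut curves are differentiable. The modified
  energy serves twice: it gives the decay for |xi| >= 1, and, applied with zero data to the
  difference between the solution and the explicit propagator, it gives uniqueness and hence the
  formula on annuli inside the unit ball. The constant must not depend on the data, although the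
  time threshold may. The transform of u1 is close to P1 only on a ball whose radius depends on u1,
  so the lower bound has to come from shells that shrink to the origin as t grows, with a constant
  independent of that radius. Here theta > 1/2 enters once more: t times t^(-1/(2 theta)) tends to
  infinity, so many oscillations of sin (r t) fit in before the damping sets in.\<close>

section \<open>Closure properties of the set of square integrable functions\<close>

lemma in_L2_measurable [measurable_dest]: "in_L2 f \<Longrightarrow> f \<in> borel_measurable borel"
  by (simp add: in_L2_def)

lemma in_L2_integrable: "in_L2 f \<Longrightarrow> integrable lborel (\<lambda>x. (norm (f x))\<^sup>2)"
  by (simp add: in_L2_def)

lemma in_L2_bound:
  assumes f: "in_L2 f" and [measurable]: "g \<in> borel_measurable borel"
    and le: "AE x in lborel. norm (g x) \<le> c * norm (f x)"
  shows "in_L2 g"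
  unfolding in_L2_def
proof (intro conjI)
  show "integrable lborel (\<lambda>x. (norm (g x))\<^sup>2)"
  proof (rule Bochner_Integration.integrable_bound)
    show "integrable lborel (\<lambda>x. c\<^sup>2 * (norm (f x))\<^sup>2)"
      using in_L2_integrable[OF f] by simp
    show "AE x in lborel. norm ((norm (g x))\<^sup>2) \<le> norm (c\<^sup>2 * (norm (f x))\<^sup>2)"
      using le
    proof eventually_elim
      case (elim x)
      then have "(norm (g x))\<^sup>2 \<le> (c * norm (f x))\<^sup>2"
        by (intro power_mono) auto
      then show ?case by (simp add: power_mult_distrib)
    qed
  qed measurable
qed simp

lemma in_L2_zero: "in_L2 (\<lambda>x. 0)"
  by (simp add: in_L2_def)

lemma in_L2_add:
  assumes f: "in_L2 f" and g: "in_L2 g"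
  shows "in_L2 (\<lambda>x. f x + g x)"
  unfolding in_L2_def
proof (intro conjI)
  note [measurable] = in_L2_measurable[OF f] in_L2_measurable[OF g]
  show "(\<lambda>x. f x + g x) \<in> borel_measurable lborel" by measurable
  show "integrable lborel (\<lambda>x. (norm (f x + g x))\<^sup>2)"
  proof (rule Bochner_Integration.integrable_bound)
    show "integrable lborel (\<lambda>x. 2 * (norm (f x))\<^sup>2 + 2 * (norm (g x))\<^sup>2)"
      using in_L2_integrable[OF f] in_L2_integrable[OF g] by simp
    show "AE x in lborel. norm ((norm (f x + g x))\<^sup>2)
      \<le> norm (2 * (norm (f x))\<^sup>2 + 2 * (norm (g x))\<^sup>2)"
    proof (rule AE_I2)
      fix x
      have "(norm (f x + g x))\<^sup>2 \<le> (norm (f x) + norm (g x))\<^sup>2"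
        by (intro power_mono norm_triangle_ineq) auto
      also have "\<dots> \<le> 2 * (norm (f x))\<^sup>2 + 2 * (norm (g x))\<^sup>2"
        using sum_squares_bound[of "norm (f x)" "norm (g x)"] by (simp add: power2_sum)
      finally show "norm ((norm (f x + g x))\<^sup>2)
        \<le> norm (2 * (norm (f x))\<^sup>2 + 2 * (norm (g x))\<^sup>2)" by simp
    qed
  qed measurable
qed

lemma in_L2_scaleR: "in_L2 f \<Longrightarrow> in_L2 (\<lambda>x. (c::real) *\<^sub>R f x)"
  by (rule in_L2_bound[where c="\<bar>c\<bar>"]) (auto simp: in_L2_def)

lemma in_L2_uminus: "in_L2 f \<Longrightarrow> in_L2 (\<lambda>x. - f x)"
  by (simp add: in_L2_def)

lemma in_L2_diff: "in_L2 f \<Longrightarrow> in_L2 g \<Longrightarrow> in_L2 (\<lambda>x. f x - g x)"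
  using in_L2_add[of f "\<lambda>x. - g x"] in_L2_uminus[of g] by simp

lemma in_L2_inner_integrable:
  assumes f: "in_L2 f" and g: "in_L2 g"
  shows "integrable lborel (\<lambda>x. f x \<bullet> g x)"
proof (rule Bochner_Integration.integrable_bound)
  show "integrable lborel (\<lambda>x. (norm (f x))\<^sup>2 + (norm (g x))\<^sup>2)"
    using in_L2_integrable[OF f] in_L2_integrable[OF g] by simp
  show "(\<lambda>x. f x \<bullet> g x) \<in> borel_measurable lborel"
    using in_L2_measurable[OF f] in_L2_measurable[OF g] by simp
  show "AE x in lborel. norm (f x \<bullet> g x) \<le> norm ((norm (f x))\<^sup>2 + (norm (g x))\<^sup>2)"
  proof (rule AE_I2)
    fix x
    have "\<bar>f x \<bullet> g x\<bar> \<le> norm (f x) * norm (g x)" by (rule Cauchy_Schwarz_ineq2)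
    also have "2 * (norm (f x) * norm (g x)) \<le> (norm (f x))\<^sup>2 + (norm (g x))\<^sup>2"
      using sum_squares_bound[of "norm (f x)" "norm (g x)"] by simp
    then have "norm (f x) * norm (g x) \<le> (norm (f x))\<^sup>2 + (norm (g x))\<^sup>2"
      by (smt (verit) mult_nonneg_nonneg norm_ge_zero)
    finally show "norm (f x \<bullet> g x) \<le> norm ((norm (f x))\<^sup>2 + (norm (g x))\<^sup>2)" by simp
  qed
qed

lemma L2_norm_nonneg [simp]: "0 \<le> L2_norm f"
  by (simp add: L2_norm_def)

lemma L2_norm_power2: "(L2_norm f)\<^sup>2 = (LINT x|lborel. (norm (f x))\<^sup>2)"
  by (simp add: L2_norm_def)

lemma nn_integral_L2_norm:
  assumes "in_L2 f"
  shows "(\<integral>\<^sup>+x. ennreal ((norm (f x))\<^sup>2) \<partial>lborel) = ennreal ((L2_norm f)\<^sup>2)"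
  using in_L2_integrable[OF assms] by (simp add: nn_integral_eq_integral L2_norm_def)

text \<open>A bound on \<open>L2_norm\<close> alone says nothing about membership, because the
  Bochner integral is 0 for a function that is not integrable. Estimates that must also establish
  square integrability are therefore made on nonnegative integrals and enter here.\<close>

lemma in_L2_nn_bound:
  assumes [measurable]: "f \<in> borel_measurable borel" and c: "0 \<le> c"
    and le: "(\<integral>\<^sup>+x. ennreal ((norm (f x))\<^sup>2) \<partial>lborel) \<le> ennreal (c\<^sup>2)"
  shows "in_L2 f" "L2_norm f \<le> c"
proof -
  have "integrable lborel (\<lambda>x. (norm (f x))\<^sup>2)"
    using le by (intro integrableI_bounded) (auto simp: le_less_trans[OF _ ennreal_less_top])
  then show *: "in_L2 f" by (simp add: in_L2_def)
  then have "(L2_norm f)\<^sup>2 \<le> c\<^sup>2"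
    using le nn_integral_L2_norm[OF *] by (simp add: ennreal_le_iff)
  then show "L2_norm f \<le> c" using c by (rule power2_le_imp_le)
qed

section \<open>The Hilbert space of square integrable functions\<close>

\<comment> \<open>Classes modulo null sets form a type so that derivatives, bounded linear maps,
  Cauchy sequences and limits become available through the type classes. The relation is partial:
  functions outside \<open>in_L2\<close> belong to no class.\<close>
quotient_type (overloaded) 'a l2 = "'a::euclidean_space \<Rightarrow> complex" / partial:
  "\<lambda>f g. in_L2 f \<and> in_L2 g \<and> (AE x in lborel. f x = g x)"
  morphisms rep_l2 abs_l2
proof (rule part_equivpI)
  show "\<exists>f::'a \<Rightarrow> complex. in_L2 f \<and> in_L2 f \<and> (AE x in lborel. f x = f x)"
    using in_L2_zero by auto
  show "symp (\<lambda>f g::'a \<Rightarrow> complex. in_L2 f \<and> in_L2 g \<and> (AE x in lborel. f x = g x))"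
  proof (rule sympI, elim conjE, intro conjI)
    fix f g :: "'a \<Rightarrow> complex"
    assume "AE x in lborel. f x = g x"
    then show "AE x in lborel. g x = f x" by eventually_elim simp
  qed
  show "transp (\<lambda>f g::'a \<Rightarrow> complex. in_L2 f \<and> in_L2 g \<and> (AE x in lborel. f x = g x))"
  proof (rule transpI, elim conjE, intro conjI)
    fix f g h :: "'a \<Rightarrow> complex"
    assume "AE x in lborel. f x = g x" "AE x in lborel. g x = h x"
    then show "AE x in lborel. f x = h x" by eventually_elim simp
  qed
qed

lemma in_L2_rep [simp, intro]: "in_L2 (rep_l2 x)"
  using Quotient_rep_reflp[OF Quotient_l2] by blast

lemma abs_rep_l2 [simp]: "abs_l2 (rep_l2 x) = x"
  by (rule Quotient_abs_rep[OF Quotient_l2])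

lemma abs_l2_eq_iff:
  assumes "in_L2 f" "in_L2 g"
  shows "abs_l2 f = abs_l2 g \<longleftrightarrow> (AE x in lborel. f x = g x)"
  using Quotient_rel[OF Quotient_l2, of f g] assms by auto

lemma rep_abs_l2:
  assumes "in_L2 f"
  shows "AE x in lborel. rep_l2 (abs_l2 f) x = f x"
  using abs_l2_eq_iff[of "rep_l2 (abs_l2 f)" f] assms by simp

instantiation l2 :: (euclidean_space) real_inner
begin

lift_definition zero_l2 :: "'a l2" is "\<lambda>x. 0"
  by (simp add: in_L2_zero)

lift_definition plus_l2 :: "'a l2 \<Rightarrow> 'a l2 \<Rightarrow> 'a l2" is "\<lambda>f g x. f x + g x"
proof (elim conjE, intro conjI)
  fix f g h k :: "'a \<Rightarrow> complex"
  assume "AE x in lborel. f x = g x" "AE x in lborel. h x = k x"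
  then show "AE x in lborel. f x + h x = g x + k x" by eventually_elim simp
qed (erule (1) in_L2_add)+

lift_definition minus_l2 :: "'a l2 \<Rightarrow> 'a l2 \<Rightarrow> 'a l2" is "\<lambda>f g x. f x - g x"
proof (elim conjE, intro conjI)
  fix f g h k :: "'a \<Rightarrow> complex"
  assume "AE x in lborel. f x = g x" "AE x in lborel. h x = k x"
  then show "AE x in lborel. f x - h x = g x - k x" by eventually_elim simp
qed (erule (1) in_L2_diff)+

lift_definition uminus_l2 :: "'a l2 \<Rightarrow> 'a l2" is "\<lambda>f x. - f x"
proof (elim conjE, intro conjI)
  fix f g :: "'a \<Rightarrow> complex"
  assume "AE x in lborel. f x = g x"
  then show "AE x in lborel. - f x = - g x" by eventually_elim simp
qed (erule in_L2_uminus)+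

lift_definition scaleR_l2 :: "real \<Rightarrow> 'a l2 \<Rightarrow> 'a l2" is "\<lambda>c f x. c *\<^sub>R f x"
proof (elim conjE, intro conjI)
  fix f g :: "'a \<Rightarrow> complex" and c :: real
  assume "AE x in lborel. f x = g x"
  then show "AE x in lborel. c *\<^sub>R f x = c *\<^sub>R g x" by eventually_elim simp
qed (erule in_L2_scaleR)+

text \<open>On complex values the dot is the real part of the Hermitian product, so the space is a
  real Hilbert space. This is enough, since all multipliers of the problem are real.\<close>

lift_definition inner_l2 :: "'a l2 \<Rightarrow> 'a l2 \<Rightarrow> real" is "\<lambda>f g. LINT x|lborel. f x \<bullet> g x"
proof (elim conjE)
  fix f g h k :: "'a \<Rightarrow> complex"
  assume *: "in_L2 f" "in_L2 g" "in_L2 h" "in_L2 k"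
    and ae: "AE x in lborel. f x = g x" "AE x in lborel. h x = k x"
  from ae have "AE x in lborel. f x \<bullet> h x = g x \<bullet> k x" by eventually_elim simp
  with * show "(LINT x|lborel. f x \<bullet> h x) = (LINT x|lborel. g x \<bullet> k x)"
    by (intro integral_cong_AE) (auto intro!: borel_measurable_integrable in_L2_inner_integrable)
qed

definition norm_l2 :: "'a l2 \<Rightarrow> real" where "norm_l2 x = sqrt (x \<bullet> x)"
definition sgn_l2 :: "'a l2 \<Rightarrow> 'a l2" where "sgn_l2 x = scaleR (inverse (norm x)) x"
definition dist_l2 :: "'a l2 \<Rightarrow> 'a l2 \<Rightarrow> real" where "dist_l2 x y = norm (x - y)"
definition uniformity_l2 :: "('a l2 \<times> 'a l2) filter" where
  "uniformity_l2 = (INF e\<in>{0 <..}. principal {(x, y). dist x y < e})"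
definition open_l2 :: "'a l2 set \<Rightarrow> bool" where
  "open_l2 U = (\<forall>x\<in>U. eventually (\<lambda>(x', y). x' = x \<longrightarrow> y \<in> U) uniformity)"

instance
proof
  fix x y z :: "'a l2" and r s :: real
  show "x + y + z = x + (y + z)" by transfer (auto simp: add.assoc intro!: in_L2_add)
  show "x + y = y + x" by transfer (auto simp: add.commute intro!: in_L2_add)
  show "0 + x = x" by transfer auto
  show "- x + x = 0" by transfer (simp add: in_L2_zero)
  show "x - y = x + - y" by transfer (auto intro: in_L2_diff)
  show "r *\<^sub>R (x + y) = r *\<^sub>R x + r *\<^sub>R y"
    by transfer (auto simp: algebra_simps intro!: in_L2_add in_L2_scaleR)
  show "(r + s) *\<^sub>R x = r *\<^sub>R x + s *\<^sub>R x"
    by transfer (auto simp: algebra_simps intro!: in_L2_add in_L2_scaleR)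
  show "r *\<^sub>R s *\<^sub>R x = (r * s) *\<^sub>R x"
    by transfer (auto simp: in_L2_scaleR mult.assoc)
  show "1 *\<^sub>R x = x" by transfer auto
  show "x \<bullet> y = y \<bullet> x" by transfer (simp add: inner_commute)
  show "(x + y) \<bullet> z = x \<bullet> z + y \<bullet> z"
    by transfer (auto simp: inner_add_left in_L2_inner_integrable)
  show "r *\<^sub>R x \<bullet> y = r * (x \<bullet> y)"
    by transfer auto
  show "0 \<le> x \<bullet> x" by transfer (auto intro!: integral_nonneg_AE)
  show "(x \<bullet> x = 0) = (x = 0)"
  proof transfer
    fix f :: "'a \<Rightarrow> complex"
    assume "in_L2 f \<and> in_L2 f \<and> (AE x in lborel. f x = f x)"
    then have f: "in_L2 f" by simp
    show "((LINT x|lborel. f x \<bullet> f x) = 0) =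
        (in_L2 f \<and> in_L2 (\<lambda>x::'a. 0) \<and> (AE x in lborel. f x = 0))"
      using f integral_nonneg_eq_0_iff_AE[OF in_L2_inner_integrable[OF f f]]
      by (simp add: in_L2_zero)
  qed
qed (simp_all add: norm_l2_def sgn_l2_def dist_l2_def uniformity_l2_def open_l2_def)

end

lemma abs_l2_add: "in_L2 f \<Longrightarrow> in_L2 g \<Longrightarrow> abs_l2 f + abs_l2 g = abs_l2 (\<lambda>x. f x + g x)"
  by (rule plus_l2.abs_eq) auto

lemma abs_l2_diff: "in_L2 f \<Longrightarrow> in_L2 g \<Longrightarrow> abs_l2 f - abs_l2 g = abs_l2 (\<lambda>x. f x - g x)"
  by (rule minus_l2.abs_eq) auto

lemma abs_l2_scaleR: "in_L2 f \<Longrightarrow> c *\<^sub>R abs_l2 f = abs_l2 (\<lambda>x. c *\<^sub>R f x)"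
  by (rule scaleR_l2.abs_eq) auto

lemma abs_l2_inner: "in_L2 f \<Longrightarrow> in_L2 g \<Longrightarrow> abs_l2 f \<bullet> abs_l2 g = (LINT x|lborel. f x \<bullet> g x)"
  by (rule inner_l2.abs_eq) auto

lemma norm_abs_l2: "in_L2 f \<Longrightarrow> norm (abs_l2 f) = L2_norm f"
  by (simp add: norm_eq_sqrt_inner abs_l2_inner L2_norm_def power2_norm_eq_inner)

lemma inner_l2_rep: "x \<bullet> y = (LINT \<xi>|lborel. rep_l2 x \<xi> \<bullet> rep_l2 y \<xi>)"
  using abs_l2_inner[of "rep_l2 x" "rep_l2 y"] by simp

lemma norm_l2_rep: "norm x = L2_norm (rep_l2 x)"
  using norm_abs_l2[of "rep_l2 x"] by simp

lemma abs_l2_cong: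
  assumes "in_L2 f" and "g \<in> borel_measurable borel" and "AE x in lborel. f x = g x"
  shows "abs_l2 f = abs_l2 g"
proof -
  have "in_L2 g" by (rule in_L2_bound[where c=1, OF assms(1,2)]) (use assms(3) in auto)
  with assms show ?thesis by (simp add: abs_l2_eq_iff)
qed

text \<open>The membership clauses stay on the right because \<open>abs_l2\<close> has no useful
  value outside \<open>in_L2\<close>.\<close>

lemma L2_tendsto_iff:
  "L2_tendsto f l F \<longleftrightarrow>
    (\<forall>\<^sub>F y in F. in_L2 (f y)) \<and> in_L2 l \<and> ((\<lambda>y. abs_l2 (f y)) \<longlongrightarrow> abs_l2 l) F"
proof -
  have "((\<lambda>y. L2_norm (\<lambda>x. f y x - l x)) \<longlongrightarrow> 0) F \<longleftrightarrow> ((\<lambda>y. abs_l2 (f y)) \<longlongrightarrow> abs_l2 l) F"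
    if *: "\<forall>\<^sub>F y in F. in_L2 (f y)" "in_L2 l"
  proof -
    have "\<forall>\<^sub>F y in F. L2_norm (\<lambda>x. f y x - l x) = norm (abs_l2 (f y) - abs_l2 l)"
      using *(1) by eventually_elim (simp add: abs_l2_diff *(2) norm_abs_l2 in_L2_diff)
    from tendsto_cong[OF this] show ?thesis
      by (simp add: tendsto_norm_zero_iff LIM_zero_iff)
  qed
  then show ?thesis unfolding L2_tendsto_def by auto
qed

lemma ennreal_suminf_term_le:
  fixes g :: "nat \<Rightarrow> real"
  assumes "(\<Sum>k. ennreal (g k)) = ennreal C" "0 \<le> C"
  shows "g k \<le> C"
proof -
  have "ennreal (g k) = (\<Sum>j\<in>{k}. ennreal (g j))" by simp
  also have "\<dots> \<le> (\<Sum>k. ennreal (g k))"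
    by (rule sum_le_suminf[OF summableI]) auto
  finally show ?thesis using assms by (simp only: ennreal_le_iff)
qed

text \<open>The weight 2^k keeps the argument on squares: the sum of 2^k |d_k|^2 over the successive
  differences d_k has integral at most the sum of 2^-k, so it is finite almost everywhere. Where it
  equals C, each |d_k| is at most sqrt C times 2^(-k/2), and the telescoping series converges
  absolutely.\<close>

lemma L2_Cauchy_AE_convergent:
  fixes f :: "nat \<Rightarrow> 'a::euclidean_space \<Rightarrow> complex"
  assumes f: "\<And>k. in_L2 (f k)"
    and d: "\<And>k. L2_norm (\<lambda>x. f (Suc k) x - f k x) \<le> (1/2) ^ k"
  shows "AE x in lborel. convergent (\<lambda>k. f k x)"
proof -
  note [measurable] = in_L2_measurable[OF f]
  let ?d = "\<lambda>k x. norm (f (Suc k) x - f k x)"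
  have "(\<integral>\<^sup>+x. (\<Sum>k. ennreal (2 ^ k * (?d k x)\<^sup>2)) \<partial>lborel)
      = (\<Sum>k. \<integral>\<^sup>+x. ennreal (2 ^ k * (?d k x)\<^sup>2) \<partial>lborel)"
    by (intro nn_integral_suminf) measurable
  also have "\<dots> \<le> (\<Sum>k. ennreal ((1/2) ^ k))"
  proof (rule suminf_le)
    fix k
    have "(\<integral>\<^sup>+x. ennreal (2 ^ k * (?d k x)\<^sup>2) \<partial>lborel)
        = ennreal (2 ^ k) * (\<integral>\<^sup>+x. ennreal ((?d k x)\<^sup>2) \<partial>lborel)"
      by (simp add: ennreal_mult nn_integral_cmult)
    also have "\<dots> = ennreal (2 ^ k * (L2_norm (\<lambda>x. f (Suc k) x - f k x))\<^sup>2)"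
      by (simp add: nn_integral_L2_norm in_L2_diff f ennreal_mult)
    also have "\<dots> \<le> ennreal (2 ^ k * ((1/2) ^ k)\<^sup>2)"
      using d[of k] by (intro ennreal_leI mult_left_mono power_mono) (auto simp: L2_norm_def)
    also have "2 ^ k * ((1/2) ^ k)\<^sup>2 = (1/2::real) ^ k"
      by (simp add: power2_eq_square power_divide)
    finally show "(\<integral>\<^sup>+x. ennreal (2 ^ k * (?d k x)\<^sup>2) \<partial>lborel) \<le> ennreal ((1/2) ^ k)" .
  qed auto
  also have "\<dots> = ennreal (\<Sum>k. (1/2) ^ k)"
    by (intro suminf_ennreal2) (auto intro: summable_geometric)
  also have "\<dots> < \<infinity>" by simp
  finally have fin: "(\<integral>\<^sup>+x. (\<Sum>k. ennreal (2 ^ k * (?d k x)\<^sup>2)) \<partial>lborel) \<noteq> \<infinity>"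
    by (rule less_imp_neq)
  have "AE x in lborel. (\<Sum>k. ennreal (2 ^ k * (?d k x)\<^sup>2)) \<noteq> \<infinity>"
    by (rule nn_integral_PInf_AE[OF _ fin]) measurable
  then show ?thesis
  proof eventually_elim
    case (elim x)
    define S where "S = (\<Sum>k. ennreal (2 ^ k * (?d k x)\<^sup>2))"
    have "S \<noteq> \<infinity>" unfolding S_def by (fact elim)
    then obtain C where C: "S = ennreal C" "0 \<le> C" by (cases S) auto
    have le: "?d k x \<le> sqrt C * (1 / sqrt 2) ^ k" for k
    proof -
      have "2 ^ k * (?d k x)\<^sup>2 \<le> C"
        by (rule ennreal_suminf_term_le[OF C[unfolded S_def]])
      then have "(?d k x)\<^sup>2 \<le> C / 2 ^ k" by (simp add: field_simps)
      then have "?d k x \<le> sqrt (C / 2 ^ k)" by (rule real_le_rsqrt)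
      also have "\<dots> = sqrt C * (1 / sqrt 2) ^ k"
        by (simp only: real_sqrt_divide real_sqrt_power power_divide power_one
            times_divide_eq_right mult_1_right)
      finally show ?thesis .
    qed
    have "summable (\<lambda>k. f (Suc k) x - f k x)"
    proof (rule summable_comparison_test'[OF summable_mult[OF summable_geometric]])
      show "norm (1 / sqrt 2) < 1" by simp
      show "norm (f (Suc k) x - f k x) \<le> sqrt C * (1 / sqrt 2) ^ k" for k by (rule le)
    qed
    then have "convergent (\<lambda>n. \<Sum>k<n. f (Suc k) x - f k x)"
      by (simp only: summable_iff_convergent)
    then have "convergent (\<lambda>n. f n x - f 0 x)"
      by (simp only: sum_lessThan_telescope[of "\<lambda>n. f n x"])
    then show "convergent (\<lambda>n. f n x)"
      by (simp only: convergent_diff_const_right_iff)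
  qed
qed

text \<open>Fatou's lemma identifies the almost everywhere limit of a subsequence as the \<open>L\<^sup>2\<close> limit.\<close>

instance l2 :: (euclidean_space) complete_space
proof
  fix X :: "nat \<Rightarrow> 'a l2"
  assume X: "Cauchy X"
  have "\<forall>k. \<exists>N. \<forall>m\<ge>N. \<forall>n\<ge>N. norm (X m - X n) < (1/2) ^ k"
    using X by (simp add: Cauchy_iff)
  then obtain N where N: "\<And>k m n. m \<ge> N k \<Longrightarrow> n \<ge> N k \<Longrightarrow> norm (X m - X n) < (1/2) ^ k"
    by metis
  \<comment> \<open>The partial sum dominates \<open>N k\<close>, and the extra \<open>k\<close>
    makes \<open>r\<close> strictly increasing even where \<open>N\<close> vanishes.\<close>
  define r where "r k = (\<Sum>i\<le>k. N i) + k" for k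
  have r: "r k \<ge> N k" for k
    unfolding r_def using member_le_sum[of k "{..k}" N] by auto
  have r': "strict_mono r"
    unfolding strict_mono_Suc_iff r_def by simp
  define f where "f k = rep_l2 (X (r k))" for k
  have f: "in_L2 (f k)" for k by (simp add: f_def)
  have Xf: "X (r k) = abs_l2 (f k)" for k by (simp add: f_def)
  have fd: "L2_norm (\<lambda>x. f m x - f k x) \<le> (1/2) ^ k" if "m \<ge> k" for m k
  proof -
    have "r m \<ge> r k" using that r' by (simp add: strict_mono_less_eq)
    then have "norm (X (r m) - X (r k)) \<le> (1/2) ^ k"
      using N[of k "r m" "r k"] r[of k] by force
    then show ?thesis by (simp add: Xf abs_l2_diff f norm_abs_l2 in_L2_diff)
  qed
  note [measurable] = in_L2_measurable[OF f]
  define g where "g x = lim (\<lambda>k. f k x)" for x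
  have [measurable]: "g \<in> borel_measurable borel"
    unfolding g_def by measurable
  have conv: "AE x in lborel. (\<lambda>k. f k x) \<longlonglongrightarrow> g x"
    using L2_Cauchy_AE_convergent[of f, OF f fd] by (auto simp: g_def convergent_LIMSEQ_iff)
  have bound: "(\<integral>\<^sup>+x. ennreal ((norm (g x - f k x))\<^sup>2) \<partial>lborel) \<le> ennreal (((1/2) ^ k)\<^sup>2)" for k
  proof -
    have "(\<integral>\<^sup>+x. ennreal ((norm (g x - f k x))\<^sup>2) \<partial>lborel)
        = (\<integral>\<^sup>+x. liminf (\<lambda>m. ennreal ((norm (f m x - f k x))\<^sup>2)) \<partial>lborel)"
    proof (intro nn_integral_cong_AE)
      show "AE x in lborel. ennreal ((norm (g x - f k x))\<^sup>2)
          = liminf (\<lambda>m. ennreal ((norm (f m x - f k x))\<^sup>2))"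
        using conv
      proof eventually_elim
        case (elim x)
        then have "(\<lambda>m. ennreal ((norm (f m x - f k x))\<^sup>2)) \<longlonglongrightarrow> ennreal ((norm (g x - f k x))\<^sup>2)"
          by (intro tendsto_ennrealI tendsto_intros)
        then show ?case by (rule lim_imp_Liminf[OF sequentially_bot, symmetric])
      qed
    qed
    also have "\<dots> \<le> liminf (\<lambda>m. \<integral>\<^sup>+x. ennreal ((norm (f m x - f k x))\<^sup>2) \<partial>lborel)"
      by (rule nn_integral_liminf) measurable
    also have "\<dots> \<le> liminf (\<lambda>m. ennreal (((1/2) ^ k)\<^sup>2))"
    proof (rule Liminf_mono, rule eventually_mono[OF eventually_ge_at_top[of k]])
      fix m assume "k \<le> m"
      then show "(\<integral>\<^sup>+x. ennreal ((norm (f m x - f k x))\<^sup>2) \<partial>lborel) \<le> ennreal (((1/2) ^ k)\<^sup>2)"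
        using fd[of k m] f
        by (auto simp: nn_integral_L2_norm in_L2_diff intro!: ennreal_leI power_mono L2_norm_nonneg)
    qed
    also have "\<dots> = ennreal (((1/2) ^ k)\<^sup>2)" by (simp add: Liminf_const)
    finally show ?thesis .
  qed
  have gf: "in_L2 (\<lambda>x. g x - f k x)" "L2_norm (\<lambda>x. g x - f k x) \<le> (1/2) ^ k" for k
    using in_L2_nn_bound[OF _ _ bound[of k]] by auto
  have g: "in_L2 g" using in_L2_add[OF gf(1) f, of 0 0] by simp
  have "(\<lambda>k. abs_l2 g - abs_l2 (f k)) \<longlonglongrightarrow> 0"
  proof (rule Lim_null_comparison)
    show "\<forall>\<^sub>F k in sequentially. norm (abs_l2 g - abs_l2 (f k)) \<le> (1/2) ^ k"
      using gf(2) by (simp add: abs_l2_diff g f norm_abs_l2 gf(1))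
  qed (rule LIMSEQ_power_zero, simp)
  then have "(\<lambda>k. abs_l2 (f k)) \<longlonglongrightarrow> abs_l2 g"
    using tendsto_diff[OF tendsto_const[of "abs_l2 g"]] by fastforce
  then have "(X \<circ> r) \<longlonglongrightarrow> abs_l2 g" by (simp add: comp_def Xf)
  with X r' have "X \<longlonglongrightarrow> abs_l2 g" by (rule Cauchy_converges_subseq)
  then show "convergent X" by (rule convergentI)
qed

section \<open>Multiplication operators\<close>

definition bounded_symbol :: "('a::euclidean_space \<Rightarrow> real) \<Rightarrow> bool" where
  "bounded_symbol m \<longleftrightarrow> m \<in> borel_measurable borel \<and> (\<exists>K. \<forall>\<xi>. \<bar>m \<xi>\<bar> \<le> K)"

definition mult_l2 :: "('a::euclidean_space \<Rightarrow> real) \<Rightarrow> 'a l2 \<Rightarrow> 'a l2" where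
  "mult_l2 m x = abs_l2 (\<lambda>\<xi>. m \<xi> *\<^sub>R rep_l2 x \<xi>)"

lemma bounded_symbolI: "m \<in> borel_measurable borel \<Longrightarrow> (\<And>\<xi>. \<bar>m \<xi>\<bar> \<le> K) \<Longrightarrow> bounded_symbol m"
  by (auto simp: bounded_symbol_def)

lemma bounded_symbol_measurable: "bounded_symbol m \<Longrightarrow> m \<in> borel_measurable borel"
  by (simp add: bounded_symbol_def)

lemma in_L2_mult:
  assumes "bounded_symbol m" "in_L2 f"
  shows "in_L2 (\<lambda>\<xi>. m \<xi> *\<^sub>R f \<xi>)"
proof -
  obtain K where "\<And>\<xi>. \<bar>m \<xi>\<bar> \<le> K" using assms(1) by (auto simp: bounded_symbol_def)
  then show ?thesis
    using bounded_symbol_measurable[OF assms(1)] in_L2_measurable[OF assms(2)]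
    by (intro in_L2_bound[OF assms(2), where c=K]) (auto intro!: mult_right_mono)
qed

lemma mult_l2_abs:
  assumes m: "bounded_symbol m" and f: "in_L2 f"
  shows "mult_l2 m (abs_l2 f) = abs_l2 (\<lambda>\<xi>. m \<xi> *\<^sub>R f \<xi>)"
  unfolding mult_l2_def using rep_abs_l2[OF f] in_L2_mult[OF m] f
  by (subst abs_l2_eq_iff) auto

lemma norm_mult_l2_le:
  assumes m: "bounded_symbol m" and K: "\<And>\<xi>. \<bar>m \<xi>\<bar> \<le> K"
  shows "norm (mult_l2 m x) \<le> K * norm x"
proof -
  have K0: "0 \<le> K" using K[of 0] by linarith
  have "(LINT \<xi>|lborel. (norm (m \<xi> *\<^sub>R rep_l2 x \<xi>))\<^sup>2) \<le> (LINT \<xi>|lborel. K\<^sup>2 * (norm (rep_l2 x \<xi>))\<^sup>2)"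
  proof (rule integral_mono)
    show "integrable lborel (\<lambda>\<xi>. (norm (m \<xi> *\<^sub>R rep_l2 x \<xi>))\<^sup>2)"
      by (rule in_L2_integrable[OF in_L2_mult[OF m in_L2_rep]])
    show "(norm (m \<xi> *\<^sub>R rep_l2 x \<xi>))\<^sup>2 \<le> K\<^sup>2 * (norm (rep_l2 x \<xi>))\<^sup>2" for \<xi>
      unfolding norm_scaleR power_mult_distrib
      by (intro mult_right_mono power_mono K) auto
    show "integrable lborel (\<lambda>\<xi>. K\<^sup>2 * (norm (rep_l2 x \<xi>))\<^sup>2)"
      by (intro integrable_mult_right in_L2_integrable in_L2_rep)
  qed
  also have "\<dots> = (K * norm x)\<^sup>2"
    by (simp only: norm_l2_rep L2_norm_power2 power_mult_distrib integral_mult_right_zero)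
  finally have "(norm (mult_l2 m x))\<^sup>2 \<le> (K * norm x)\<^sup>2"
    by (simp only: mult_l2_def norm_abs_l2 in_L2_mult[OF m in_L2_rep] L2_norm_power2)
  then show ?thesis by (rule power2_le_imp_le) (simp add: K0)
qed

lemma bounded_linear_mult_l2:
  assumes m: "bounded_symbol m"
  shows "bounded_linear (mult_l2 m)"
proof -
  obtain K where K: "\<And>\<xi>. \<bar>m \<xi>\<bar> \<le> K" using m by (auto simp: bounded_symbol_def)
  show ?thesis
  proof (rule bounded_linear_intro)
    fix x y :: "'a l2" and c :: real
    have "mult_l2 m (abs_l2 (rep_l2 x) + abs_l2 (rep_l2 y))
        = abs_l2 (\<lambda>\<xi>. m \<xi> *\<^sub>R rep_l2 x \<xi> + m \<xi> *\<^sub>R rep_l2 y \<xi>)"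
      by (simp only: abs_l2_add in_L2_rep mult_l2_abs[OF m] in_L2_add scaleR_add_right)
    also have "\<dots> = mult_l2 m x + mult_l2 m y"
      unfolding mult_l2_def by (rule abs_l2_add[symmetric]; rule in_L2_mult[OF m in_L2_rep])
    finally show "mult_l2 m (x + y) = mult_l2 m x + mult_l2 m y" by (simp only: abs_rep_l2)
    have "mult_l2 m (c *\<^sub>R abs_l2 (rep_l2 x)) = abs_l2 (\<lambda>\<xi>. m \<xi> *\<^sub>R c *\<^sub>R rep_l2 x \<xi>)"
      by (simp only: abs_l2_scaleR in_L2_rep mult_l2_abs[OF m] in_L2_scaleR)
    also have "\<dots> = abs_l2 (\<lambda>\<xi>. c *\<^sub>R m \<xi> *\<^sub>R rep_l2 x \<xi>)"
      by (simp only: scaleR_left_commute)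
    also have "\<dots> = c *\<^sub>R mult_l2 m x"
      unfolding mult_l2_def by (rule abs_l2_scaleR[symmetric, OF in_L2_mult[OF m in_L2_rep]])
    finally show "mult_l2 m (c *\<^sub>R x) = c *\<^sub>R mult_l2 m x" by (simp only: abs_rep_l2)
    show "norm (mult_l2 m x) \<le> norm x * K"
      using norm_mult_l2_le[OF m K] by (simp add: mult.commute)
  qed
qed

lemma mult_l2_inner:
  assumes m: "bounded_symbol m"
  shows "mult_l2 m x \<bullet> y = (LINT \<xi>|lborel. m \<xi> * (rep_l2 x \<xi> \<bullet> rep_l2 y \<xi>))"
  using abs_l2_inner[OF in_L2_mult[OF m in_L2_rep] in_L2_rep, of x y] by (simp add: mult_l2_def)

section \<open>Gaussians\<close>

lemma lborel_integral_affine: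
  fixes f :: "'a::euclidean_space \<Rightarrow> 'b::{banach, second_countable_topology}"
  assumes [measurable]: "f \<in> borel_measurable borel" and c: "c \<noteq> 0"
  shows "(LINT x|lborel. f x) = \<bar>c\<bar> ^ DIM('a) *\<^sub>R (LINT x|lborel. f (t + c *\<^sub>R x))"
  by (subst lborel_affine[OF c, of t]) (simp add: integral_density integral_distr)

lemma lborel_integrable_affine:
  fixes f :: "'a::euclidean_space \<Rightarrow> 'b::{banach, second_countable_topology}"
  assumes [measurable]: "f \<in> borel_measurable borel" and c: "c \<noteq> 0"
  shows "integrable lborel f \<longleftrightarrow> integrable lborel (\<lambda>x. f (t + c *\<^sub>R x))"
proof -
  have scale: "integrable lborel (\<lambda>x. a *\<^sub>R h x) \<longleftrightarrow> integrable lborel h"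
    if "a \<noteq> 0" for a and h :: "'a \<Rightarrow> 'b"
    using that integrable_scaleR_right[of "inverse a" lborel "\<lambda>x. a *\<^sub>R h x"]
      integrable_scaleR_right[of a lborel h] by auto
  show ?thesis
    using c by (subst lborel_affine[OF c, of t])
      (simp add: integrable_density integrable_distr_eq scale)
qed

lemma in_L2_affine:
  fixes f :: "'a::euclidean_space \<Rightarrow> complex"
  assumes f: "in_L2 f" and c: "c \<noteq> 0"
  shows "in_L2 (\<lambda>x. f (t + c *\<^sub>R x))"
  using f lborel_integrable_affine[OF _ c, of "\<lambda>x. (norm (f x))\<^sup>2" t]
  by (auto simp: in_L2_def)

lemma L2_norm_translate:
  assumes "in_L2 f"
  shows "L2_norm (\<lambda>x. f (x + z)) = L2_norm f"
  using lborel_integral_affine[of "\<lambda>x. (norm (f x))\<^sup>2" 1 z] in_L2_measurable[OF assms]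
  by (simp add: L2_norm_def add.commute)

lemma L2_norm_reflect:
  assumes "in_L2 f"
  shows "L2_norm (\<lambda>x. f (- x)) = L2_norm f"
  using lborel_integral_affine[of "\<lambda>x. (norm (f x))\<^sup>2" "-1" 0] in_L2_measurable[OF assms]
  by (simp add: L2_norm_def)

lemma in_L2_translate: "in_L2 f \<Longrightarrow> in_L2 (\<lambda>x. f (x + z))"
  using in_L2_affine[of f 1 z] by (simp add: add.commute)

lemma in_L2_reflect: "in_L2 f \<Longrightarrow> in_L2 (\<lambda>x. f (- x))"
  using in_L2_affine[of f "-1" 0] by simp

text \<open>Lebesgue measure is the image of the product measure on the coordinates, so integrals of
  products split. This reduces Gaussian integrals to dimension one.\<close>

lemma lborel_prod_Basis:
  fixes g :: "'a::euclidean_space \<Rightarrow> real \<Rightarrow> complex"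
  assumes g: "\<And>b. b \<in> Basis \<Longrightarrow> integrable lborel (g b)"
  shows "integrable lborel (\<lambda>x::'a. \<Prod>b\<in>Basis. g b (x \<bullet> b))"
    and "(LINT x|lborel. (\<Prod>b\<in>(Basis::'a set). g b (x \<bullet> b))) = (\<Prod>b\<in>Basis. (LINT t|lborel. g b t))"
proof -
  interpret product_sigma_finite "\<lambda>_::'a. lborel :: real measure" ..
  let ?S = "\<lambda>f::'a \<Rightarrow> real. \<Sum>b\<in>Basis. f b *\<^sub>R b"
  let ?P = "Pi\<^sub>M Basis (\<lambda>_::'a. lborel :: real measure)"
  have eq: "(\<Prod>b\<in>Basis. g b (?S f \<bullet> b)) = (\<Prod>b\<in>Basis. g b (f b))" for f
    by (intro prod.cong) auto
  have m: "b \<in> Basis \<Longrightarrow> g b \<in> borel_measurable borel" for b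
    using borel_measurable_integrable[OF g] by simp
  have [measurable]: "(\<lambda>x::'a. \<Prod>b\<in>Basis. g b (x \<bullet> b)) \<in> borel_measurable borel"
    by (intro borel_measurable_prod measurable_compose[OF _ m]) auto
  have S: "?S \<in> ?P \<rightarrow>\<^sub>M borel" by measurable
  show "integrable lborel (\<lambda>x::'a. \<Prod>b\<in>Basis. g b (x \<bullet> b))"
    by (subst lborel_eq, subst integrable_distr_eq[OF S])
       (auto simp only: eq finite_Basis intro!: product_integrable_prod g, measurable)
  show "(LINT x|lborel. (\<Prod>b\<in>(Basis::'a set). g b (x \<bullet> b))) = (\<Prod>b\<in>Basis. (LINT t|lborel. g b t))"
    by (subst lborel_eq, subst integral_distr[OF S])
       (measurable, simp only: eq product_integral_prod[OF finite_Basis g])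
qed

text \<open>This is the characteristic function of the standard normal law, evaluated at -s because
  of the sign in the kernel.\<close>

lemma std_normal_fourier:
  "integrable lborel (\<lambda>t. exp (- (\<i> * complex_of_real (t * s))) * complex_of_real (std_normal_density t))"
  "(LINT t|lborel. exp (- (\<i> * complex_of_real (t * s))) * complex_of_real (std_normal_density t))
    = complex_of_real (exp (- s\<^sup>2 / 2))"
proof -
  have "integrable lborel (\<lambda>t. std_normal_density t *\<^sub>R exp (- (\<i> * complex_of_real (t * s))))"
    by (rule Bochner_Integration.integrable_bound[of _ std_normal_density])
       (auto simp: normal_density_nonneg)
  then show "integrable lborel
      (\<lambda>t. exp (- (\<i> * complex_of_real (t * s))) * complex_of_real (std_normal_density t))"
    by (simp add: scaleR_conv_of_real mult.commute)
  have "complex_of_real (exp (- s\<^sup>2 / 2)) = char std_normal_distribution (- s)"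
    by (simp add: char_std_normal_distribution)
  also have "\<dots> = (LINT t|lborel. std_normal_density t *\<^sub>R iexp (- s * t))"
    unfolding char_def by (subst integral_density) (auto simp: normal_density_nonneg)
  also have "\<dots> = (LINT t|lborel. exp (- (\<i> * complex_of_real (t * s))) * complex_of_real (std_normal_density t))"
    by (simp add: scaleR_conv_of_real mult.commute)
  finally show "(LINT t|lborel. exp (- (\<i> * complex_of_real (t * s))) * complex_of_real (std_normal_density t))
    = complex_of_real (exp (- s\<^sup>2 / 2))" by (rule sym)
qed

text \<open>The normalisation is that of a probability density: averaging against it satisfies
  Jensen's inequality, and its transform carries no constant factor.\<close>

definition gauss_density :: "'a::euclidean_space \<Rightarrow> real" where
  "gauss_density x = exp (- (norm x)\<^sup>2 / 2) / sqrt (2 * pi) ^ DIM('a)"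

lemma gauss_density_measurable [measurable]: "gauss_density \<in> borel_measurable borel"
  unfolding gauss_density_def by measurable

lemma gauss_density_pos: "0 < gauss_density x"
  by (simp add: gauss_density_def)

lemma gauss_density_nonneg [simp]: "0 \<le> gauss_density x"
  using gauss_density_pos[of x] by simp

lemma norm_power2_Basis: "(norm x)\<^sup>2 = (\<Sum>b\<in>Basis. (x \<bullet> b)\<^sup>2)"
  unfolding power2_norm_eq_inner by (subst euclidean_inner) (simp add: power2_eq_square)

lemma gauss_density_prod: "gauss_density x = (\<Prod>b\<in>Basis. std_normal_density (x \<bullet> b))"
  by (simp add: gauss_density_def std_normal_density_def norm_power2_Basis
      prod_dividef exp_sum[symmetric] sum_divide_distrib sum_negf)

lemma gauss_density_fourier_integrand:
  "exp (- (\<i> * complex_of_real (x \<bullet> \<xi>))) * complex_of_real (gauss_density x)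
    = (\<Prod>b\<in>Basis. exp (- (\<i> * complex_of_real ((x \<bullet> b) * (\<xi> \<bullet> b))))
        * complex_of_real (std_normal_density (x \<bullet> b)))"
proof -
  have "exp (- (\<i> * complex_of_real (x \<bullet> \<xi>)))
      = exp (\<Sum>b\<in>Basis. - (\<i> * complex_of_real ((x \<bullet> b) * (\<xi> \<bullet> b))))"
    by (subst euclidean_inner) (simp only: of_real_sum sum_distrib_left sum_negf)
  also have "\<dots> = (\<Prod>b\<in>Basis. exp (- (\<i> * complex_of_real ((x \<bullet> b) * (\<xi> \<bullet> b)))))"
    by (rule exp_sum) simp
  finally show ?thesis
    by (simp only: gauss_density_prod of_real_prod prod.distrib)
qed

lemma gauss_density_fourier:
  "fourier_integral (\<lambda>x. complex_of_real (gauss_density x)) \<xi>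
    = complex_of_real (exp (- (norm \<xi>)\<^sup>2 / 2))"
proof -
  have "fourier_integral (\<lambda>x. complex_of_real (gauss_density x)) \<xi>
      = (\<Prod>b\<in>Basis. complex_of_real (exp (- (\<xi> \<bullet> b)\<^sup>2 / 2)))"
    unfolding fourier_integral_def gauss_density_fourier_integrand
    by (subst lborel_prod_Basis(2)) (intro std_normal_fourier, simp only: std_normal_fourier)
  also have "\<dots> = complex_of_real (exp (\<Sum>b\<in>Basis. - (\<xi> \<bullet> b)\<^sup>2 / 2))"
    by (simp only: of_real_prod exp_sum finite_Basis)
  also have "(\<Sum>b\<in>Basis. - (\<xi> \<bullet> b)\<^sup>2 / 2) = - (norm \<xi>)\<^sup>2 / 2"
    by (simp add: norm_power2_Basis sum_divide_distrib sum_negf)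
  finally show ?thesis .
qed

lemma gauss_density_integrable: "integrable lborel (gauss_density :: 'a::euclidean_space \<Rightarrow> real)"
proof -
  have "integrable lborel (\<lambda>x::'a. exp (- (\<i> * complex_of_real (x \<bullet> 0))) * complex_of_real (gauss_density x))"
    unfolding gauss_density_fourier_integrand
    by (rule lborel_prod_Basis(1)) (rule std_normal_fourier)
  then show ?thesis by (simp add: complex_of_real_integrable_eq)
qed

lemma gauss_density_integral: "(LINT x|lborel. gauss_density x) = 1"
  using gauss_density_fourier[of 0] by (simp add: fourier_integral_def)

lemma gauss_density_nn_integral: "(\<integral>\<^sup>+x. ennreal (gauss_density x) \<partial>lborel) = 1"
  by (subst nn_integral_eq_integral) (auto simp: gauss_density_integrable gauss_density_integral)

lemma exp_norm_integrable:
  fixes e :: real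
  assumes "e \<noteq> 0"
  shows "integrable lborel (\<lambda>\<xi>::'a::euclidean_space. exp (- (norm (e *\<^sub>R \<xi>))\<^sup>2 / 2))"
proof -
  have "integrable lborel (\<lambda>\<xi>::'a. gauss_density (0 + e *\<^sub>R \<xi>) * sqrt (2 * pi) ^ DIM('a))"
    by (intro integrable_mult_left
        lborel_integrable_affine[THEN iffD1, OF _ assms gauss_density_integrable]) measurable
  then show ?thesis by (simp add: gauss_density_def)
qed

section \<open>The Fourier integral\<close>

lemma norm_fourier_kernel [simp]: "norm (exp (- (\<i> * complex_of_real a))) = 1"
  by (simp add: norm_exp_eq_Re)

lemma fourier_kernel_integrable:
  assumes "integrable lborel f"
  shows "integrable lborel (\<lambda>x. exp (- (\<i> * complex_of_real (x \<bullet> \<xi>))) * f x)"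
  using assms borel_measurable_integrable[OF assms]
  by (intro Bochner_Integration.integrable_bound[OF assms]) (auto simp: norm_mult)

lemma fourier_integral_measurable [measurable (raw)]:
  assumes "integrable lborel f"
  shows "fourier_integral f \<in> borel_measurable borel"
proof -
  have [measurable]: "f \<in> borel_measurable borel"
    using borel_measurable_integrable[OF assms] by simp
  have "(\<lambda>\<xi>. LINT x|lborel. exp (- (\<i> * complex_of_real (x \<bullet> \<xi>))) * f x) \<in> borel_measurable borel"
    by (intro lborel.borel_measurable_lebesgue_integral) measurable
  then show ?thesis by (simp add: fourier_integral_def[abs_def])
qed

lemma norm_fourier_integral_le:
  assumes "integrable lborel f"
  shows "norm (fourier_integral f \<xi>) \<le> (LINT x|lborel. norm (f x))"
  unfolding fourier_integral_def
  by (rule order_trans[OF integral_norm_bound]) (simp add: norm_mult)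

lemma fourier_integral_diff:
  assumes "integrable lborel f" "integrable lborel g"
  shows "fourier_integral (\<lambda>x. f x - g x) \<xi> = fourier_integral f \<xi> - fourier_integral g \<xi>"
  using assms by (simp add: fourier_integral_def right_diff_distrib fourier_kernel_integrable)

lemma fourier_integral_add:
  assumes "integrable lborel f" "integrable lborel g"
  shows "fourier_integral (\<lambda>x. f x + g x) \<xi> = fourier_integral f \<xi> + fourier_integral g \<xi>"
  using assms by (simp add: fourier_integral_def distrib_left fourier_kernel_integrable)

lemma fourier_integral_scaleR:
  "fourier_integral (\<lambda>x. c *\<^sub>R f x) \<xi> = c *\<^sub>R fourier_integral f \<xi>"
  unfolding fourier_integral_def by (simp only: mult_scaleR_right integral_scaleR_right)

text \<open>Both sides are iterated integrals of the same function of two variables, which is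
  integrable because its absolute value is |f x| |k xi|. Inversion and the Plancherel bound both
  come from this symmetry, with \<open>k\<close> a Gaussian factor times a character or times the
  transform itself.\<close>

lemma fourier_multiplication_formula:
  fixes f k :: "'a::euclidean_space \<Rightarrow> complex"
  assumes f: "integrable lborel f" and k: "integrable lborel k"
  shows "(LINT \<xi>|lborel. fourier_integral f \<xi> * k \<xi>) = (LINT x|lborel. f x * fourier_integral k x)"
proof -
  have [measurable]: "f \<in> borel_measurable borel" "k \<in> borel_measurable borel"
    using borel_measurable_integrable[OF f] borel_measurable_integrable[OF k] by auto
  let ?h = "\<lambda>x \<xi>. exp (- (\<i> * complex_of_real (x \<bullet> \<xi>))) * f x * k \<xi>"
  have "integrable (lborel \<Otimes>\<^sub>M lborel) (case_prod ?h)"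
  proof (rule lborel_pair.Fubini_integrable)
    show "case_prod ?h \<in> borel_measurable (lborel \<Otimes>\<^sub>M lborel)" by measurable
    show "integrable lborel (\<lambda>x. LINT \<xi>|lborel. norm (case_prod ?h (x, \<xi>)))"
      using f by (simp add: norm_mult integrable_norm)
    show "AE x in lborel. integrable lborel (\<lambda>\<xi>. case_prod ?h (x, \<xi>))"
    proof (rule AE_I2)
      fix x
      have "integrable lborel (\<lambda>\<xi>. f x * (exp (- (\<i> * complex_of_real (\<xi> \<bullet> x))) * k \<xi>))"
        by (intro integrable_mult_right fourier_kernel_integrable k)
      then show "integrable lborel (\<lambda>\<xi>. case_prod ?h (x, \<xi>))"
        by (simp add: inner_commute mult_ac)
    qed
  qed
  from lborel_pair.Fubini_integral[OF this]
  have "(LINT \<xi>|lborel. LINT x|lborel. ?h x \<xi>) = (LINT x|lborel. LINT \<xi>|lborel. ?h x \<xi>)" .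
  moreover have "(LINT x|lborel. ?h x \<xi>) = fourier_integral f \<xi> * k \<xi>" for \<xi>
    by (simp add: fourier_integral_def)
  moreover have "(LINT \<xi>|lborel. ?h x \<xi>) = f x * fourier_integral k x" for x
  proof -
    have "(LINT \<xi>|lborel. ?h x \<xi>) = (LINT \<xi>|lborel. f x * (exp (- (\<i> * complex_of_real (\<xi> \<bullet> x))) * k \<xi>))"
      by (simp only: inner_commute[of x] mult_ac)
    then show ?thesis by (simp add: fourier_integral_def)
  qed
  ultimately show ?thesis by (simp only:)
qed

section \<open>Continuity of translations\<close>

text \<open>Continuity at 0 is phrased with sequences because it is proved and used through
  dominated convergence.\<close>

definition translation_continuous :: "('a::euclidean_space \<Rightarrow> complex) \<Rightarrow> bool" where
  "translation_continuous f \<longleftrightarrow>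
    (\<forall>z :: nat \<Rightarrow> 'a. z \<longlonglongrightarrow> 0 \<longrightarrow> (\<lambda>k. LINT x|lborel. norm (f (x + z k) - f x)) \<longlonglongrightarrow> 0)"

lemma integrable_translate:
  fixes f :: "'a::euclidean_space \<Rightarrow> 'b::{banach, second_countable_topology}"
  assumes "integrable lborel f"
  shows "integrable lborel (\<lambda>x. f (x + z))"
    and "(LINT x|lborel. f (x + z)) = (LINT x|lborel. f x)"
proof -
  have m: "f \<in> borel_measurable borel" using borel_measurable_integrable[OF assms] by simp
  show "integrable lborel (\<lambda>x. f (x + z))"
    using lborel_integrable_affine[OF m, of 1 z] assms by (simp add: add.commute)
  show "(LINT x|lborel. f (x + z)) = (LINT x|lborel. f x)"
    using lborel_integral_affine[OF m, of 1 z] by (simp add: add.commute)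
qed

text \<open>Translations preserve the L^1 norm, so the error of approximating \<open>f\<close> by
  \<open>g\<close> is paid twice, once shifted and once not, and the property passes to L^1
  limits.\<close>

lemma translation_continuous_approx:
  assumes f: "integrable lborel f"
    and approx: "\<And>e. 0 < e \<Longrightarrow> \<exists>g. integrable lborel g \<and> translation_continuous g \<and>
      (LINT x|lborel. norm (f x - g x)) \<le> e"
  shows "translation_continuous f"
  unfolding translation_continuous_def
proof (intro allI impI LIMSEQ_I)
  fix z :: "nat \<Rightarrow> 'a" and e :: real
  assume z: "z \<longlonglongrightarrow> 0" and e: "0 < e"
  obtain g where g: "integrable lborel g" "translation_continuous g"
      "(LINT x|lborel. norm (f x - g x)) \<le> e / 4"
    using approx[of "e / 4"] e by auto
  have "(\<lambda>k. LINT x|lborel. norm (g (x + z k) - g x)) \<longlonglongrightarrow> 0"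
    using g(2) z by (auto simp: translation_continuous_def)
  from LIMSEQ_D[OF this, of "e / 4"] e
  obtain N where N: "\<And>k. k \<ge> N \<Longrightarrow> norm ((LINT x|lborel. norm (g (x + z k) - g x)) - 0) < e / 4"
    by auto
  show "\<exists>N. \<forall>k\<ge>N. norm ((LINT x|lborel. norm (f (x + z k) - f x)) - 0) < e"
  proof (intro exI allI impI)
    fix k assume k: "N \<le> k"
    have d: "integrable lborel (\<lambda>x. norm (f x - g x))"
      using f g(1) by auto
    note i = integrable_translate[OF d, of "z k"] integrable_translate(1)[OF g(1), of "z k"]
      integrable_translate(1)[OF f, of "z k"]
    have "(LINT x|lborel. norm (f (x + z k) - f x)) \<le>
        (LINT x|lborel. norm (f (x + z k) - g (x + z k)) + norm (g (x + z k) - g x) + norm (f x - g x))"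
    proof (rule integral_mono)
      show "norm (f (x + z k) - f x) \<le>
          norm (f (x + z k) - g (x + z k)) + norm (g (x + z k) - g x) + norm (f x - g x)" for x
        by norm
    qed (use i d f g(1) in auto)
    also have "\<dots> = (LINT x|lborel. norm (f (x + z k) - g (x + z k)))
        + (LINT x|lborel. norm (g (x + z k) - g x)) + (LINT x|lborel. norm (f x - g x))"
      using i d f g(1) by auto
    also have "\<dots> \<le> e / 4 + (LINT x|lborel. norm (g (x + z k) - g x)) + e / 4"
      using g(3) i(2) by simp
    also have "\<dots> < e" using N[OF k] e by simp
    finally show "norm ((LINT x|lborel. norm (f (x + z k) - f x)) - 0) < e"
      by simp
  qed
qed

lemma translation_continuous_add:
  assumes "integrable lborel f" "integrable lborel g"
    and "translation_continuous f" "translation_continuous g"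
  shows "translation_continuous (\<lambda>x. f x + g x)"
  unfolding translation_continuous_def
proof (intro allI impI)
  fix z :: "nat \<Rightarrow> 'a"
  assume z: "z \<longlonglongrightarrow> 0"
  have "(\<lambda>k. (LINT x|lborel. norm (f (x + z k) - f x)) + (LINT x|lborel. norm (g (x + z k) - g x))) \<longlonglongrightarrow> 0 + 0"
    using assms(3,4) z by (intro tendsto_add) (auto simp: translation_continuous_def)
  then show "(\<lambda>k. LINT x|lborel. norm (f (x + z k) + g (x + z k) - (f x + g x))) \<longlonglongrightarrow> 0"
  proof (rule Lim_null_comparison[rotated, OF tendsto_eq_rhs])
    show "\<forall>\<^sub>F k in sequentially. norm (LINT x|lborel. norm (f (x + z k) + g (x + z k) - (f x + g x)))
       \<le> (LINT x|lborel. norm (f (x + z k) - f x)) + (LINT x|lborel. norm (g (x + z k) - g x))"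
    proof (rule always_eventually, rule allI)
      fix k
      note i = integrable_translate(1)[OF assms(1), of "z k"] integrable_translate(1)[OF assms(2), of "z k"]
      have "(LINT x|lborel. norm (f (x + z k) + g (x + z k) - (f x + g x)))
         \<le> (LINT x|lborel. norm (f (x + z k) - f x) + norm (g (x + z k) - g x))"
        using i assms(1,2) by (intro integral_mono) (auto intro: norm_diff_triangle_ineq)
      also have "\<dots> = (LINT x|lborel. norm (f (x + z k) - f x)) + (LINT x|lborel. norm (g (x + z k) - g x))"
        using i assms(1,2) by (intro Bochner_Integration.integral_add) auto
      finally show "norm (LINT x|lborel. norm (f (x + z k) + g (x + z k) - (f x + g x)))
       \<le> (LINT x|lborel. norm (f (x + z k) - f x)) + (LINT x|lborel. norm (g (x + z k) - g x))" by simp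
    qed
  qed simp
qed

text \<open>The symmetric difference of U and its translate has indicator i + i' - 2 i i'.
  Translation invariance gives i and i' the same integral, so only the product i i' has to converge.
  Off U it is 0, and at a point of U it is eventually 1 because U is open.\<close>

lemma translation_continuous_open:
  fixes U :: "'a::euclidean_space set"
  assumes U: "open U" and fin: "emeasure lborel U < \<infinity>"
  shows "translation_continuous (\<lambda>x. indicator U x *\<^sub>R c)"
  unfolding translation_continuous_def
proof (intro allI impI)
  fix z :: "nat \<Rightarrow> 'a"
  assume z: "z \<longlonglongrightarrow> 0"
  let ?i = "indicator U :: 'a \<Rightarrow> real"
  have [measurable]: "U \<in> sets borel" using U by simp
  have iU: "integrable lborel ?i" using fin by simp
  note iz = integrable_translate[OF iU]
  have ip: "integrable lborel (\<lambda>x. ?i x * ?i (x + z k))" for k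
    by (rule Bochner_Integration.integrable_bound[OF iU]) (auto simp: indicator_def)
  have lim: "(\<lambda>k. LINT x|lborel. ?i x * ?i (x + z k)) \<longlonglongrightarrow> (LINT x|lborel. ?i x)"
  proof (rule integral_dominated_convergence[where w = ?i])
    show "AE x in lborel. (\<lambda>k. ?i x * ?i (x + z k)) \<longlonglongrightarrow> ?i x"
    proof (rule AE_I2)
      fix x
      show "(\<lambda>k. ?i x * ?i (x + z k)) \<longlonglongrightarrow> ?i x"
      proof (cases "x \<in> U")
        case True
        have "(\<lambda>k. x + z k) \<longlonglongrightarrow> x + 0" by (intro tendsto_intros z)
        then have "\<forall>\<^sub>F k in sequentially. x + z k \<in> U"
          using topological_tendstoD[OF _ U] True by simp
        then have "\<forall>\<^sub>F k in sequentially. ?i x * ?i (x + z k) = ?i x"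
          by eventually_elim (simp add: True)
        then show ?thesis by (rule tendsto_eventually)
      qed simp
    qed
  qed (use iU in \<open>auto simp: indicator_def\<close>)
  have eq: "(LINT x|lborel. norm (?i (x + z k) *\<^sub>R c - ?i x *\<^sub>R c))
      = (2 * (LINT x|lborel. ?i x) - 2 * (LINT x|lborel. ?i x * ?i (x + z k))) * norm c" for k
  proof -
    have "(LINT x|lborel. norm (?i (x + z k) *\<^sub>R c - ?i x *\<^sub>R c))
      = (LINT x|lborel. (?i (x + z k) + ?i x - 2 * (?i x * ?i (x + z k))) * norm c)"
      by (intro Bochner_Integration.integral_cong) (auto simp: indicator_def)
    also have "\<dots> = (LINT x|lborel. ?i (x + z k) + ?i x - 2 * (?i x * ?i (x + z k))) * norm c"
      by (rule integral_mult_left_zero)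
    also have "(LINT x|lborel. ?i (x + z k) + ?i x - 2 * (?i x * ?i (x + z k)))
      = (LINT x|lborel. ?i (x + z k)) + (LINT x|lborel. ?i x) - 2 * (LINT x|lborel. ?i x * ?i (x + z k))"
      using iz(1)[of "z k"] iU ip[of k] by (simp only: Bochner_Integration.integral_diff
          Bochner_Integration.integral_add Bochner_Integration.integrable_add integrable_mult_right
          integral_mult_right_zero)
    finally show ?thesis using iz(2)[of "z k"] by simp
  qed
  have "(\<lambda>k. (2 * (LINT x|lborel. ?i x) - 2 * (LINT x|lborel. ?i x * ?i (x + z k))) * norm c)
      \<longlonglongrightarrow> (2 * (LINT x|lborel. ?i x) - 2 * (LINT x|lborel. ?i x)) * norm c"
    by (intro tendsto_intros lim)
  then show "(\<lambda>k. LINT x|lborel. norm (?i (x + z k) *\<^sub>R c - ?i x *\<^sub>R c)) \<longlonglongrightarrow> 0"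
    by (simp only: eq) simp
qed

text \<open>Simple functions are dense in L^1, and outer regularity replaces a Borel set of finite
  measure by an open set that is only slightly larger.\<close>

lemma translation_continuous_integrable:
  fixes f :: "'a::euclidean_space \<Rightarrow> complex"
  assumes "integrable lborel f"
  shows "translation_continuous f"
  using assms
proof (induction rule: integrable_induct)
  case (base A c)
  then have A [measurable]: "A \<in> sets borel" by simp
  have iA: "integrable lborel (indicator A :: 'a \<Rightarrow> real)" using base by simp
  show ?case
  proof (rule translation_continuous_approx)
    show "integrable lborel (\<lambda>x. indicator A x *\<^sub>R c)" by (intro integrable_scaleR_left iA)
    fix e :: real assume e: "0 < e"
    \<comment> \<open>Adding 1 avoids a division by zero when \<open>c\<close> is 0.\<close>
    define e' where "e' = e / (norm c + 1)"
    have e': "0 < e'" using e by (simp add: e'_def add_nonneg_pos)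
    obtain U where U: "open U" "A \<subseteq> U" "emeasure lborel (U - A) < ennreal e'"
      using outer_regular_lborel[OF A e'] by auto
    have [measurable]: "U \<in> sets borel" using U(1) by simp
    have "emeasure lborel U \<le> emeasure lborel A + emeasure lborel (U - A)"
      using emeasure_subadditive[of A lborel "U - A"] U(2) by (simp add: Un_absorb1)
    also have "\<dots> < \<infinity>" using base(2) U(3) by (auto simp: less_top[symmetric] top_unique)
    finally have fin: "emeasure lborel U < \<infinity>" .
    have "(LINT x|lborel. norm (indicator A x *\<^sub>R c - indicator U x *\<^sub>R c))
        = (LINT x|lborel. indicator (U - A) x * norm c)"
      using U(2) by (intro Bochner_Integration.integral_cong) (auto simp: indicator_def)
    also have "\<dots> = measure lborel (U - A) * norm c" by simp
    also have "\<dots> \<le> e' * norm c"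
      using U(3) e' by (intro mult_right_mono) (auto simp: measure_def enn2real_leI less_imp_le)
    also have "\<dots> \<le> e' * (norm c + 1)" using e' by simp
    also have "\<dots> = e" using norm_ge_zero[of c] by (simp add: e'_def add_nonneg_eq_0_iff)
    finally show "\<exists>g. integrable lborel g \<and> translation_continuous g \<and>
        (LINT x|lborel. norm (indicator A x *\<^sub>R c - g x)) \<le> e"
      using fin translation_continuous_open[OF U(1) fin, of c]
      by (intro exI[of _ "\<lambda>x. indicator U x *\<^sub>R c"]) (auto intro!: integrable_scaleR_left)
  qed
next
  case (add f g)
  then show ?case by (intro translation_continuous_add)
next
  case (lim f s)
  show ?case
  proof (rule translation_continuous_approx[OF lim(4)])
    fix e :: real assume e: "0 < e"
    have "(\<lambda>i. LINT x|lborel. norm (f x - s i x)) \<longlonglongrightarrow> integral\<^sup>L lborel (\<lambda>x::'a. 0 :: real)"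
    \<comment> \<open>The approximants of the induction rule satisfy |s i x| <= 2 |f x|, which makes
      the difference at most 3 |f x|.\<close>
    proof (rule integral_dominated_convergence[where w = "\<lambda>x. 3 * norm (f x)"])
      show "AE x in lborel. (\<lambda>i. norm (f x - s i x)) \<longlonglongrightarrow> 0"
      proof (rule AE_I2)
        fix x
        have "(\<lambda>i. norm (f x - s i x)) \<longlonglongrightarrow> norm (f x - f x)"
          using lim(2) by (intro tendsto_intros) simp
        then show "(\<lambda>i. norm (f x - s i x)) \<longlonglongrightarrow> 0" by simp
      qed
      show "AE x in lborel. norm (norm (f x - s i x)) \<le> 3 * norm (f x)" for i
      proof (rule AE_I2)
        fix x
        have "norm (f x - s i x) \<le> norm (f x) + norm (s i x)" by (rule norm_triangle_ineq4)
        with lim(3)[of x i] show "norm (norm (f x - s i x)) \<le> 3 * norm (f x)" by simp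
      qed
      show "(\<lambda>x. norm (f x - s i x)) \<in> borel_measurable lborel" for i
        using borel_measurable_integrable[OF lim(4)] borel_measurable_integrable[OF lim(1)] by simp
    qed (use lim(4) in auto)
    then have "(\<lambda>i. LINT x|lborel. norm (f x - s i x)) \<longlonglongrightarrow> 0" by simp
    from LIMSEQ_D[OF this e] obtain i where "(LINT x|lborel. norm (f x - s i x)) \<le> e"
      by (metis abs_of_nonneg diff_zero integral_norm_bound le_refl less_imp_le norm_ge_zero
          order_trans real_norm_def abs_ge_self)
    then show "\<exists>g. integrable lborel g \<and> translation_continuous g \<and>
        (LINT x|lborel. norm (f x - g x)) \<le> e"
      using lim(1,5) by auto
  qed
qed

section \<open>Dominated convergence and continuity of translations in L^2\<close>

lemma inverse_Suc_tendsto: "(\<lambda>k. 1 / real (Suc k)) \<longlonglongrightarrow> 0"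
  by (rule LIMSEQ_Suc[OF lim_1_over_n])

text \<open>The limit inherits the majorant, so the squared differences are dominated by (2 C)^2
  |g|^2.\<close>

lemma L2_tendsto_dominated:
  assumes f: "\<And>k::nat. f k \<in> borel_measurable borel" and g: "in_L2 g" and l: "l \<in> borel_measurable borel"
    and bound: "\<And>k x. norm (f k x) \<le> C * norm (g x)"
    and lim: "\<And>x. (\<lambda>k. f k x) \<longlonglongrightarrow> l x"
  shows "L2_tendsto f l sequentially"
  unfolding L2_tendsto_def
proof (intro conjI always_eventually allI)
  note [measurable] = f l in_L2_measurable[OF g]
  have fL: "in_L2 (f k)" for k
    by (rule in_L2_bound[OF g f, where c = C]) (simp add: bound)
  then show "in_L2 (f k)" for k .
  have lbound: "norm (l x) \<le> C * norm (g x)" for x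
    by (rule Lim_bounded[OF tendsto_norm[OF lim], where M = 0]) (simp add: bound)
  show lL: "in_L2 l"
    by (rule in_L2_bound[OF g l, where c = C]) (simp add: lbound)
  have "(\<lambda>k. LINT x|lborel. (norm (f k x - l x))\<^sup>2) \<longlonglongrightarrow> integral\<^sup>L lborel (\<lambda>x::'a. 0 :: real)"
  proof (rule integral_dominated_convergence[where w = "\<lambda>x. (2 * C)\<^sup>2 * (norm (g x))\<^sup>2"])
    show "integrable lborel (\<lambda>x. (2 * C)\<^sup>2 * (norm (g x))\<^sup>2)"
      using in_L2_integrable[OF g] by simp
    show "AE x in lborel. (\<lambda>k. (norm (f k x - l x))\<^sup>2) \<longlonglongrightarrow> 0"
    proof (rule AE_I2)
      fix x
      have "(\<lambda>k. (norm (f k x - l x))\<^sup>2) \<longlonglongrightarrow> (norm (l x - l x))\<^sup>2"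
        by (intro tendsto_intros lim)
      then show "(\<lambda>k. (norm (f k x - l x))\<^sup>2) \<longlonglongrightarrow> 0" by simp
    qed
    show "AE x in lborel. norm ((norm (f k x - l x))\<^sup>2) \<le> (2 * C)\<^sup>2 * (norm (g x))\<^sup>2" for k
    proof (rule AE_I2)
      fix x
      have "norm (f k x - l x) \<le> norm (f k x) + norm (l x)" by (rule norm_triangle_ineq4)
      also have "\<dots> \<le> 2 * C * norm (g x)" using bound[of k x] lbound[of x] by simp
      finally have "(norm (f k x - l x))\<^sup>2 \<le> (2 * C * norm (g x))\<^sup>2" by (rule power_mono) simp
      then show "norm ((norm (f k x - l x))\<^sup>2) \<le> (2 * C)\<^sup>2 * (norm (g x))\<^sup>2"
        by (simp add: power_mult_distrib)
    qed
  qed measurable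
  then have "(\<lambda>k. sqrt (LINT x|lborel. (norm (f k x - l x))\<^sup>2)) \<longlonglongrightarrow> sqrt 0"
    by (intro tendsto_real_sqrt) simp
  then show "(\<lambda>k. L2_norm (\<lambda>x. f k x - l x)) \<longlonglongrightarrow> 0"
    by (simp add: L2_norm_def)
qed

text \<open>The L^1 statement is transferred by cutting off the values of \<open>f\<close> above
  height j. For the truncated function, which is bounded by j, the squared difference is at most 2 j
  times the difference, so L^1 continuity suffices; the truncation error is small in L^2, uniformly
  under translation.\<close>

lemma L2_translation_continuous:
  fixes f :: "'a::euclidean_space \<Rightarrow> complex"
  assumes f1: "integrable lborel f" and f2: "in_L2 f" and z: "z \<longlonglongrightarrow> 0"
  shows "(\<lambda>k. L2_norm (\<lambda>x. f (x + z k) - f x)) \<longlonglongrightarrow> 0"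
proof (rule LIMSEQ_I)
  fix e :: real assume e: "0 < e"
  note [measurable] = in_L2_measurable[OF f2]
  define g where "g j x = (if norm (f x) \<le> real j then f x else 0)" for j x
  have [measurable]: "g j \<in> borel_measurable borel" for j unfolding g_def by measurable
  have gle: "norm (g j x) \<le> norm (f x)" "norm (g j x) \<le> real j" for j x
    by (auto simp: g_def)
  have g1: "integrable lborel (g j)" for j
    by (rule Bochner_Integration.integrable_bound[OF f1]) (auto simp: gle)
  have g2: "in_L2 (g j)" for j
    by (rule in_L2_bound[OF f2, where c = 1]) (auto simp: gle)
  have "L2_tendsto g f sequentially"
  proof (rule L2_tendsto_dominated[OF _ f2, where C = 1])
    show "(\<lambda>j. g j x) \<longlonglongrightarrow> f x" for x
    proof (rule tendsto_eventually)
      obtain N where "norm (f x) \<le> real N" using real_arch_simple by blast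
      then show "\<forall>\<^sub>F j in sequentially. g j x = f x"
        unfolding g_def by (intro eventually_sequentiallyI[of N]) auto
    qed
  qed (auto simp: gle)
  then have "(\<lambda>j. L2_norm (\<lambda>x. g j x - f x)) \<longlonglongrightarrow> 0" by (simp add: L2_tendsto_def)
  from LIMSEQ_D[OF this, of "e / 3"] e obtain j where "L2_norm (\<lambda>x. g j x - f x) < e / 3" by auto
  then have j: "L2_norm (\<lambda>x. f x - g j x) < e / 3"
    by (simp add: L2_norm_def norm_minus_commute)
  have "(\<lambda>k. LINT x|lborel. norm (g j (x + z k) - g j x)) \<longlonglongrightarrow> 0"
    using translation_continuous_integrable[OF g1] z by (auto simp: translation_continuous_def)
  \<comment> \<open>The 1 in the divisor covers the height j = 0.\<close>
  moreover have "0 < (e / 3)\<^sup>2 / (2 * real j + 1)" using e by simp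
  ultimately obtain N where N: "\<And>k. k \<ge> N \<Longrightarrow>
      norm ((LINT x|lborel. norm (g j (x + z k) - g j x)) - 0) < (e / 3)\<^sup>2 / (2 * real j + 1)"
    using LIMSEQ_D by blast
  show "\<exists>N. \<forall>k\<ge>N. norm (L2_norm (\<lambda>x. f (x + z k) - f x) - 0) < e"
  proof (intro exI allI impI)
    fix k assume k: "N \<le> k"
    have d: "in_L2 (\<lambda>x. f x - g j x)" by (rule in_L2_diff[OF f2 g2])
    have gz: "in_L2 (\<lambda>x. g j (x + z k) - g j x)"
      by (rule in_L2_diff[OF in_L2_translate[OF g2] g2])
    have gi: "integrable lborel (\<lambda>x. norm (g j (x + z k) - g j x))"
      using integrable_translate(1)[OF g1] g1 by auto
    have "(L2_norm (\<lambda>x. g j (x + z k) - g j x))\<^sup>2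
        \<le> (LINT x|lborel. 2 * real j * norm (g j (x + z k) - g j x))"
      unfolding L2_norm_power2
    proof (rule integral_mono)
      fix x
      have "norm (g j (x + z k) - g j x) \<le> norm (g j (x + z k)) + norm (g j x)"
        by (rule norm_triangle_ineq4)
      also have "\<dots> \<le> 2 * real j" using gle(2)[of j "x + z k"] gle(2)[of j x] by simp
      finally show "(norm (g j (x + z k) - g j x))\<^sup>2 \<le> 2 * real j * norm (g j (x + z k) - g j x)"
        by (simp add: power2_eq_square mult_right_mono)
    qed (use in_L2_integrable[OF gz] gi in auto)
    also have "\<dots> = 2 * real j * (LINT x|lborel. norm (g j (x + z k) - g j x))" by simp
    also have "\<dots> \<le> (2 * real j + 1) * (LINT x|lborel. norm (g j (x + z k) - g j x))"
      by (intro mult_right_mono) auto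
    also have "\<dots> < (e / 3)\<^sup>2"
      using N[OF k] by (simp add: pos_less_divide_eq mult.commute)
    finally have gs: "L2_norm (\<lambda>x. g j (x + z k) - g j x) < e / 3"
      by (rule power_less_imp_less_base) (use e in simp)
    have "abs_l2 (\<lambda>x. f (x + z k) - f x) = abs_l2 (\<lambda>x. (f (x + z k) - g j (x + z k))
        + (g j (x + z k) - g j x) - (f x - g j x))" by simp
    also have "\<dots> = abs_l2 (\<lambda>x. f (x + z k) - g j (x + z k)) + abs_l2 (\<lambda>x. g j (x + z k) - g j x)
        - abs_l2 (\<lambda>x. f x - g j x)"
      using in_L2_translate[OF d, of "z k"] gz d by (simp only: abs_l2_add abs_l2_diff in_L2_add)
    finally have eq: "abs_l2 (\<lambda>x. f (x + z k) - f x) = abs_l2 (\<lambda>x. f (x + z k) - g j (x + z k))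
        + abs_l2 (\<lambda>x. g j (x + z k) - g j x) - abs_l2 (\<lambda>x. f x - g j x)" .
    have "norm (abs_l2 (\<lambda>x. f (x + z k) - f x)) \<le>
        norm (abs_l2 (\<lambda>x. f (x + z k) - g j (x + z k))) + norm (abs_l2 (\<lambda>x. g j (x + z k) - g j x))
        + norm (abs_l2 (\<lambda>x. f x - g j x))"
      unfolding eq
      using norm_triangle_ineq4[of "abs_l2 (\<lambda>x. f (x + z k) - g j (x + z k)) + abs_l2 (\<lambda>x. g j (x + z k) - g j x)"
          "abs_l2 (\<lambda>x. f x - g j x)"]
        norm_triangle_ineq[of "abs_l2 (\<lambda>x. f (x + z k) - g j (x + z k))" "abs_l2 (\<lambda>x. g j (x + z k) - g j x)"]
      by linarith
    then have "L2_norm (\<lambda>x. f (x + z k) - f x) \<le> L2_norm (\<lambda>x. f (x + z k) - g j (x + z k))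
        + L2_norm (\<lambda>x. g j (x + z k) - g j x) + L2_norm (\<lambda>x. f x - g j x)"
      using in_L2_translate[OF d, of "z k"] gz d in_L2_diff[OF in_L2_translate[OF f2] f2, of "z k"]
      by (simp only: norm_abs_l2)
    also have "L2_norm (\<lambda>x. f (x + z k) - g j (x + z k)) = L2_norm (\<lambda>x. f x - g j x)"
      by (rule L2_norm_translate[OF d])
    finally show "norm (L2_norm (\<lambda>x. f (x + z k) - f x) - 0) < e" using j gs by simp
  qed
qed

section \<open>Gaussian smoothing\<close>

text \<open>For e > 0 this is the convolution of \<open>f\<close> with the centred Gaussian of
  standard deviation e, rescaled so that the density is fixed and e appears only in the
  translation.\<close>

definition gauss_mean :: "real \<Rightarrow> ('a::euclidean_space \<Rightarrow> complex) \<Rightarrow> 'a \<Rightarrow> complex" where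
  "gauss_mean e f x = (LINT z|lborel. complex_of_real (gauss_density z) * f (x + e *\<^sub>R z))"

lemma gauss_density_le: "gauss_density (z::'a::euclidean_space) \<le> 1"
proof -
  have "1 \<le> sqrt (2 * pi)" using pi_gt3 by simp
  then have "1 \<le> sqrt (2 * pi) ^ DIM('a)" by simp
  then have "exp (- (norm z)\<^sup>2 / 2) \<le> sqrt (2 * pi) ^ DIM('a)"
    by (rule order_trans[rotated]) simp
  then show ?thesis by (simp add: gauss_density_def divide_le_eq)
qed

lemma gauss_mean_integrable:
  assumes f: "integrable lborel f" and e: "e \<noteq> 0"
  shows "integrable lborel (\<lambda>z. complex_of_real (gauss_density z) * f (x + e *\<^sub>R z))"
proof -
  have [measurable]: "f \<in> borel_measurable borel" using borel_measurable_integrable[OF f] by simp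
  have i: "integrable lborel (\<lambda>z. f (x + e *\<^sub>R z))"
    using lborel_integrable_affine[OF _ e, of f x] f by simp
  show ?thesis
    by (rule Bochner_Integration.integrable_bound[OF i])
       (auto simp: norm_mult gauss_density_le intro!: mult_left_le_one_le)
qed

text \<open>Jensen's inequality for the square amounts to a nonnegative variance: with m the mean of
  |h|, the Gaussian integral of (|h| - m)^2 is expanded.\<close>

lemma gauss_jensen:
  fixes h :: "'a::euclidean_space \<Rightarrow> complex"
  assumes h: "integrable lborel (\<lambda>z. complex_of_real (gauss_density z) * h z)"
    and [measurable]: "h \<in> borel_measurable borel"
  shows "ennreal ((norm (LINT z|lborel. complex_of_real (gauss_density z) * h z))\<^sup>2)
    \<le> (\<integral>\<^sup>+z. ennreal (gauss_density z * (norm (h z))\<^sup>2) \<partial>lborel)"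
proof (cases "(\<integral>\<^sup>+z. ennreal (gauss_density z * (norm (h z))\<^sup>2) \<partial>lborel) = \<infinity>")
  case False
  then have i2: "integrable lborel (\<lambda>z. gauss_density z * (norm (h z))\<^sup>2)"
    by (intro integrableI_bounded) (auto simp: less_top abs_mult)
  have i1: "integrable lborel (\<lambda>z. gauss_density z * norm (h z))"
    using integrable_norm[OF h] by (simp add: norm_mult)
  define m where "m = (LINT z|lborel. gauss_density z * norm (h z))"
  have "norm (LINT z|lborel. complex_of_real (gauss_density z) * h z) \<le> m"
    unfolding m_def by (rule order_trans[OF integral_norm_bound]) (simp add: norm_mult)
  then have le: "(norm (LINT z|lborel. complex_of_real (gauss_density z) * h z))\<^sup>2 \<le> m\<^sup>2"
    by (rule power_mono) simp
  have "0 \<le> (LINT z|lborel. gauss_density z * (norm (h z) - m)\<^sup>2)"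
    by (rule Bochner_Integration.integral_nonneg) simp
  also have "\<dots> = (LINT z|lborel. gauss_density z * (norm (h z))\<^sup>2 - 2 * m * (gauss_density z * norm (h z))
      + m\<^sup>2 * gauss_density z)"
    by (intro Bochner_Integration.integral_cong) (auto simp: power2_eq_square algebra_simps)
  also have "\<dots> = (LINT z|lborel. gauss_density z * (norm (h z))\<^sup>2) - 2 * m * m + m\<^sup>2 * 1"
    using Bochner_Integration.integral_add[OF
        Bochner_Integration.integrable_diff[OF i2 integrable_mult_right[OF i1]]
        integrable_mult_right[OF gauss_density_integrable], of "2 * m" "m\<^sup>2"]
      Bochner_Integration.integral_diff[OF i2 integrable_mult_right[OF i1], of "2 * m"]
    by (simp only: integral_mult_right_zero m_def[symmetric] gauss_density_integral)
  finally have "m\<^sup>2 \<le> (LINT z|lborel. gauss_density z * (norm (h z))\<^sup>2)"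
    by (simp add: power2_eq_square)
  with le have "(norm (LINT z|lborel. complex_of_real (gauss_density z) * h z))\<^sup>2
      \<le> (LINT z|lborel. gauss_density z * (norm (h z))\<^sup>2)" by linarith
  then show ?thesis by (subst nn_integral_eq_integral[OF i2]) (auto intro: ennreal_leI)
qed simp

lemma gauss_mean_measurable [measurable (raw)]:
  assumes [measurable]: "f \<in> borel_measurable borel"
  shows "gauss_mean e f \<in> borel_measurable borel"
proof -
  have "(\<lambda>x. LINT z|lborel. complex_of_real (gauss_density z) * f (x + e *\<^sub>R z)) \<in> borel_measurable borel"
    by (intro lborel.borel_measurable_lebesgue_integral) measurable
  then show ?thesis by (simp add: gauss_mean_def[abs_def])
qed

text \<open>Jensen in z followed by Tonelli moves the L^2 norm inside the Gaussian average. The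
  factor \<open>a\<close> covers both uses: 0 gives the contraction property, 1 the approximation
  error.\<close>

lemma gauss_mean_diff_bound:
  fixes f :: "'a::euclidean_space \<Rightarrow> complex"
  assumes f1: "integrable lborel f" and f2: "in_L2 f" and e: "e \<noteq> 0"
  shows "(\<integral>\<^sup>+x. ennreal ((norm (gauss_mean e f x - a *\<^sub>R f x))\<^sup>2) \<partial>lborel)
    \<le> (\<integral>\<^sup>+z. ennreal (gauss_density z * (L2_norm (\<lambda>x. f (x + e *\<^sub>R z) - a *\<^sub>R f x))\<^sup>2) \<partial>lborel)"
proof -
  note [measurable] = in_L2_measurable[OF f2]
  have "(\<integral>\<^sup>+x. ennreal ((norm (gauss_mean e f x - a *\<^sub>R f x))\<^sup>2) \<partial>lborel)
    \<le> (\<integral>\<^sup>+x. \<integral>\<^sup>+z. ennreal (gauss_density z * (norm (f (x + e *\<^sub>R z) - a *\<^sub>R f x))\<^sup>2) \<partial>lborel \<partial>lborel)"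
  proof (rule nn_integral_mono)
    fix x
    have i: "integrable lborel (\<lambda>z::'a. complex_of_real (gauss_density z) * (a *\<^sub>R f x))"
      using gauss_density_integrable by (intro integrable_mult_left) (simp add: complex_of_real_integrable_eq)
    note i' = gauss_mean_integrable[OF f1 e, of x]
    have int: "integrable lborel (\<lambda>z. complex_of_real (gauss_density z) * (f (x + e *\<^sub>R z) - a *\<^sub>R f x))"
      using Bochner_Integration.integrable_diff[OF i' i] by (simp only: right_diff_distrib)
    have "(LINT z|lborel. complex_of_real (gauss_density z) * (f (x + e *\<^sub>R z) - a *\<^sub>R f x))
        = gauss_mean e f x - (LINT z|lborel. complex_of_real (gauss_density (z::'a)) * (a *\<^sub>R f x))"
      using Bochner_Integration.integral_diff[OF i' i] by (simp only: right_diff_distrib gauss_mean_def)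
    also have "(LINT z|lborel. complex_of_real (gauss_density (z::'a)) * (a *\<^sub>R f x)) = a *\<^sub>R f x"
      by (simp add: gauss_density_integral)
    finally show "ennreal ((norm (gauss_mean e f x - a *\<^sub>R f x))\<^sup>2) \<le>
        (\<integral>\<^sup>+z. ennreal (gauss_density z * (norm (f (x + e *\<^sub>R z) - a *\<^sub>R f x))\<^sup>2) \<partial>lborel)"
      using gauss_jensen[OF int] by simp
  qed
  also have "\<dots> = (\<integral>\<^sup>+z. \<integral>\<^sup>+x. ennreal (gauss_density z * (norm (f (x + e *\<^sub>R z) - a *\<^sub>R f x))\<^sup>2) \<partial>lborel \<partial>lborel)"
    by (rule lborel_pair.Fubini'[symmetric]) measurable
  also have "\<dots> = (\<integral>\<^sup>+z. ennreal (gauss_density z * (L2_norm (\<lambda>x. f (x + e *\<^sub>R z) - a *\<^sub>R f x))\<^sup>2) \<partial>lborel)"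
  proof (rule nn_integral_cong)
    fix z :: 'a
    have "in_L2 (\<lambda>x. f (x + e *\<^sub>R z) - a *\<^sub>R f x)"
      by (intro in_L2_diff in_L2_translate in_L2_scaleR f2)
    from nn_integral_L2_norm[OF this]
    show "(\<integral>\<^sup>+x. ennreal (gauss_density z * (norm (f (x + e *\<^sub>R z) - a *\<^sub>R f x))\<^sup>2) \<partial>lborel)
        = ennreal (gauss_density z * (L2_norm (\<lambda>x. f (x + e *\<^sub>R z) - a *\<^sub>R f x))\<^sup>2)"
      by (simp add: ennreal_mult nn_integral_cmult)
  qed
  finally show ?thesis .
qed

lemma gauss_mean_in_L2:
  fixes f :: "'a::euclidean_space \<Rightarrow> complex"
  assumes f1: "integrable lborel f" and f2: "in_L2 f" and e: "e \<noteq> 0"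
  shows "in_L2 (gauss_mean e f)" "L2_norm (gauss_mean e f) \<le> L2_norm f"
proof -
  note [measurable] = in_L2_measurable[OF f2]
  have "(\<integral>\<^sup>+x. ennreal ((norm (gauss_mean e f x))\<^sup>2) \<partial>lborel)
    \<le> (\<integral>\<^sup>+z. ennreal (gauss_density (z::'a) * (L2_norm f)\<^sup>2) \<partial>lborel)"
    using gauss_mean_diff_bound[OF f1 f2 e, of 0] by (simp add: L2_norm_translate[OF f2])
  also have "\<dots> = ennreal ((L2_norm f)\<^sup>2)"
    by (simp add: ennreal_mult nn_integral_multc gauss_density_nn_integral)
  finally have le: "(\<integral>\<^sup>+x. ennreal ((norm (gauss_mean e f x))\<^sup>2) \<partial>lborel) \<le> ennreal ((L2_norm f)\<^sup>2)" .
  show "in_L2 (gauss_mean e f)" "L2_norm (gauss_mean e f) \<le> L2_norm f"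
    using in_L2_nn_bound[OF _ L2_norm_nonneg le] by auto
qed

text \<open>The error is a Gaussian average of squared translation errors
  \<open>D (e k *\<^sub>R z)\<close>. These tend to 0 for each z by continuity of translations and
  are at most 4 times the squared norm of \<open>f\<close>, so dominated convergence applies in
  z.\<close>

lemma gauss_mean_tendsto:
  fixes f :: "'a::euclidean_space \<Rightarrow> complex"
  assumes f1: "integrable lborel f" and f2: "in_L2 f" and e: "\<And>k. e k \<noteq> 0" and lim: "e \<longlonglongrightarrow> 0"
  shows "L2_tendsto (\<lambda>k. gauss_mean (e k) f) f sequentially"
  unfolding L2_tendsto_def
proof (intro conjI always_eventually allI)
  note [measurable] = in_L2_measurable[OF f2]
  show "in_L2 (gauss_mean (e k) f)" for k by (rule gauss_mean_in_L2[OF f1 f2 e])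
  show "in_L2 f" by (rule f2)
  define D where "D z = (L2_norm (\<lambda>x. f (x + z) - f x))\<^sup>2" for z
  have D4: "D z \<le> (2 * L2_norm f)\<^sup>2" for z
  proof -
    have "norm (abs_l2 (\<lambda>x. f (x + z)) - abs_l2 f) \<le> norm (abs_l2 (\<lambda>x. f (x + z))) + norm (abs_l2 f)"
      by (rule norm_triangle_ineq4)
    then have "L2_norm (\<lambda>x. f (x + z) - f x) \<le> 2 * L2_norm f"
      by (simp add: abs_l2_diff norm_abs_l2 in_L2_translate in_L2_diff f2 L2_norm_translate)
    then show ?thesis unfolding D_def by (rule power_mono) simp
  qed
  have Dm [measurable]: "D \<in> borel_measurable borel"
  proof -
    have "(\<lambda>z. LINT x|lborel. (norm (f (x + z) - f x))\<^sup>2) \<in> borel_measurable borel"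
      by (intro lborel.borel_measurable_lebesgue_integral) measurable
    then show ?thesis by (simp add: D_def[abs_def] L2_norm_power2)
  qed
  have gb: "norm (gauss_density z * D (e k *\<^sub>R z)) \<le> gauss_density z * (2 * L2_norm f)\<^sup>2" for k and z :: 'a
  proof -
    have "0 \<le> D (e k *\<^sub>R z)" by (simp add: D_def)
    then have "norm (gauss_density z * D (e k *\<^sub>R z)) = gauss_density z * D (e k *\<^sub>R z)" by simp
    also have "\<dots> \<le> gauss_density z * (2 * L2_norm f)\<^sup>2" by (intro mult_left_mono D4) simp
    finally show ?thesis .
  qed
  have gw: "integrable lborel (\<lambda>z::'a. gauss_density z * (2 * L2_norm f)\<^sup>2)"
    by (intro integrable_mult_left gauss_density_integrable)
  have gi: "integrable lborel (\<lambda>z::'a. gauss_density z * D (e k *\<^sub>R z))" for k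
    by (rule Bochner_Integration.integrable_bound[OF gw])
       (measurable, use gb in \<open>auto intro!: AE_I2 intro: order_trans[OF _ abs_ge_self]\<close>)
  have "(\<lambda>k. LINT z|lborel. gauss_density z * D (e k *\<^sub>R z)) \<longlonglongrightarrow> integral\<^sup>L lborel (\<lambda>z::'a. 0 :: real)"
  proof (rule integral_dominated_convergence[where w = "\<lambda>z. gauss_density z * (2 * L2_norm f)\<^sup>2"])
    show "integrable lborel (\<lambda>z::'a. gauss_density z * (2 * L2_norm f)\<^sup>2)" by (rule gw)
    show "AE z in lborel. (\<lambda>k. gauss_density z * D (e k *\<^sub>R z)) \<longlonglongrightarrow> 0"
    proof (rule AE_I2)
      fix z :: 'a
      have "(\<lambda>k. e k *\<^sub>R z) \<longlonglongrightarrow> 0 *\<^sub>R z" by (intro tendsto_intros lim)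
      then have "(\<lambda>k. L2_norm (\<lambda>x. f (x + e k *\<^sub>R z) - f x)) \<longlonglongrightarrow> 0"
        by (intro L2_translation_continuous[OF f1 f2]) simp
      then have "(\<lambda>k. gauss_density z * (L2_norm (\<lambda>x. f (x + e k *\<^sub>R z) - f x))\<^sup>2) \<longlonglongrightarrow> gauss_density z * 0\<^sup>2"
        by (intro tendsto_intros)
      then show "(\<lambda>k. gauss_density z * D (e k *\<^sub>R z)) \<longlonglongrightarrow> 0" by (simp add: D_def)
    qed
    show "AE z in lborel. norm (gauss_density z * D (e k *\<^sub>R z)) \<le> gauss_density z * (2 * L2_norm f)\<^sup>2" for k
      by (rule AE_I2) (rule gb)
  qed measurable
  then have "(\<lambda>k. sqrt (LINT z|lborel. gauss_density z * D (e k *\<^sub>R z))) \<longlonglongrightarrow> sqrt 0"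
    by (intro tendsto_real_sqrt) simp
  then have lim0: "(\<lambda>k. sqrt (LINT z|lborel. gauss_density z * D (e k *\<^sub>R z))) \<longlonglongrightarrow> 0" by simp
  show "(\<lambda>k. L2_norm (\<lambda>x. gauss_mean (e k) f x - f x)) \<longlonglongrightarrow> 0"
  proof (rule Lim_null_comparison[OF always_eventually[OF allI] lim0])
    fix k
    let ?I = "LINT z|lborel. gauss_density z * D (e k *\<^sub>R z)"
    have I: "0 \<le> ?I" by (rule Bochner_Integration.integral_nonneg) (simp add: D_def)
    have "(\<integral>\<^sup>+x. ennreal ((norm (gauss_mean (e k) f x - f x))\<^sup>2) \<partial>lborel)
        \<le> (\<integral>\<^sup>+z. ennreal (gauss_density z * D (e k *\<^sub>R z)) \<partial>lborel)"
      using gauss_mean_diff_bound[OF f1 f2 e, of k 1] by (simp add: D_def)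
    also have "\<dots> = ennreal ((sqrt ?I)\<^sup>2)"
      using I by (subst nn_integral_eq_integral[OF gi]) (auto simp: D_def)
    finally have "L2_norm (\<lambda>x. gauss_mean (e k) f x - f x) \<le> sqrt ?I"
      by (intro in_L2_nn_bound(2)) (use I in auto)
    then show "norm (L2_norm (\<lambda>x. gauss_mean (e k) f x - f x)) \<le> sqrt ?I" by simp
  qed
qed

section \<open>Inversion and Plancherel bound on integrable functions\<close>

text \<open>The kernel carries no normalising factor, so the squared L^2 norm gets multiplied by
  this power of 2 pi. The argument is a type because only the dimension matters.\<close>

definition plancherel_const :: "'a::euclidean_space itself \<Rightarrow> real" where
  "plancherel_const _ = (2 * pi) ^ DIM('a)"

lemma plancherel_const_pos: "0 < plancherel_const TYPE('a::euclidean_space)"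
  by (simp add: plancherel_const_def)

lemma gauss_exp_eq:
  "exp (- (norm (z::'a::euclidean_space))\<^sup>2 / 2) = sqrt (2 * pi) ^ DIM('a) * gauss_density z"
  by (simp add: gauss_density_def)

text \<open>Up to the factor \<open>plancherel_const\<close> the result is the Gaussian density of
  width e centred at x. The factor sqrt (2 pi)^n arises twice: once when the exponential is written
  as a density, and once when its transform is written as a density again.\<close>

lemma fourier_modulated_gauss:
  fixes x y :: "'a::euclidean_space"
  assumes e: "e > 0"
  shows "fourier_integral (\<lambda>\<xi>. exp (\<i> * complex_of_real (x \<bullet> \<xi>))
      * complex_of_real (exp (- (norm (e *\<^sub>R \<xi>))\<^sup>2 / 2))) y
    = complex_of_real (plancherel_const TYPE('a) * (1 / e) ^ DIM('a) * gauss_density ((1 / e) *\<^sub>R (y - x)))"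
proof -
  let ?s = "sqrt (2 * pi) ^ DIM('a)"
  have "fourier_integral (\<lambda>\<xi>. exp (\<i> * complex_of_real (x \<bullet> \<xi>))
      * complex_of_real (exp (- (norm (e *\<^sub>R \<xi>))\<^sup>2 / 2))) y
    = (LINT \<xi>|lborel. exp (- (\<i> * complex_of_real (\<xi> \<bullet> (y - x))))
        * complex_of_real (exp (- (norm (e *\<^sub>R \<xi>))\<^sup>2 / 2)))"
    unfolding fourier_integral_def mult.assoc[symmetric] exp_add[symmetric]
    by (simp add: inner_diff_right inner_commute algebra_simps)
  also have "\<dots> = (1 / e) ^ DIM('a) *\<^sub>R (LINT \<xi>|lborel. exp (- (\<i> * complex_of_real (\<xi> \<bullet> ((1 / e) *\<^sub>R (y - x)))))
        * complex_of_real (exp (- (norm \<xi>)\<^sup>2 / 2)))"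
    using e by (subst lborel_integral_affine[where c = "1 / e" and t = 0]) auto
  also have "\<dots> = (1 / e) ^ DIM('a) *\<^sub>R (LINT \<xi>|lborel. complex_of_real ?s * (exp (- (\<i> * complex_of_real (\<xi> \<bullet> ((1 / e) *\<^sub>R (y - x)))))
        * complex_of_real (gauss_density \<xi>)))"
    unfolding gauss_exp_eq by (simp only: of_real_mult mult_ac)
  also have "\<dots> = (1 / e) ^ DIM('a) *\<^sub>R (complex_of_real ?s
      * fourier_integral (\<lambda>z. complex_of_real (gauss_density z)) ((1 / e) *\<^sub>R (y - x)))"
    by (simp only: integral_mult_right_zero fourier_integral_def)
  also have "\<dots> = complex_of_real ((?s * ?s) * (1 / e) ^ DIM('a) * gauss_density ((1 / e) *\<^sub>R (y - x)))"
    unfolding gauss_density_fourier gauss_exp_eq by (simp add: scaleR_conv_of_real)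
  also have "?s * ?s = plancherel_const TYPE('a)"
    by (subst power_mult_distrib[symmetric]) (simp add: plancherel_const_def)
  finally show ?thesis .
qed

text \<open>The argument -x turns the forward kernel into the inverse one. The multiplication
  formula then moves the transform from \<open>f\<close> to the modulated Gaussian, which is known
  explicitly.\<close>

lemma inverse_fourier_gauss_mean:
  fixes f :: "'a::euclidean_space \<Rightarrow> complex"
  assumes f: "integrable lborel f" and e: "e > 0"
  shows "fourier_integral (\<lambda>\<xi>. fourier_integral f \<xi> * complex_of_real (exp (- (norm (e *\<^sub>R \<xi>))\<^sup>2 / 2))) (- x)
    = complex_of_real (plancherel_const TYPE('a)) * gauss_mean e f x"
proof -
  have [measurable]: "f \<in> borel_measurable borel" using borel_measurable_integrable[OF f] by simp
  let ?k = "\<lambda>\<xi>. exp (\<i> * complex_of_real (x \<bullet> \<xi>)) * complex_of_real (exp (- (norm (e *\<^sub>R \<xi>))\<^sup>2 / 2))"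
  have k: "integrable lborel ?k"
    using exp_norm_integrable[of e] e
    by (intro Bochner_Integration.integrable_bound[OF exp_norm_integrable[of e]])
       (auto simp: norm_mult)
  have "fourier_integral (\<lambda>\<xi>. fourier_integral f \<xi> * complex_of_real (exp (- (norm (e *\<^sub>R \<xi>))\<^sup>2 / 2))) (- x)
      = (LINT \<xi>|lborel. fourier_integral f \<xi> * ?k \<xi>)"
    unfolding fourier_integral_def[of "\<lambda>\<xi>. fourier_integral f \<xi> * complex_of_real (exp (- (norm (e *\<^sub>R \<xi>))\<^sup>2 / 2))"]
    by (intro Bochner_Integration.integral_cong) (auto simp: inner_commute mult_ac)
  also have "\<dots> = (LINT y|lborel. f y * fourier_integral ?k y)"
    by (rule fourier_multiplication_formula[OF f k])
  also have "\<dots> = (LINT y|lborel. complex_of_real (plancherel_const TYPE('a)) *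
      (complex_of_real ((1 / e) ^ DIM('a)) * (complex_of_real (gauss_density ((1 / e) *\<^sub>R (y - x))) * f y)))"
    unfolding fourier_modulated_gauss[OF e] by (simp only: of_real_mult mult_ac)
  also have "\<dots> = complex_of_real (plancherel_const TYPE('a)) * (complex_of_real ((1 / e) ^ DIM('a)) *
      (LINT y|lborel. complex_of_real (gauss_density ((1 / e) *\<^sub>R (y - x))) * f y))"
    by (simp only: integral_mult_right_zero)
  also have "(LINT y|lborel. complex_of_real (gauss_density ((1 / e) *\<^sub>R (y - x))) * f y)
      = e ^ DIM('a) *\<^sub>R gauss_mean e f x"
    using e by (subst lborel_integral_affine[where c = e and t = x]) (auto simp: gauss_mean_def)
  also have "complex_of_real ((1 / e) ^ DIM('a)) * (e ^ DIM('a) *\<^sub>R gauss_mean e f x) = gauss_mean e f x"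
    using e by (simp add: scaleR_conv_of_real power_divide)
  finally show ?thesis .
qed

text \<open>The transform of an integrable function is bounded but in general not integrable; the
  Gaussian factor repairs this.\<close>

lemma fourier_damped_integrable:
  assumes f: "integrable lborel f" and e: "e > 0"
  shows "integrable lborel (\<lambda>\<xi>. fourier_integral f \<xi> * complex_of_real (exp (- (norm (e *\<^sub>R \<xi>))\<^sup>2 / 2)))"
proof -
  note [measurable] = fourier_integral_measurable[OF f]
  have "integrable lborel (\<lambda>\<xi>. (LINT x|lborel. norm (f x)) * exp (- (norm (e *\<^sub>R \<xi>))\<^sup>2 / 2))"
    using e by (intro integrable_mult_right exp_norm_integrable) simp
  then show ?thesis
    by (rule Bochner_Integration.integrable_bound)
       (auto simp: norm_mult norm_fourier_integral_le[OF f] intro!: mult_right_mono)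
qed

lemma cnj_measurable [measurable]: "cnj \<in> borel_measurable borel"
  by (intro borel_measurable_continuous_onI continuous_intros)

text \<open>The conjugate of the transform of \<open>f\<close> is the transform of the conjugated
  reflection of \<open>f\<close>. Hence the multiplication formula rewrites the damped energy as (2
  pi)^n times the inner product of \<open>f\<close> with its Gaussian mean, and Cauchy-Schwarz and
  the contraction property bound that.\<close>

lemma fourier_damped_L2:
  fixes f :: "'a::euclidean_space \<Rightarrow> complex"
  assumes f1: "integrable lborel f" and f2: "in_L2 f" and e: "e > 0"
  shows "(LINT \<xi>|lborel. (norm (fourier_integral f \<xi>))\<^sup>2 * exp (- (norm (e *\<^sub>R \<xi>))\<^sup>2 / 2))
    \<le> plancherel_const TYPE('a) * (L2_norm f)\<^sup>2"
proof -
  note [measurable] = in_L2_measurable[OF f2] fourier_integral_measurable[OF f1]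
  let ?c = "plancherel_const TYPE('a)"
  let ?k = "\<lambda>\<xi>. fourier_integral f \<xi> * complex_of_real (exp (- (norm (e *\<^sub>R \<xi>))\<^sup>2 / 2))"
  let ?f = "\<lambda>x. cnj (f (- x))"
  have k: "integrable lborel ?k" by (rule fourier_damped_integrable[OF f1 e])
  have "integrable lborel (\<lambda>x. f (- x))"
    using lborel_integrable_affine[of f "-1" 0] f1 by simp
  then have f': "integrable lborel ?f" by (simp add: complex_integrable_cnj)
  have F: "fourier_integral ?f \<xi> = cnj (fourier_integral f \<xi>)" for \<xi>
  proof -
    have "fourier_integral ?f \<xi> = (LINT x|lborel. cnj (exp (- (\<i> * complex_of_real (- x \<bullet> \<xi>))) * f (- x)))"
      unfolding fourier_integral_def by (simp add: exp_cnj)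
    also have "\<dots> = cnj (LINT x|lborel. exp (- (\<i> * complex_of_real (- x \<bullet> \<xi>))) * f (- x))"
      by (rule Bochner_Integration.integral_cnj)
    also have "(LINT x|lborel. exp (- (\<i> * complex_of_real (- x \<bullet> \<xi>))) * f (- x)) = fourier_integral f \<xi>"
      unfolding fourier_integral_def
      by (subst (2) lborel_integral_affine[where c = "-1" and t = 0]) auto
    finally show ?thesis .
  qed
  have "complex_of_real (LINT \<xi>|lborel. (norm (fourier_integral f \<xi>))\<^sup>2 * exp (- (norm (e *\<^sub>R \<xi>))\<^sup>2 / 2))
      = (LINT \<xi>|lborel. fourier_integral ?f \<xi> * ?k \<xi>)"
    unfolding F integral_complex_of_real[symmetric]
    by (intro Bochner_Integration.integral_cong) (simp_all only: of_real_mult complex_norm_square mult_ac)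
  also have "\<dots> = (LINT x|lborel. ?f x * fourier_integral ?k x)"
    by (rule fourier_multiplication_formula[OF f' k])
  also have "\<dots> = (LINT x|lborel. cnj (f x) * fourier_integral ?k (- x))"
  proof -
    define K where "K = fourier_integral ?k"
    have [measurable]: "K \<in> borel_measurable borel"
      unfolding K_def by (rule fourier_integral_measurable[OF k])
    have "(LINT x|lborel. ?f x * K x) = (LINT x|lborel. cnj (f x) * K (- x))"
      by (subst lborel_integral_affine[where c = "-1" and t = 0]) auto
    then show ?thesis by (simp only: K_def)
  qed
  also have "\<dots> = complex_of_real ?c * (LINT x|lborel. cnj (f x) * gauss_mean e f x)"
    unfolding inverse_fourier_gauss_mean[OF f1 e]
    by (simp only: mult.left_commute[of _ "complex_of_real (plancherel_const TYPE('a))"]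
        integral_mult_right_zero)
  finally have "Re (complex_of_real (LINT \<xi>|lborel. (norm (fourier_integral f \<xi>))\<^sup>2 * exp (- (norm (e *\<^sub>R \<xi>))\<^sup>2 / 2)))
      = Re (complex_of_real ?c * (LINT x|lborel. cnj (f x) * gauss_mean e f x))"
    by (simp only:)
  then have eq: "(LINT \<xi>|lborel. (norm (fourier_integral f \<xi>))\<^sup>2 * exp (- (norm (e *\<^sub>R \<xi>))\<^sup>2 / 2))
      = ?c * Re (LINT x|lborel. cnj (f x) * gauss_mean e f x)"
    by (simp only: Re_complex_of_real times_complex.simps Im_complex_of_real mult_zero_left diff_zero)
  have g2: "in_L2 (gauss_mean e f)" "L2_norm (gauss_mean e f) \<le> L2_norm f"
    using gauss_mean_in_L2[OF f1 f2, of e] e by auto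
  note [measurable] = in_L2_measurable[OF g2(1)]
  have "integrable lborel (\<lambda>x. cnj (f x) * gauss_mean e f x)"
  proof (rule Bochner_Integration.integrable_bound)
    show "integrable lborel (\<lambda>x. (norm (f x))\<^sup>2 + (norm (gauss_mean e f x))\<^sup>2)"
      using in_L2_integrable[OF f2] in_L2_integrable[OF g2(1)] by simp
    show "AE x in lborel. norm (cnj (f x) * gauss_mean e f x) \<le> norm ((norm (f x))\<^sup>2 + (norm (gauss_mean e f x))\<^sup>2)"
    proof (rule AE_I2)
      fix x
      have "2 * (norm (f x) * norm (gauss_mean e f x)) \<le> (norm (f x))\<^sup>2 + (norm (gauss_mean e f x))\<^sup>2"
        using sum_squares_bound[of "norm (f x)" "norm (gauss_mean e f x)"] by simp
      moreover have "0 \<le> norm (f x) * norm (gauss_mean e f x)" by simp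
      ultimately have "norm (f x) * norm (gauss_mean e f x) \<le> (norm (f x))\<^sup>2 + (norm (gauss_mean e f x))\<^sup>2"
        by linarith
      then show "norm (cnj (f x) * gauss_mean e f x) \<le> norm ((norm (f x))\<^sup>2 + (norm (gauss_mean e f x))\<^sup>2)"
        by (simp add: norm_mult)
    qed
  qed measurable
  then have "Re (LINT x|lborel. cnj (f x) * gauss_mean e f x) = (LINT x|lborel. Re (cnj (f x) * gauss_mean e f x))"
    by (rule integral_Re[symmetric])
  also have "\<dots> = abs_l2 f \<bullet> abs_l2 (gauss_mean e f)"
    by (simp add: abs_l2_inner f2 g2 inner_complex_def)
  also have "\<dots> \<le> norm (abs_l2 f) * norm (abs_l2 (gauss_mean e f))"
    by (rule norm_cauchy_schwarz)
  also have "\<dots> \<le> L2_norm f * L2_norm f"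
    using g2 by (simp add: norm_abs_l2 f2 mult_left_mono)
  finally show ?thesis
    unfolding eq using plancherel_const_pos[where 'a = 'a]
    by (simp add: power2_eq_square)
qed

text \<open>Fatou's lemma removes the damping. Only an inequality results at this stage; equality
  follows later from inversion.\<close>

lemma fourier_integral_L2:
  fixes f :: "'a::euclidean_space \<Rightarrow> complex"
  assumes f1: "integrable lborel f" and f2: "in_L2 f"
  shows "in_L2 (fourier_integral f)"
    and "L2_norm (fourier_integral f) \<le> sqrt (plancherel_const TYPE('a)) * L2_norm f"
proof -
  note [measurable] = fourier_integral_measurable[OF f1]
  let ?c = "plancherel_const TYPE('a)"
  let ?g = "\<lambda>k \<xi>. (norm (fourier_integral f \<xi>))\<^sup>2 * exp (- (norm ((1 / real (Suc k)) *\<^sub>R \<xi>))\<^sup>2 / 2)"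
  have "(\<integral>\<^sup>+\<xi>. ennreal ((norm (fourier_integral f \<xi>))\<^sup>2) \<partial>lborel)
      = (\<integral>\<^sup>+\<xi>. liminf (\<lambda>k. ennreal (?g k \<xi>)) \<partial>lborel)"
  proof (rule nn_integral_cong)
    fix \<xi>
    have "(\<lambda>k. ennreal (?g k \<xi>)) \<longlonglongrightarrow> ennreal ((norm (fourier_integral f \<xi>))\<^sup>2 * exp (- (norm (0 *\<^sub>R \<xi>))\<^sup>2 / 2))"
      by (intro tendsto_ennrealI tendsto_intros inverse_Suc_tendsto) simp
    then have "(\<lambda>k. ennreal (?g k \<xi>)) \<longlonglongrightarrow> ennreal ((norm (fourier_integral f \<xi>))\<^sup>2)" by simp
    then show "ennreal ((norm (fourier_integral f \<xi>))\<^sup>2) = liminf (\<lambda>k. ennreal (?g k \<xi>))"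
      by (rule lim_imp_Liminf[OF sequentially_bot, symmetric])
  qed
  also have "\<dots> \<le> liminf (\<lambda>k. \<integral>\<^sup>+\<xi>. ennreal (?g k \<xi>) \<partial>lborel)"
    by (rule nn_integral_liminf) measurable
  also have "\<dots> \<le> liminf (\<lambda>k::nat. ennreal (?c * (L2_norm f)\<^sup>2))"
  proof (rule Liminf_mono, rule always_eventually, rule allI)
    fix k
    have e: "0 < 1 / real (Suc k)" by simp
    \<comment> \<open>One factor of the squared transform is bounded by the L^1 norm; the other
      keeps the integrable Gaussian damping.\<close>
    have i: "integrable lborel (?g k)"
    proof (rule Bochner_Integration.integrable_bound[OF integrable_norm[OF integrable_mult_right[OF fourier_damped_integrable[OF f1 e]]]])
      show "AE \<xi> in lborel. norm (?g k \<xi>) \<le> norm (norm (complex_of_real (LINT x|lborel. norm (f x)) *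
          (fourier_integral f \<xi> * complex_of_real (exp (- (norm ((1 / real (Suc k)) *\<^sub>R \<xi>))\<^sup>2 / 2)))))"
      proof (rule AE_I2)
        fix \<xi>
        have "(norm (fourier_integral f \<xi>))\<^sup>2 \<le> (LINT x|lborel. norm (f x)) * norm (fourier_integral f \<xi>)"
          unfolding power2_eq_square by (intro mult_right_mono norm_fourier_integral_le[OF f1]) simp
        then have "?g k \<xi> \<le> (LINT x|lborel. norm (f x)) * norm (fourier_integral f \<xi>)
            * exp (- (norm ((1 / real (Suc k)) *\<^sub>R \<xi>))\<^sup>2 / 2)"
          by (rule mult_right_mono) simp
        moreover have "0 \<le> (LINT x|lborel. norm (f x))" by simp
        ultimately show "norm (?g k \<xi>) \<le> norm (norm (complex_of_real (LINT x|lborel. norm (f x)) *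
          (fourier_integral f \<xi> * complex_of_real (exp (- (norm ((1 / real (Suc k)) *\<^sub>R \<xi>))\<^sup>2 / 2)))))"
          by (simp only: norm_mult norm_of_real abs_mult abs_exp_cancel abs_norm_cancel
              real_norm_def abs_of_nonneg mult.assoc abs_power2 norm_exp_eq_Re)
      qed
    qed measurable
    show "(\<integral>\<^sup>+\<xi>. ennreal (?g k \<xi>) \<partial>lborel) \<le> ennreal (?c * (L2_norm f)\<^sup>2)"
      using fourier_damped_L2[OF f1 f2 e]
      by (subst nn_integral_eq_integral[OF i]) (auto intro!: ennreal_leI)
  qed
  also have "\<dots> = ennreal ((sqrt ?c * L2_norm f)\<^sup>2)"
    using plancherel_const_pos[where 'a = 'a] by (simp add: Liminf_const power_mult_distrib)
  finally have le: "(\<integral>\<^sup>+\<xi>. ennreal ((norm (fourier_integral f \<xi>))\<^sup>2) \<partial>lborel)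
      \<le> ennreal ((sqrt ?c * L2_norm f)\<^sup>2)" .
  have "0 \<le> sqrt ?c * L2_norm f"
    using plancherel_const_pos[where 'a = 'a] by (simp add: less_imp_le)
  from in_L2_nn_bound[OF _ this le]
  show "in_L2 (fourier_integral f)" "L2_norm (fourier_integral f) \<le> sqrt ?c * L2_norm f"
    by simp_all
qed

lemma is_L2_fourier_fourier_integral:
  assumes f1: "integrable lborel f" and f2: "in_L2 f"
  shows "is_L2_fourier f (fourier_integral f)"
  unfolding is_L2_fourier_def using assms fourier_integral_L2(1)[OF f1 f2]
  by (intro exI[of _ "\<lambda>_. f"]) (auto simp: L2_tendsto_iff)

text \<open>The damped transforms are integrable and converge to the transform in L^2, so they are
  admissible approximants in \<open>is_L2_fourier\<close>. Their own transforms are reflected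
  Gaussian means, which converge to the reflected function.\<close>

lemma is_L2_fourier_inversion:
  fixes f :: "'a::euclidean_space \<Rightarrow> complex"
  assumes f1: "integrable lborel f" and f2: "in_L2 f"
  shows "is_L2_fourier (fourier_integral f) (\<lambda>x. plancherel_const TYPE('a) *\<^sub>R f (- x))"
proof -
  note [measurable] = fourier_integral_measurable[OF f1] in_L2_measurable[OF f2]
  let ?c = "plancherel_const TYPE('a)"
  let ?e = "\<lambda>k. 1 / real (Suc k)"
  let ?\<phi> = "\<lambda>k \<xi>. fourier_integral f \<xi> * complex_of_real (exp (- (norm (?e k *\<^sub>R \<xi>))\<^sup>2 / 2))"
  have e: "0 < ?e k" for k by simp
  have "L2_tendsto ?\<phi> (fourier_integral f) sequentially"
  proof (rule L2_tendsto_dominated[OF _ fourier_integral_L2(1)[OF f1 f2], where C = 1])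
    show "(\<lambda>k. ?\<phi> k \<xi>) \<longlonglongrightarrow> fourier_integral f \<xi>" for \<xi>
    proof -
      have "(\<lambda>k. ?\<phi> k \<xi>) \<longlonglongrightarrow> fourier_integral f \<xi> * complex_of_real (exp (- (norm (0 *\<^sub>R \<xi>))\<^sup>2 / 2))"
        by (intro tendsto_intros inverse_Suc_tendsto) simp
      then show ?thesis by simp
    qed
    show "norm (?\<phi> k \<xi>) \<le> 1 * norm (fourier_integral f \<xi>)" for k \<xi>
    proof -
      have "norm (?\<phi> k \<xi>) = norm (fourier_integral f \<xi>) * exp (- (norm (?e k *\<^sub>R \<xi>))\<^sup>2 / 2)"
        by (simp only: norm_mult norm_of_real abs_exp_cancel)
      also have "\<dots> \<le> norm (fourier_integral f \<xi>) * 1"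
        by (intro mult_left_mono) auto
      finally show ?thesis by simp
    qed
  qed measurable
  moreover have "L2_tendsto (\<lambda>k. fourier_integral (?\<phi> k)) (\<lambda>x. ?c *\<^sub>R f (- x)) sequentially"
  proof -
    have F: "fourier_integral (?\<phi> k) = (\<lambda>x. ?c *\<^sub>R gauss_mean (?e k) f (- x))" for k
      using inverse_fourier_gauss_mean[OF f1 e, of k "- x" for x]
      by (auto simp: scaleR_conv_of_real)
    have g2: "in_L2 (gauss_mean (?e k) f)" for k
      by (rule gauss_mean_in_L2[OF f1 f2]) simp
    have "L2_tendsto (\<lambda>k. gauss_mean (?e k) f) f sequentially"
      by (rule gauss_mean_tendsto[OF f1 f2]) (simp, rule inverse_Suc_tendsto)
    then have "(\<lambda>k. L2_norm (\<lambda>x. gauss_mean (?e k) f x - f x)) \<longlonglongrightarrow> 0"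
      by (simp only: L2_tendsto_def)
    then have "(\<lambda>k. ?c * L2_norm (\<lambda>x. gauss_mean (?e k) f x - f x)) \<longlonglongrightarrow> ?c * 0"
      by (intro tendsto_intros)
    moreover have "L2_norm (\<lambda>x. ?c *\<^sub>R gauss_mean (?e k) f (- x) - ?c *\<^sub>R f (- x))
        = ?c * L2_norm (\<lambda>x. gauss_mean (?e k) f x - f x)" for k
    proof -
      have d: "in_L2 (\<lambda>x. gauss_mean (?e k) f x - f x)" by (rule in_L2_diff[OF g2 f2])
      have "L2_norm (\<lambda>x. ?c *\<^sub>R gauss_mean (?e k) f (- x) - ?c *\<^sub>R f (- x))
          = norm (?c *\<^sub>R abs_l2 (\<lambda>x. gauss_mean (?e k) f (- x) - f (- x)))"
        using in_L2_reflect[OF d]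
        by (simp only: abs_l2_scaleR scaleR_diff_right[symmetric] norm_abs_l2 in_L2_scaleR)
      also have "\<dots> = ?c * L2_norm (\<lambda>x. gauss_mean (?e k) f (- x) - f (- x))"
        using in_L2_reflect[OF d] plancherel_const_pos[where 'a = 'a] by (simp add: norm_abs_l2)
      also have "L2_norm (\<lambda>x. gauss_mean (?e k) f (- x) - f (- x)) = L2_norm (\<lambda>x. gauss_mean (?e k) f x - f x)"
        by (rule L2_norm_reflect[OF d])
      finally show ?thesis .
    qed
    ultimately show ?thesis
      unfolding L2_tendsto_def F
      using in_L2_scaleR[OF in_L2_reflect[OF g2]] in_L2_scaleR[OF in_L2_reflect[OF f2]]
      by (simp only: simp_thms eventually_True mult_zero_right)
  qed
  ultimately show ?thesis
    unfolding is_L2_fourier_def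
    using fourier_damped_integrable[OF f1 e] by (intro exI[of _ ?\<phi>]) blast
qed

section \<open>The Fourier transform as an operator\<close>

lemma in_L2_integrable_cut:
  fixes f :: "'a::euclidean_space \<Rightarrow> complex"
  assumes f: "in_L2 f" and [measurable]: "A \<in> sets borel" and A: "emeasure lborel A < \<infinity>"
  shows "integrable lborel (\<lambda>x. indicator A x *\<^sub>R f x)"
proof (rule Bochner_Integration.integrable_bound)
  note [measurable] = in_L2_measurable[OF f]
  show "integrable lborel (\<lambda>x. indicator A x + (norm (f x))\<^sup>2)"
    using A in_L2_integrable[OF f] by simp
  show "(\<lambda>x. indicator A x *\<^sub>R f x) \<in> borel_measurable lborel" by measurable
  show "AE x in lborel. norm (indicator A x *\<^sub>R f x) \<le> norm (indicator A x + (norm (f x))\<^sup>2)"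
  proof (rule AE_I2)
    fix x
    have "2 * norm (f x) \<le> 1 + (norm (f x))\<^sup>2"
      using sum_squares_bound[of 1 "norm (f x)"] by simp
    then have "norm (f x) \<le> 1 + (norm (f x))\<^sup>2"
      using norm_ge_zero[of "f x"] by linarith
    then show "norm (indicator A x *\<^sub>R f x) \<le> norm (indicator A x + (norm (f x))\<^sup>2)"
      by (auto simp: indicator_def)
  qed
qed

lemma L2_dense_integrable:
  fixes f :: "'a::euclidean_space \<Rightarrow> complex"
  assumes f: "in_L2 f"
  obtains \<phi> :: "nat \<Rightarrow> 'a \<Rightarrow> complex"
  where "\<And>k. integrable lborel (\<phi> k)" "\<And>k. in_L2 (\<phi> k)" "L2_tendsto \<phi> f sequentially"
proof
  note [measurable] = in_L2_measurable[OF f]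
  let ?\<phi> = "\<lambda>k::nat. \<lambda>x. indicator (ball 0 (real k)) x *\<^sub>R f x"
  show "integrable lborel (?\<phi> k)" for k
    using emeasure_bounded_finite[of "ball (0::'a) (real k)"]
    by (intro in_L2_integrable_cut f) auto
  show "in_L2 (?\<phi> k)" for k
    by (rule in_L2_bound[OF f, where c = 1]) (auto simp: indicator_def)
  show "L2_tendsto ?\<phi> f sequentially"
  proof (rule L2_tendsto_dominated[OF _ f, where C = 1])
    show "(\<lambda>k. ?\<phi> k x) \<longlonglongrightarrow> f x" for x
    proof (rule tendsto_eventually)
      obtain N where "norm x < real N" using reals_Archimedean2 by blast
      then show "\<forall>\<^sub>F k in sequentially. ?\<phi> k x = f x"
        by (intro eventually_sequentiallyI[of N]) (auto simp: indicator_def)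
    qed
  qed (auto simp: indicator_def)
qed

text \<open>Membership that holds eventually becomes membership for all indices after a shift of the
  sequence, and square integrability of the transforms comes from
  \<open>fourier_integral_L2\<close>. All later work is then about limits in
  \<open>l2\<close>.\<close>

lemma is_L2_fourier_iff:
  "is_L2_fourier f g \<longleftrightarrow> in_L2 f \<and> in_L2 g \<and> (\<exists>\<phi>. (\<forall>k. integrable lborel (\<phi> k) \<and> in_L2 (\<phi> k)) \<and>
    (\<lambda>k. abs_l2 (\<phi> k)) \<longlonglongrightarrow> abs_l2 f \<and> (\<lambda>k. abs_l2 (fourier_integral (\<phi> k))) \<longlonglongrightarrow> abs_l2 g)"
proof safe
  assume "is_L2_fourier f g"
  then obtain \<phi> where \<phi>: "\<And>k. integrable lborel (\<phi> k)"
      "\<forall>\<^sub>F k in sequentially. in_L2 (\<phi> k)" "(\<lambda>k. abs_l2 (\<phi> k)) \<longlonglongrightarrow> abs_l2 f"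
      "(\<lambda>k. abs_l2 (fourier_integral (\<phi> k))) \<longlonglongrightarrow> abs_l2 g" and fg: "in_L2 f" "in_L2 g"
    by (auto simp: is_L2_fourier_def L2_tendsto_iff)
  show "in_L2 f" "in_L2 g" by (rule fg)+
  from \<phi>(2) obtain N where N: "\<And>k. k \<ge> N \<Longrightarrow> in_L2 (\<phi> k)"
    by (auto simp: eventually_sequentially)
  show "\<exists>\<phi>. (\<forall>k. integrable lborel (\<phi> k) \<and> in_L2 (\<phi> k)) \<and>
    (\<lambda>k. abs_l2 (\<phi> k)) \<longlonglongrightarrow> abs_l2 f \<and> (\<lambda>k. abs_l2 (fourier_integral (\<phi> k))) \<longlonglongrightarrow> abs_l2 g"
    using \<phi>(1) N LIMSEQ_ignore_initial_segment[OF \<phi>(3), of N] LIMSEQ_ignore_initial_segment[OF \<phi>(4), of N]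
    by (intro exI[of _ "\<lambda>k. \<phi> (k + N)"]) auto
next
  fix \<phi> assume "in_L2 f" "in_L2 g" "\<forall>k. integrable lborel (\<phi> k) \<and> in_L2 (\<phi> k)"
    "(\<lambda>k. abs_l2 (\<phi> k)) \<longlonglongrightarrow> abs_l2 f" "(\<lambda>k. abs_l2 (fourier_integral (\<phi> k))) \<longlonglongrightarrow> abs_l2 g"
  then show "is_L2_fourier f g"
    unfolding is_L2_fourier_def L2_tendsto_iff using fourier_integral_L2(1)
    by (intro exI[of _ \<phi>]) (auto intro!: always_eventually)
qed

lemma is_L2_fourier_add:
  assumes "is_L2_fourier f g" "is_L2_fourier f' g'"
  shows "is_L2_fourier (\<lambda>x. f x + f' x) (\<lambda>x. g x + g' x)"
proof -
  from assms obtain \<phi> \<phi>' where L: "in_L2 f" "in_L2 f'" "in_L2 g" "in_L2 g'"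
    and \<phi>: "\<And>k. integrable lborel (\<phi> k)" "\<And>k. in_L2 (\<phi> k)" "(\<lambda>k. abs_l2 (\<phi> k)) \<longlonglongrightarrow> abs_l2 f"
      "(\<lambda>k. abs_l2 (fourier_integral (\<phi> k))) \<longlonglongrightarrow> abs_l2 g"
    and \<phi>': "\<And>k. integrable lborel (\<phi>' k)" "\<And>k. in_L2 (\<phi>' k)" "(\<lambda>k. abs_l2 (\<phi>' k)) \<longlonglongrightarrow> abs_l2 f'"
      "(\<lambda>k. abs_l2 (fourier_integral (\<phi>' k))) \<longlonglongrightarrow> abs_l2 g'"
    unfolding is_L2_fourier_iff by metis
  have "(\<lambda>k. abs_l2 (\<lambda>x. \<phi> k x + \<phi>' k x)) \<longlonglongrightarrow> abs_l2 (\<lambda>x. f x + f' x)"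
    using tendsto_add[OF \<phi>(3) \<phi>'(3)] by (simp add: abs_l2_add L \<phi>(2) \<phi>'(2))
  moreover have "fourier_integral (\<lambda>x. \<phi> k x + \<phi>' k x) = (\<lambda>\<xi>. fourier_integral (\<phi> k) \<xi> + fourier_integral (\<phi>' k) \<xi>)" for k
    using fourier_integral_add[OF \<phi>(1) \<phi>'(1), of k k] by auto
  then have "(\<lambda>k. abs_l2 (fourier_integral (\<lambda>x. \<phi> k x + \<phi>' k x))) \<longlonglongrightarrow> abs_l2 (\<lambda>x. g x + g' x)"
    using tendsto_add[OF \<phi>(4) \<phi>'(4)]
    by (simp add: abs_l2_add L fourier_integral_L2(1) \<phi>(1,2) \<phi>'(1,2))
  ultimately show ?thesis
    unfolding is_L2_fourier_iff using \<phi> \<phi>' L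
    by (auto intro!: in_L2_add exI[of _ "\<lambda>k x. \<phi> k x + \<phi>' k x"])
qed

lemma is_L2_fourier_scaleR:
  assumes "is_L2_fourier f g"
  shows "is_L2_fourier (\<lambda>x. c *\<^sub>R f x) (\<lambda>x. c *\<^sub>R g x)"
proof -
  from assms obtain \<phi> where L: "in_L2 f" "in_L2 g"
    and \<phi>: "\<And>k. integrable lborel (\<phi> k)" "\<And>k. in_L2 (\<phi> k)" "(\<lambda>k. abs_l2 (\<phi> k)) \<longlonglongrightarrow> abs_l2 f"
      "(\<lambda>k. abs_l2 (fourier_integral (\<phi> k))) \<longlonglongrightarrow> abs_l2 g"
    unfolding is_L2_fourier_iff by metis
  have "(\<lambda>k. abs_l2 (\<lambda>x. c *\<^sub>R \<phi> k x)) \<longlonglongrightarrow> abs_l2 (\<lambda>x. c *\<^sub>R f x)"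
    using tendsto_scaleR[OF tendsto_const \<phi>(3), of c] by (simp only: abs_l2_scaleR L \<phi>(2))
  moreover have "fourier_integral (\<lambda>x. c *\<^sub>R \<phi> k x) = (\<lambda>\<xi>. c *\<^sub>R fourier_integral (\<phi> k) \<xi>)" for k
    using fourier_integral_scaleR by auto
  then have "(\<lambda>k. abs_l2 (fourier_integral (\<lambda>x. c *\<^sub>R \<phi> k x))) \<longlonglongrightarrow> abs_l2 (\<lambda>x. c *\<^sub>R g x)"
    using tendsto_scaleR[OF tendsto_const \<phi>(4), of c]
    by (simp only: abs_l2_scaleR L fourier_integral_L2(1) \<phi>(1,2))
  ultimately show ?thesis
    unfolding is_L2_fourier_iff using \<phi> L
    by (auto intro!: in_L2_scaleR exI[of _ "\<lambda>k x. c *\<^sub>R \<phi> k x"])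
qed

lemma is_L2_fourier_bound:
  fixes f :: "'a::euclidean_space \<Rightarrow> complex"
  assumes "is_L2_fourier f g"
  shows "norm (abs_l2 g) \<le> sqrt (plancherel_const TYPE('a)) * norm (abs_l2 f)"
proof -
  from assms obtain \<phi> where
    \<phi>: "\<And>k. integrable lborel (\<phi> k)" "\<And>k. in_L2 (\<phi> k)" "(\<lambda>k. abs_l2 (\<phi> k)) \<longlonglongrightarrow> abs_l2 f"
      "(\<lambda>k. abs_l2 (fourier_integral (\<phi> k))) \<longlonglongrightarrow> abs_l2 g"
    unfolding is_L2_fourier_iff by metis
  show ?thesis
  proof (rule LIMSEQ_le[OF tendsto_norm[OF \<phi>(4)] tendsto_mult[OF tendsto_const tendsto_norm[OF \<phi>(3)]]])
    show "\<exists>N. \<forall>n\<ge>N. norm (abs_l2 (fourier_integral (\<phi> n))) \<le> sqrt (plancherel_const TYPE('a)) * norm (abs_l2 (\<phi> n))"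
      using fourier_integral_L2[OF \<phi>(1,2)] by (auto simp: norm_abs_l2 \<phi>(2))
  qed
qed

lemma is_L2_fourier_unique:
  assumes "is_L2_fourier f g" "is_L2_fourier f' g'" "abs_l2 f = abs_l2 f'"
  shows "abs_l2 g = abs_l2 g'"
proof -
  have L: "in_L2 f" "in_L2 f'" "in_L2 g" "in_L2 g'"
    using assms by (auto simp: is_L2_fourier_iff)
  have "is_L2_fourier (\<lambda>x. f x + (-1) *\<^sub>R f' x) (\<lambda>x. g x + (-1) *\<^sub>R g' x)"
    by (intro is_L2_fourier_add is_L2_fourier_scaleR assms)
  then have "is_L2_fourier (\<lambda>x. f x - f' x) (\<lambda>x. g x - g' x)" by simp
  from is_L2_fourier_bound[OF this] have "norm (abs_l2 g - abs_l2 g') \<le> 0"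
    using assms(3) by (simp only: abs_l2_diff[symmetric] L) simp
  then show ?thesis by simp
qed

text \<open>The transforms of an approximating sequence form a Cauchy sequence by the Plancherel
  bound, so completeness of \<open>l2\<close> provides the limit.\<close>

lemma is_L2_fourier_exists:
  fixes f :: "'a::euclidean_space \<Rightarrow> complex"
  assumes f: "in_L2 f"
  shows "\<exists>g. is_L2_fourier f g"
proof -
  obtain \<phi> :: "nat \<Rightarrow> 'a \<Rightarrow> complex" where \<phi>: "\<And>k. integrable lborel (\<phi> k)" "\<And>k. in_L2 (\<phi> k)"
    "L2_tendsto \<phi> f sequentially" using L2_dense_integrable[OF f] by blast
  let ?s = "sqrt (plancherel_const TYPE('a))"
  have s: "0 < ?s" using plancherel_const_pos[where 'a = 'a] by simp
  have lim: "(\<lambda>k. abs_l2 (\<phi> k)) \<longlonglongrightarrow> abs_l2 f" using \<phi>(3) by (simp add: L2_tendsto_iff)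
  then have C: "Cauchy (\<lambda>k. abs_l2 (\<phi> k))" by (rule LIMSEQ_imp_Cauchy)
  have le: "norm (abs_l2 (fourier_integral (\<phi> k)) - abs_l2 (fourier_integral (\<phi> m)))
      \<le> ?s * norm (abs_l2 (\<phi> k) - abs_l2 (\<phi> m))" for k m
  proof -
    have "(\<lambda>\<xi>. fourier_integral (\<phi> k) \<xi> - fourier_integral (\<phi> m) \<xi>) = fourier_integral (\<lambda>x. \<phi> k x - \<phi> m x)"
      using fourier_integral_diff[OF \<phi>(1) \<phi>(1), of k m] by auto
    moreover have "L2_norm (fourier_integral (\<lambda>x. \<phi> k x - \<phi> m x)) \<le> ?s * L2_norm (\<lambda>x. \<phi> k x - \<phi> m x)"
      using \<phi>(1,2) by (intro fourier_integral_L2(2) in_L2_diff) auto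
    ultimately show ?thesis
      using \<phi>(1,2) fourier_integral_L2(1)[OF \<phi>(1,2)] fourier_integral_L2(1)[of "\<lambda>x. \<phi> k x - \<phi> m x"]
      by (simp add: abs_l2_diff norm_abs_l2 in_L2_diff)
  qed
  have "Cauchy (\<lambda>k. abs_l2 (fourier_integral (\<phi> k)))"
  proof (rule CauchyI)
    fix e :: real assume "0 < e"
    then have "0 < e / ?s" using s by simp
    from CauchyD[OF C this] obtain M where
      M: "\<And>m n. m \<ge> M \<Longrightarrow> n \<ge> M \<Longrightarrow> norm (abs_l2 (\<phi> m) - abs_l2 (\<phi> n)) < e / ?s" by auto
    show "\<exists>M. \<forall>m\<ge>M. \<forall>n\<ge>M. norm (abs_l2 (fourier_integral (\<phi> m)) - abs_l2 (fourier_integral (\<phi> n))) < e"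
    proof (intro exI allI impI)
      fix m n assume "M \<le> m" "M \<le> n"
      from M[OF this] have "?s * norm (abs_l2 (\<phi> m) - abs_l2 (\<phi> n)) < e"
        using s by (simp only: pos_less_divide_eq mult.commute)
      with le[of m n] show "norm (abs_l2 (fourier_integral (\<phi> m)) - abs_l2 (fourier_integral (\<phi> n))) < e"
        by linarith
    qed
  qed
  then obtain G where "(\<lambda>k. abs_l2 (fourier_integral (\<phi> k))) \<longlonglongrightarrow> G"
    using Cauchy_convergent convergentD by blast
  then have "is_L2_fourier f (rep_l2 G)"
    unfolding is_L2_fourier_iff using f lim \<phi> by auto
  then show ?thesis by (rule exI[of "is_L2_fourier f"])
qed

text \<open>Passing to classes removes the arbitrariness of the choice operator in
  \<open>L2_fourier\<close>.\<close>

definition fourier_l2 :: "'a::euclidean_space l2 \<Rightarrow> 'a l2" where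
  "fourier_l2 x = abs_l2 (L2_fourier (rep_l2 x))"

lemma is_L2_fourier_L2_fourier: "in_L2 f \<Longrightarrow> is_L2_fourier f (L2_fourier f)"
  unfolding L2_fourier_def
  by (rule someI_ex[of "is_L2_fourier f"]) (rule is_L2_fourier_exists)

lemma in_L2_L2_fourier: "in_L2 f \<Longrightarrow> in_L2 (L2_fourier f)"
  using is_L2_fourier_L2_fourier is_L2_fourier_iff by blast

lemma is_L2_fourier_fourier_l2:
  assumes "is_L2_fourier f g"
  shows "fourier_l2 (abs_l2 f) = abs_l2 g"
  unfolding fourier_l2_def
  by (rule is_L2_fourier_unique[OF is_L2_fourier_L2_fourier assms]) auto

lemma fourier_l2_abs: "in_L2 f \<Longrightarrow> fourier_l2 (abs_l2 f) = abs_l2 (L2_fourier f)"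
  by (rule is_L2_fourier_fourier_l2) (rule is_L2_fourier_L2_fourier)

lemma fourier_l2_integral:
  "integrable lborel f \<Longrightarrow> in_L2 f \<Longrightarrow> fourier_l2 (abs_l2 f) = abs_l2 (fourier_integral f)"
  by (rule is_L2_fourier_fourier_l2) (rule is_L2_fourier_fourier_integral)

lemma norm_fourier_l2_le:
  "norm (fourier_l2 (x :: 'a::euclidean_space l2)) \<le> sqrt (plancherel_const TYPE('a)) * norm x"
  using is_L2_fourier_bound[OF is_L2_fourier_L2_fourier[OF in_L2_rep, of x]]
  by (simp add: fourier_l2_def)

lemma bounded_linear_fourier_l2: "bounded_linear (fourier_l2 :: 'a::euclidean_space l2 \<Rightarrow> 'a l2)"
proof (rule bounded_linear_intro)
  fix x y :: "'a l2" and c :: real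
  note F = is_L2_fourier_L2_fourier[OF in_L2_rep]
  have "fourier_l2 (abs_l2 (\<lambda>\<xi>. rep_l2 x \<xi> + rep_l2 y \<xi>)) = abs_l2 (\<lambda>\<xi>. L2_fourier (rep_l2 x) \<xi> + L2_fourier (rep_l2 y) \<xi>)"
    by (intro is_L2_fourier_fourier_l2 is_L2_fourier_add F)
  also have "\<dots> = fourier_l2 x + fourier_l2 y"
    unfolding fourier_l2_def by (rule abs_l2_add[symmetric]; rule in_L2_L2_fourier[OF in_L2_rep])
  also have "abs_l2 (\<lambda>\<xi>. rep_l2 x \<xi> + rep_l2 y \<xi>) = x + y"
    using abs_l2_add[of "rep_l2 x" "rep_l2 y"] by simp
  finally show "fourier_l2 (x + y) = fourier_l2 x + fourier_l2 y" .
  have "fourier_l2 (abs_l2 (\<lambda>\<xi>. c *\<^sub>R rep_l2 x \<xi>)) = abs_l2 (\<lambda>\<xi>. c *\<^sub>R L2_fourier (rep_l2 x) \<xi>)"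
    by (intro is_L2_fourier_fourier_l2 is_L2_fourier_scaleR F)
  also have "\<dots> = c *\<^sub>R fourier_l2 x"
    unfolding fourier_l2_def by (rule abs_l2_scaleR[symmetric]; rule in_L2_L2_fourier[OF in_L2_rep])
  also have "abs_l2 (\<lambda>\<xi>. c *\<^sub>R rep_l2 x \<xi>) = c *\<^sub>R x"
    using abs_l2_scaleR[of "rep_l2 x" c] by simp
  finally show "fourier_l2 (c *\<^sub>R x) = c *\<^sub>R fourier_l2 x" .
  show "norm (fourier_l2 x) \<le> norm x * sqrt (plancherel_const TYPE('a))"
    using norm_fourier_l2_le[of x] by (simp only: mult.commute)
qed

section \<open>Reflection, inversion and Plancherel on classes\<close>

definition reflect_l2 :: "'a::euclidean_space l2 \<Rightarrow> 'a l2" where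
  "reflect_l2 x = abs_l2 (\<lambda>\<xi>. rep_l2 x (- \<xi>))"

text \<open>That the result does not depend on the representative is argued through norms: the
  difference of two representatives has norm 0, and reflection preserves the norm.\<close>

lemma reflect_l2_abs:
  assumes f: "in_L2 f"
  shows "reflect_l2 (abs_l2 f) = abs_l2 (\<lambda>x. f (- x))"
proof -
  have d: "in_L2 (\<lambda>x. rep_l2 (abs_l2 f) x - f x)" by (intro in_L2_diff in_L2_rep f)
  have "abs_l2 (rep_l2 (abs_l2 f)) - abs_l2 f = 0" by simp
  then have "L2_norm (\<lambda>x. rep_l2 (abs_l2 f) x - f x) = 0"
    using d by (simp only: abs_l2_diff in_L2_rep f) (simp add: norm_abs_l2[symmetric])
  then have "L2_norm (\<lambda>x. rep_l2 (abs_l2 f) (- x) - f (- x)) = 0"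
    using L2_norm_reflect[OF d] by simp
  then have "norm (abs_l2 (\<lambda>x. rep_l2 (abs_l2 f) (- x)) - abs_l2 (\<lambda>x. f (- x))) = 0"
    using in_L2_reflect[OF d] by (simp only: abs_l2_diff in_L2_reflect in_L2_rep f norm_abs_l2)
  then show ?thesis by (simp add: reflect_l2_def)
qed

lemma reflect_reflect_l2 [simp]: "reflect_l2 (reflect_l2 x) = x"
  unfolding reflect_l2_def[of x] by (subst reflect_l2_abs) (auto intro: in_L2_reflect)

lemma norm_reflect_l2 [simp]: "norm (reflect_l2 x) = norm x"
proof -
  have "norm (reflect_l2 x) = L2_norm (\<lambda>\<xi>. rep_l2 x (- \<xi>))"
    unfolding reflect_l2_def by (intro norm_abs_l2 in_L2_reflect in_L2_rep)
  then show ?thesis by (simp only: L2_norm_reflect in_L2_rep norm_l2_rep)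
qed

lemma bounded_linear_reflect_l2: "bounded_linear reflect_l2"
proof (rule bounded_linear_intro[where K = 1])
  fix x y :: "'a l2" and c :: real
  have "reflect_l2 (abs_l2 (rep_l2 x) + abs_l2 (rep_l2 y)) = abs_l2 (\<lambda>\<xi>. rep_l2 x (- \<xi>) + rep_l2 y (- \<xi>))"
    by (simp only: abs_l2_add in_L2_rep reflect_l2_abs in_L2_add)
  also have "\<dots> = reflect_l2 x + reflect_l2 y"
    unfolding reflect_l2_def by (rule abs_l2_add[symmetric]; rule in_L2_reflect[OF in_L2_rep])
  finally show "reflect_l2 (x + y) = reflect_l2 x + reflect_l2 y" by simp
  have "reflect_l2 (c *\<^sub>R abs_l2 (rep_l2 x)) = abs_l2 (\<lambda>\<xi>. c *\<^sub>R rep_l2 x (- \<xi>))"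
    by (simp only: abs_l2_scaleR in_L2_rep reflect_l2_abs in_L2_scaleR)
  also have "\<dots> = c *\<^sub>R reflect_l2 x"
    unfolding reflect_l2_def by (rule abs_l2_scaleR[symmetric]; rule in_L2_reflect[OF in_L2_rep])
  finally show "reflect_l2 (c *\<^sub>R x) = c *\<^sub>R reflect_l2 x" by simp
qed simp

lemma fourier_fourier_l2:
  fixes x :: "'a::euclidean_space l2"
  shows "fourier_l2 (fourier_l2 x) = plancherel_const TYPE('a) *\<^sub>R reflect_l2 x"
proof -
  interpret F: bounded_linear "fourier_l2 :: 'a l2 \<Rightarrow> 'a l2" by (rule bounded_linear_fourier_l2)
  interpret R: bounded_linear "reflect_l2 :: 'a l2 \<Rightarrow> 'a l2" by (rule bounded_linear_reflect_l2)
  obtain \<phi> where \<phi>: "\<And>k. integrable lborel (\<phi> k)" "\<And>k. in_L2 (\<phi> k)" "L2_tendsto \<phi> (rep_l2 x) sequentially"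
    using L2_dense_integrable[OF in_L2_rep] by blast
  have lim: "(\<lambda>k. abs_l2 (\<phi> k)) \<longlonglongrightarrow> x" using \<phi>(3) by (simp add: L2_tendsto_iff)
  have eq: "fourier_l2 (fourier_l2 (abs_l2 (\<phi> k))) = plancherel_const TYPE('a) *\<^sub>R reflect_l2 (abs_l2 (\<phi> k))" for k
    using is_L2_fourier_fourier_l2[OF is_L2_fourier_inversion[OF \<phi>(1,2)], of k]
    by (simp only: fourier_l2_integral \<phi>(1,2) reflect_l2_abs abs_l2_scaleR in_L2_reflect)
  have "(\<lambda>k. fourier_l2 (fourier_l2 (abs_l2 (\<phi> k)))) \<longlonglongrightarrow> fourier_l2 (fourier_l2 x)"
    by (intro F.tendsto lim)
  moreover have "(\<lambda>k. plancherel_const TYPE('a) *\<^sub>R reflect_l2 (abs_l2 (\<phi> k))) \<longlonglongrightarrow> plancherel_const TYPE('a) *\<^sub>R reflect_l2 x"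
    by (intro tendsto_intros R.tendsto lim)
  ultimately show ?thesis unfolding eq by (rule LIMSEQ_unique)
qed

text \<open>The lower bound follows from the upper bound: applying the transform twice gives (2
  pi)^n times an isometry, and the outer application can gain at most a factor (2 pi)^(n/2).\<close>

theorem plancherel:
  "norm (fourier_l2 (x :: 'a::euclidean_space l2)) = sqrt (plancherel_const TYPE('a)) * norm x"
proof (rule antisym)
  let ?c = "plancherel_const TYPE('a)"
  have c: "0 < ?c" by (rule plancherel_const_pos)
  have "sqrt ?c * (sqrt ?c * norm x) = norm (fourier_l2 (fourier_l2 x))"
    using c by (simp add: fourier_fourier_l2)
  also have "\<dots> \<le> sqrt ?c * norm (fourier_l2 x)" by (rule norm_fourier_l2_le)
  finally show "sqrt ?c * norm x \<le> norm (fourier_l2 x)" using c by simp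
qed (rule norm_fourier_l2_le)

text \<open>The square of the transform is a multiple of the reflection, so a preimage is obtained
  by transforming the reflection and dividing by the constant.\<close>

lemma fourier_l2_surj:
  obtains x where "fourier_l2 x = (y :: 'a::euclidean_space l2)"
proof
  let ?c = "plancherel_const TYPE('a)"
  have "?c \<noteq> 0" using plancherel_const_pos[where 'a = 'a] by simp
  then show "fourier_l2 ((1 / ?c) *\<^sub>R fourier_l2 (reflect_l2 y)) = y"
    by (simp add: linear_cmul[OF bounded_linear.linear[OF bounded_linear_fourier_l2]] fourier_fourier_l2)
qed

text \<open>Surjectivity shows that the choice in \<open>L2_inverse_fourier\<close> ranges over a
  nonempty set whenever the argument is square integrable.\<close>

lemma L2_inverse_fourier:
  assumes g: "in_L2 g"
  shows "in_L2 (L2_inverse_fourier g)" "fourier_l2 (abs_l2 (L2_inverse_fourier g)) = abs_l2 g"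
proof -
  obtain x where x: "fourier_l2 x = abs_l2 g" by (rule fourier_l2_surj)
  have "is_L2_fourier (rep_l2 x) (L2_fourier (rep_l2 x))"
    by (rule is_L2_fourier_L2_fourier) simp
  moreover have "abs_l2 (L2_fourier (rep_l2 x)) = abs_l2 g" using x by (simp add: fourier_l2_def)
  ultimately have "is_L2_fourier (rep_l2 x) g" using g by (simp add: is_L2_fourier_iff)
  then have "is_L2_fourier (L2_inverse_fourier g) g"
    unfolding L2_inverse_fourier_def by (rule someI[of "\<lambda>f. is_L2_fourier f g"])
  then show "in_L2 (L2_inverse_fourier g)" "fourier_l2 (abs_l2 (L2_inverse_fourier g)) = abs_l2 g"
    by (auto simp: is_L2_fourier_iff is_L2_fourier_fourier_l2)
qed

section \<open>Differentiable curves in the Hilbert space\<close>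

lemma has_vector_derivative_quotientI:
  fixes x :: "real \<Rightarrow> 'a::real_normed_vector"
  assumes "((\<lambda>s. (1 / (s - t)) *\<^sub>R (x s - x t)) \<longlongrightarrow> d) (at t within S)"
  shows "(x has_vector_derivative d) (at t within S)"
  unfolding has_vector_derivative_def has_derivative_iff_norm
proof (intro conjI)
  show "bounded_linear (\<lambda>h. h *\<^sub>R d)" by (rule bounded_linear_scaleR_left)
  have "((\<lambda>s. norm ((1 / (s - t)) *\<^sub>R (x s - x t) - d)) \<longlongrightarrow> 0) (at t within S)"
    using assms by (simp only: tendsto_norm_zero_iff LIM_zero_iff)
  then show "((\<lambda>s. norm (x s - x t - (s - t) *\<^sub>R d) / norm (s - t)) \<longlongrightarrow> 0) (at t within S)"
  proof (rule Lim_transform_eventually)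
    show "\<forall>\<^sub>F s in at t within S. norm ((1 / (s - t)) *\<^sub>R (x s - x t) - d)
        = norm (x s - x t - (s - t) *\<^sub>R d) / norm (s - t)"
      unfolding eventually_at_filter
    proof (intro always_eventually allI impI)
      fix s assume "s \<noteq> t"
      then have "(1 / (s - t)) *\<^sub>R (x s - x t) - d = (1 / (s - t)) *\<^sub>R (x s - x t - (s - t) *\<^sub>R d)"
        by (simp add: scaleR_diff_right)
      then show "norm ((1 / (s - t)) *\<^sub>R (x s - x t) - d) = norm (x s - x t - (s - t) *\<^sub>R d) / norm (s - t)"
        by (simp add: norm_minus_commute)
    qed
  qed
qed

lemma has_L2_derivative_abs_l2:
  assumes u: "has_L2_derivative u v" and t: "0 \<le> t"
  shows "((\<lambda>s. abs_l2 (u s)) has_vector_derivative abs_l2 (v t)) (at t within {0..})"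
proof (rule has_vector_derivative_quotientI)
  have uL: "0 \<le> s \<Longrightarrow> in_L2 (u s)" for s using u by (simp add: has_L2_derivative_def)
  have "((\<lambda>s. abs_l2 (\<lambda>x. (u s x - u t x) / complex_of_real (s - t))) \<longlongrightarrow> abs_l2 (v t)) (at t within {0..})"
    using u t by (simp add: has_L2_derivative_def L2_tendsto_iff)
  then show "((\<lambda>s. (1 / (s - t)) *\<^sub>R (abs_l2 (u s) - abs_l2 (u t))) \<longlongrightarrow> abs_l2 (v t)) (at t within {0..})"
  proof (rule Lim_transform_eventually)
    show "\<forall>\<^sub>F s in at t within {0..}. abs_l2 (\<lambda>x. (u s x - u t x) / complex_of_real (s - t))
        = (1 / (s - t)) *\<^sub>R (abs_l2 (u s) - abs_l2 (u t))"
      unfolding eventually_at_filter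
    proof (intro always_eventually allI impI)
      fix s :: real assume "s \<noteq> t" "s \<in> {0..}"
      then have s: "in_L2 (u s)" using uL by simp
      have "(\<lambda>x. (u s x - u t x) / complex_of_real (s - t)) = (\<lambda>x. (1 / (s - t)) *\<^sub>R (u s x - u t x))"
        by (simp add: scaleR_conv_of_real)
      then show "abs_l2 (\<lambda>x. (u s x - u t x) / complex_of_real (s - t))
          = (1 / (s - t)) *\<^sub>R (abs_l2 (u s) - abs_l2 (u t))"
        by (simp only: abs_l2_diff abs_l2_scaleR s uL[OF t] in_L2_diff)
    qed
  qed
qed

section \<open>Composition, equality and time derivatives of multiplication operators\<close>

lemma mult_l2_mult:
  assumes m: "bounded_symbol m" and k: "bounded_symbol k"
  shows "mult_l2 m (mult_l2 k x) = mult_l2 (\<lambda>\<xi>. m \<xi> * k \<xi>) x"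
  unfolding mult_l2_def[of k x] mult_l2_abs[OF m in_L2_mult[OF k in_L2_rep]]
  by (simp add: mult_l2_def)

lemma mult_l2_eq_iff:
  assumes m: "bounded_symbol m" and k: "bounded_symbol k"
  shows "mult_l2 m x = mult_l2 k y \<longleftrightarrow> (AE \<xi> in lborel. m \<xi> *\<^sub>R rep_l2 x \<xi> = k \<xi> *\<^sub>R rep_l2 y \<xi>)"
  unfolding mult_l2_def by (rule abs_l2_eq_iff) (intro in_L2_mult m k in_L2_rep)+

text \<open>The mean value inequality bounds the difference quotients of the symbol by C uniformly
  in frequency, so pointwise differentiability upgrades to L^2 differentiability by dominated
  convergence along sequences.\<close>

lemma has_vector_derivative_mult_symbol:
  fixes e e' :: "real \<Rightarrow> 'a::euclidean_space \<Rightarrow> real"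
  assumes e: "\<And>s. 0 \<le> s \<Longrightarrow> bounded_symbol (e s)"
    and e': "\<And>s. 0 \<le> s \<Longrightarrow> e' s \<in> borel_measurable borel"
    and C: "\<And>s \<xi>. 0 \<le> s \<Longrightarrow> \<bar>e' s \<xi>\<bar> \<le> C"
    and deriv: "\<And>s \<xi>. 0 \<le> s \<Longrightarrow> ((\<lambda>s. e s \<xi>) has_real_derivative e' s \<xi>) (at s within {0..})"
    and t: "0 \<le> t"
  shows "((\<lambda>s. mult_l2 (e s) g) has_vector_derivative mult_l2 (e' t) g) (at t within {0..})"
proof (rule has_vector_derivative_quotientI, unfold tendsto_at_iff_sequentially, intro allI impI)
  fix X :: "nat \<Rightarrow> real"
  assume X: "\<forall>i. X i \<in> {0..} - {t}" and lim: "X \<longlonglongrightarrow> t"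
  then have X0: "0 \<le> X i" "X i \<noteq> t" for i by auto
  let ?d = "\<lambda>i \<xi>. (e (X i) \<xi> - e t \<xi>) / (X i - t)"
  have dm: "?d i \<in> borel_measurable borel" for i
    using bounded_symbol_measurable[OF e[OF X0(1)], of i] bounded_symbol_measurable[OF e[OF t]] by simp
  have dC: "\<bar>?d i \<xi>\<bar> \<le> C" for i \<xi>
  proof -
    have "norm (e (X i) \<xi> - e t \<xi>) \<le> C * norm (X i - t)"
      by (rule field_differentiable_bound[of "{0..}" "\<lambda>s. e s \<xi>" "\<lambda>s. e' s \<xi>"])
         (use deriv C X0 t in auto)
    then show ?thesis using X0(2)[of i] by (simp add: abs_divide divide_le_eq)
  qed
  have "L2_tendsto (\<lambda>i \<xi>. ?d i \<xi> *\<^sub>R rep_l2 g \<xi>) (\<lambda>\<xi>. e' t \<xi> *\<^sub>R rep_l2 g \<xi>) sequentially"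
  proof (rule L2_tendsto_dominated[OF _ in_L2_rep[of g], where C = C])
    note [measurable] = dm e'[OF t] in_L2_measurable[OF in_L2_rep[of g]]
    show "(\<lambda>\<xi>. ?d i \<xi> *\<^sub>R rep_l2 g \<xi>) \<in> borel_measurable borel" for i
      by (intro borel_measurable_scaleR dm) measurable
    show "(\<lambda>\<xi>. e' t \<xi> *\<^sub>R rep_l2 g \<xi>) \<in> borel_measurable borel" by measurable
    show "norm (?d i \<xi> *\<^sub>R rep_l2 g \<xi>) \<le> C * norm (rep_l2 g \<xi>)" for i \<xi>
      unfolding norm_scaleR by (intro mult_right_mono dC) simp
    show "(\<lambda>i. ?d i \<xi> *\<^sub>R rep_l2 g \<xi>) \<longlonglongrightarrow> e' t \<xi> *\<^sub>R rep_l2 g \<xi>" for \<xi>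
    proof (intro tendsto_intros)
      have "((\<lambda>s. (e s \<xi> - e t \<xi>) / (s - t)) \<longlongrightarrow> e' t \<xi>) (at t within {0..})"
        using deriv[OF t, of \<xi>] by (simp add: has_field_derivative_iff)
      then show "(\<lambda>i. ?d i \<xi>) \<longlonglongrightarrow> e' t \<xi>"
        using X lim by (auto simp: tendsto_at_iff_sequentially comp_def)
    qed
  qed
  then have "(\<lambda>i. abs_l2 (\<lambda>\<xi>. ?d i \<xi> *\<^sub>R rep_l2 g \<xi>)) \<longlonglongrightarrow> mult_l2 (e' t) g"
    by (simp add: L2_tendsto_iff mult_l2_def)
  moreover have "abs_l2 (\<lambda>\<xi>. ?d i \<xi> *\<^sub>R rep_l2 g \<xi>) = (1 / (X i - t)) *\<^sub>R (mult_l2 (e (X i)) g - mult_l2 (e t) g)" for i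
  proof -
    have "(\<lambda>\<xi>. ?d i \<xi> *\<^sub>R rep_l2 g \<xi>) = (\<lambda>\<xi>. (1 / (X i - t)) *\<^sub>R (e (X i) \<xi> *\<^sub>R rep_l2 g \<xi> - e t \<xi> *\<^sub>R rep_l2 g \<xi>))"
      by (simp add: scaleR_diff_left[symmetric])
    then show ?thesis
      unfolding mult_l2_def
      by (simp only: abs_l2_diff abs_l2_scaleR in_L2_diff in_L2_mult e X0(1) t in_L2_rep)
  qed
  ultimately show "((\<lambda>s. (1 / (s - t)) *\<^sub>R (mult_l2 (e s) g - mult_l2 (e t) g)) \<circ> X) \<longlonglongrightarrow> mult_l2 (e' t) g"
    by (simp add: comp_def)
qed

section \<open>Energy decay for the damped system\<close>

text \<open>The equation x'' + q x' + p x = 0 as a first order system in L^2. With bounded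
  \<open>p\<close> and \<open>q\<close> the right-hand side stays in L^2, so the equation can be
  required in the strong sense.\<close>

definition damped_system ::
  "('a::euclidean_space \<Rightarrow> real) \<Rightarrow> ('a \<Rightarrow> real) \<Rightarrow> (real \<Rightarrow> 'a l2) \<Rightarrow> (real \<Rightarrow> 'a l2) \<Rightarrow> bool" where
  "damped_system p q X Y \<longleftrightarrow> bounded_symbol p \<and> bounded_symbol q \<and> (\<forall>t\<ge>0.
    (X has_vector_derivative Y t) (at t within {0..}) \<and>
    (Y has_vector_derivative - mult_l2 p (X t) - mult_l2 q (Y t)) (at t within {0..}))"

lemma damped_system_diff:
  assumes "damped_system p q X Y" "damped_system p q X' Y'"
  shows "damped_system p q (\<lambda>t. X t - X' t) (\<lambda>t. Y t - Y' t)"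
proof -
  have pq: "bounded_symbol p" "bounded_symbol q" using assms by (auto simp: damped_system_def)
  have "((\<lambda>t. Y t - Y' t) has_vector_derivative - mult_l2 p (X t - X' t) - mult_l2 q (Y t - Y' t)) (at t within {0..})"
    if "0 \<le> t" for t
  proof -
    have "((\<lambda>t. Y t - Y' t) has_vector_derivative
        (- mult_l2 p (X t) - mult_l2 q (Y t)) - (- mult_l2 p (X' t) - mult_l2 q (Y' t))) (at t within {0..})"
      using assms that by (intro has_vector_derivative_diff) (auto simp: damped_system_def)
    moreover have "(- mult_l2 p (X t) - mult_l2 q (Y t)) - (- mult_l2 p (X' t) - mult_l2 q (Y' t))
        = - mult_l2 p (X t - X' t) - mult_l2 q (Y t - Y' t)"
      by (simp add: linear_diff[OF bounded_linear.linear[OF bounded_linear_mult_l2[OF pq(1)]]]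
          linear_diff[OF bounded_linear.linear[OF bounded_linear_mult_l2[OF pq(2)]]])
    ultimately show ?thesis by (simp only:)
  qed
  then show ?thesis
    using assms pq by (auto simp: damped_system_def intro!: has_vector_derivative_diff)
qed

text \<open>Both bounds complete squares: \<open>(y - 2 a x)\<^sup>2\<close> absorbs the friction cross term and
  \<open>(y - a x)\<^sup>2\<close> the one stemming from the correction \<open>2 a (x \<bullet> y)\<close> of the energy.\<close>

lemma lyapunov_pointwise:
  fixes x y :: "'b::real_inner"
  assumes a: "0 < a" and q: "4 * a \<le> q" and p: "4 * a * q \<le> p"
  shows "3 * a * (y \<bullet> y) + 2 * a\<^sup>2 * (x \<bullet> y) \<le> 2 * q * (y \<bullet> y) + a * p * (x \<bullet> x) + 2 * a * q * (y \<bullet> x)"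
    and "0 \<le> (y \<bullet> y) / 2 + p * (x \<bullet> x) / 2 + 2 * a * (x \<bullet> y)"
proof -
  have "16 * a\<^sup>2 \<le> 4 * a * q" using a mult_left_mono[OF q, of "4 * a"] by (simp add: power2_eq_square)
  with p have p2: "16 * a\<^sup>2 \<le> p" by linarith
  define X where "X = norm x"
  define Y where "Y = norm y"
  have xy: "\<bar>x \<bullet> y\<bar> \<le> X * Y" unfolding X_def Y_def by (rule Cauchy_Schwarz_ineq2)
  have xx: "x \<bullet> x = X\<^sup>2" "y \<bullet> y = Y\<^sup>2" by (simp_all add: X_def Y_def power2_norm_eq_inner)
  have X0: "0 \<le> X" "0 \<le> Y" by (simp_all add: X_def Y_def)
  have s1: "2 * a * q * (X * Y) \<le> q / 2 * Y\<^sup>2 + 2 * a\<^sup>2 * q * X\<^sup>2"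
  proof -
    have "0 \<le> q / 2 * (Y - 2 * a * X)\<^sup>2" using a q by simp
    then show ?thesis by (simp add: power2_eq_square algebra_simps)
  qed
  have s2: "2 * a\<^sup>2 * (X * Y) \<le> a * Y\<^sup>2 + a\<^sup>2 * a * X\<^sup>2"
  proof -
    have "0 \<le> a * (Y - a * X)\<^sup>2" using a by simp
    then show ?thesis by (simp add: power2_eq_square algebra_simps)
  qed
  have s3: "2 * a\<^sup>2 * q * X\<^sup>2 \<le> a * p / 2 * X\<^sup>2"
    using mult_left_mono[OF p, of "a / 2"] a by (intro mult_right_mono) (auto simp: power2_eq_square)
  have s4: "a\<^sup>2 * a * X\<^sup>2 \<le> a * p / 2 * X\<^sup>2"
  proof (rule mult_right_mono)
    have "a\<^sup>2 \<le> p / 2" using p2 zero_le_power2[of a] by linarith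
    then show "a\<^sup>2 * a \<le> a * p / 2" using mult_left_mono[of "a\<^sup>2" "p / 2" a] a by (simp add: mult.commute)
  qed simp
  have s5: "4 * a * Y\<^sup>2 \<le> q * Y\<^sup>2" using q by (intro mult_right_mono) auto
  have c1: "- (2 * a * q * (x \<bullet> y)) \<le> 2 * a * q * (X * Y)"
    using xy a q mult_left_mono[of "- (x \<bullet> y)" "X * Y" "2 * a * q"] by simp
  have c2: "2 * a\<^sup>2 * (x \<bullet> y) \<le> 2 * a\<^sup>2 * (X * Y)"
    using xy by (intro mult_left_mono) auto
  have s6: "0 \<le> q * Y\<^sup>2" using a q by simp
  show "3 * a * (y \<bullet> y) + 2 * a\<^sup>2 * (x \<bullet> y) \<le> 2 * q * (y \<bullet> y) + a * p * (x \<bullet> x) + 2 * a * q * (y \<bullet> x)"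
    unfolding xx inner_commute[of y x] using s1 s2 s3 s4 s5 s6 c1 c2
    by (simp only: algebra_simps times_divide_eq_left times_divide_eq_right)
  have "0 \<le> (Y - 2 * a * X)\<^sup>2" by simp
  then have "2 * a * (X * Y) \<le> Y\<^sup>2 / 2 + 2 * a\<^sup>2 * X\<^sup>2"
    by (simp add: power2_eq_square algebra_simps)
  moreover have "2 * a\<^sup>2 * X\<^sup>2 \<le> p / 2 * X\<^sup>2"
  proof (rule mult_right_mono)
    show "2 * a\<^sup>2 \<le> p / 2" using p2 zero_le_power2[of a] by linarith
  qed simp
  moreover have "- (2 * a * (x \<bullet> y)) \<le> 2 * a * (X * Y)"
    using xy a mult_left_mono[of "- (x \<bullet> y)" "X * Y" "2 * a"] by simp
  ultimately show "0 \<le> (y \<bullet> y) / 2 + p * (x \<bullet> x) / 2 + 2 * a * (x \<bullet> y)"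
    unfolding xx by linarith
qed

lemma mult_l2_inner_integrable:
  assumes "bounded_symbol m"
  shows "integrable lborel (\<lambda>\<xi>. m \<xi> * (rep_l2 x \<xi> \<bullet> rep_l2 y \<xi>))"
  using in_L2_inner_integrable[OF in_L2_mult[OF assms in_L2_rep] in_L2_rep, of x y] by simp

text \<open>With E = y.y + (p x).x + 2 a x.y the first inequality is E' + a E <= 0 along the system,
  rearranged; the second, doubled, is y.y + (p x).x <= 2 E. Outside \<open>Z\<close> both states
  vanish, so the conditions on \<open>p\<close> and \<open>q\<close> are demanded only on
  \<open>Z\<close>.\<close>

lemma lyapunov_l2:
  fixes x y :: "'a::euclidean_space l2"
  assumes p: "bounded_symbol p" and q: "bounded_symbol q" and a: "0 < a"
    and pq: "\<And>\<xi>. \<xi> \<in> Z \<Longrightarrow> 4 * a \<le> q \<xi> \<and> 4 * a * q \<xi> \<le> p \<xi>"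
    and supp: "AE \<xi> in lborel. \<xi> \<notin> Z \<longrightarrow> rep_l2 x \<xi> = 0 \<and> rep_l2 y \<xi> = 0"
  shows "3 * a * (y \<bullet> y) + 2 * a\<^sup>2 * (x \<bullet> y)
      \<le> 2 * (mult_l2 q y \<bullet> y) + a * (mult_l2 p x \<bullet> x) + 2 * a * (mult_l2 q y \<bullet> x)"
    and "0 \<le> (y \<bullet> y) / 2 + (mult_l2 p x \<bullet> x) / 2 + 2 * a * (x \<bullet> y)"
proof -
  let ?x = "rep_l2 x" and ?y = "rep_l2 y"
  note i = in_L2_inner_integrable[OF in_L2_rep in_L2_rep] mult_l2_inner_integrable[OF p] mult_l2_inner_integrable[OF q]
  have "(LINT \<xi>|lborel. 3 * a * (?y \<xi> \<bullet> ?y \<xi>) + 2 * a\<^sup>2 * (?x \<xi> \<bullet> ?y \<xi>))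
      \<le> (LINT \<xi>|lborel. 2 * (q \<xi> * (?y \<xi> \<bullet> ?y \<xi>)) + a * (p \<xi> * (?x \<xi> \<bullet> ?x \<xi>)) + 2 * a * (q \<xi> * (?y \<xi> \<bullet> ?x \<xi>)))"
  proof (rule integral_mono_AE)
    show "AE \<xi> in lborel. 3 * a * (?y \<xi> \<bullet> ?y \<xi>) + 2 * a\<^sup>2 * (?x \<xi> \<bullet> ?y \<xi>)
        \<le> 2 * (q \<xi> * (?y \<xi> \<bullet> ?y \<xi>)) + a * (p \<xi> * (?x \<xi> \<bullet> ?x \<xi>)) + 2 * a * (q \<xi> * (?y \<xi> \<bullet> ?x \<xi>))"
      using supp
    proof eventually_elim
      case (elim \<xi>)
      show ?case
      proof (cases "\<xi> \<in> Z")
        case True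
        then show ?thesis using lyapunov_pointwise(1)[OF a, of "q \<xi>" "p \<xi>" "?y \<xi>" "?x \<xi>"] pq by (simp add: mult.assoc)
      qed (use elim in simp)
    qed
  qed (intro Bochner_Integration.integrable_add integrable_mult_right i)+
  then show "3 * a * (y \<bullet> y) + 2 * a\<^sup>2 * (x \<bullet> y)
      \<le> 2 * (mult_l2 q y \<bullet> y) + a * (mult_l2 p x \<bullet> x) + 2 * a * (mult_l2 q y \<bullet> x)"
    unfolding mult_l2_inner[OF p] mult_l2_inner[OF q] inner_l2_rep[of y y] inner_l2_rep[of x y]
    by (simp only: Bochner_Integration.integral_add Bochner_Integration.integrable_add
        integrable_mult_right integral_mult_right_zero i)
  have "0 \<le> (LINT \<xi>|lborel. 1 / 2 * (?y \<xi> \<bullet> ?y \<xi>) + 1 / 2 * (p \<xi> * (?x \<xi> \<bullet> ?x \<xi>)) + 2 * a * (?x \<xi> \<bullet> ?y \<xi>))"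
  proof (rule integral_nonneg_AE)
    show "AE \<xi> in lborel. 0 \<le> 1 / 2 * (?y \<xi> \<bullet> ?y \<xi>) + 1 / 2 * (p \<xi> * (?x \<xi> \<bullet> ?x \<xi>)) + 2 * a * (?x \<xi> \<bullet> ?y \<xi>)"
      using supp
    proof eventually_elim
      case (elim \<xi>)
      show ?case
      proof (cases "\<xi> \<in> Z")
        case True
        then show ?thesis using lyapunov_pointwise(2)[OF a, of "q \<xi>" "p \<xi>" "?y \<xi>" "?x \<xi>"] pq by simp
      qed (use elim in simp)
    qed
  qed
  then show "0 \<le> (y \<bullet> y) / 2 + (mult_l2 p x \<bullet> x) / 2 + 2 * a * (x \<bullet> y)"
    unfolding mult_l2_inner[OF p] inner_l2_rep[of y y] inner_l2_rep[of x y]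
    by (simp only: Bochner_Integration.integral_add Bochner_Integration.integrable_add
        integrable_mult_right integral_mult_right_zero i)
qed

lemma mult_l2_symmetric: "bounded_symbol m \<Longrightarrow> mult_l2 m x \<bullet> y = mult_l2 m y \<bullet> x"
  by (simp only: mult_l2_inner) (intro Bochner_Integration.integral_cong; simp add: inner_commute)

text \<open>Since E' + a E <= 0, the function e^(a t) E does not increase. A vanishing initial state
  reduces the initial energy to the kinetic part. If the initial velocity vanishes too, the bound is
  0, and in this form the lemma serves as a uniqueness result.\<close>

lemma damped_system_decay:
  fixes X Y :: "real \<Rightarrow> 'a::euclidean_space l2"
  assumes sys: "damped_system p q X Y" and a: "0 < a"
    and pq: "\<And>\<xi>. \<xi> \<in> Z \<Longrightarrow> 4 * a \<le> q \<xi> \<and> 4 * a * q \<xi> \<le> p \<xi>"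
    and supp: "\<And>t. 0 \<le> t \<Longrightarrow> AE \<xi> in lborel. \<xi> \<notin> Z \<longrightarrow> rep_l2 (X t) \<xi> = 0 \<and> rep_l2 (Y t) \<xi> = 0"
    and X0: "X 0 = 0" and t: "0 \<le> t"
  shows "(norm (Y t))\<^sup>2 + mult_l2 p (X t) \<bullet> X t \<le> 2 * exp (- a * t) * (norm (Y 0))\<^sup>2"
proof -
  have p: "bounded_symbol p" and q: "bounded_symbol q" using sys by (auto simp: damped_system_def)
  define E where "E s = Y s \<bullet> Y s + mult_l2 p (X s) \<bullet> X s + 2 * a * (X s \<bullet> Y s)" for s
  define E' where "E' s = 2 * a * (Y s \<bullet> Y s) - 2 * (mult_l2 q (Y s) \<bullet> Y s)
      - 2 * a * (mult_l2 p (X s) \<bullet> X s) - 2 * a * (mult_l2 q (Y s) \<bullet> X s)" for s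
  have dE: "(E has_real_derivative E' s) (at s within {0..})" if s: "0 \<le> s" for s
  proof -
    let ?Y' = "- mult_l2 p (X s) - mult_l2 q (Y s)"
    have dX: "(X has_derivative (\<lambda>h. h *\<^sub>R Y s)) (at s within {0..})"
      and dY: "(Y has_derivative (\<lambda>h. h *\<^sub>R ?Y')) (at s within {0..})"
      using sys s by (auto simp: damped_system_def has_vector_derivative_def)
    have dpX: "((\<lambda>s. mult_l2 p (X s)) has_derivative (\<lambda>h. mult_l2 p (h *\<^sub>R Y s))) (at s within {0..})"
      by (rule bounded_linear.has_derivative[OF bounded_linear_mult_l2[OF p] dX])
    have lin: "mult_l2 p (h *\<^sub>R Y s) = h *\<^sub>R mult_l2 p (Y s)" for h
      by (rule linear_cmul[OF bounded_linear.linear[OF bounded_linear_mult_l2[OF p]]])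
    have "(E has_derivative (\<lambda>h. (Y s \<bullet> (h *\<^sub>R ?Y') + (h *\<^sub>R ?Y') \<bullet> Y s)
        + (mult_l2 p (X s) \<bullet> (h *\<^sub>R Y s) + mult_l2 p (h *\<^sub>R Y s) \<bullet> X s)
        + 2 * a * (X s \<bullet> (h *\<^sub>R ?Y') + (h *\<^sub>R Y s) \<bullet> Y s))) (at s within {0..})"
      unfolding E_def
      by (intro has_derivative_add has_derivative_mult_right has_derivative_inner dX dY dpX)
    moreover have "(\<lambda>h. (Y s \<bullet> (h *\<^sub>R ?Y') + (h *\<^sub>R ?Y') \<bullet> Y s)
        + (mult_l2 p (X s) \<bullet> (h *\<^sub>R Y s) + mult_l2 p (h *\<^sub>R Y s) \<bullet> X s)
        + 2 * a * (X s \<bullet> (h *\<^sub>R ?Y') + (h *\<^sub>R Y s) \<bullet> Y s)) = (\<lambda>h. E' s * h)"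
      \<comment> \<open>Symmetry of the multiplier makes the two potential terms combine and cancel
        against the contribution of -p X in the kinetic term.\<close>
      using mult_l2_symmetric[OF p, of "Y s" "X s"]
      by (simp add: fun_eq_iff E'_def lin inner_diff_left inner_diff_right inner_commute algebra_simps)
    ultimately show ?thesis by (simp add: has_field_derivative_def)
  qed
  have le: "E' s + a * E s \<le> 0" if "0 \<le> s" for s
    using lyapunov_l2(1)[OF p q a pq supp[OF that]]
    by (simp add: E_def E'_def algebra_simps power2_eq_square)
  have mono: "exp (a * t) * E t \<le> exp (a * 0) * E 0"
  proof (cases "t = 0")
    case False
    with t have t0: "0 < t" by simp
    have "\<exists>s\<in>{0<..<t}. exp (a * t) * E t - exp (a * 0) * E 0 = exp (a * s) * (E' s + a * E s) * (t - 0)"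
    proof (rule mvt_simple[OF t0])
      fix s assume s: "0 \<le> s" "s \<le> t"
      have "((\<lambda>s. exp (a * s) * E s) has_real_derivative exp (a * s) * (E' s + a * E s)) (at s within {0..})"
        by (rule derivative_eq_intros dE s refl)+ (simp add: algebra_simps)
      then have "((\<lambda>s. exp (a * s) * E s) has_real_derivative exp (a * s) * (E' s + a * E s)) (at s within {0..t})"
        by (rule has_field_derivative_subset) auto
      then show "((\<lambda>s. exp (a * s) * E s) has_derivative (\<lambda>h. exp (a * s) * (E' s + a * E s) * h)) (at s within {0..t})"
        by (simp add: has_field_derivative_def)
    qed
    then obtain s where s: "0 < s" "s < t"
        "exp (a * t) * E t - exp (a * 0) * E 0 = exp (a * s) * (E' s + a * E s) * (t - 0)" by auto
    have "exp (a * s) * (E' s + a * E s) * (t - 0) \<le> 0"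
      using le[of s] s t0 by (intro mult_nonpos_nonneg mult_nonneg_nonpos) auto
    with s(3) show ?thesis by linarith
  qed simp
  have "E 0 = (norm (Y 0))\<^sup>2"
    using linear_0[OF bounded_linear.linear[OF bounded_linear_mult_l2[OF p]]]
    by (simp add: E_def X0 power2_norm_eq_inner)
  with mono have "exp (- a * t) * (exp (a * t) * E t) \<le> exp (- a * t) * (norm (Y 0))\<^sup>2"
    by (intro mult_left_mono) auto
  then have "E t \<le> exp (- a * t) * (norm (Y 0))\<^sup>2"
    by (simp add: mult.assoc[symmetric] exp_add[symmetric])
  moreover have "(norm (Y t))\<^sup>2 + mult_l2 p (X t) \<bullet> X t \<le> 2 * E t"
    using lyapunov_l2(2)[OF p q a pq supp[OF t]]
    by (simp add: E_def power2_norm_eq_inner)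
  ultimately show ?thesis by linarith
qed

section \<open>The damping symbol\<close>

definition damping :: "real \<Rightarrow> real \<Rightarrow> real" where
  "damping \<theta> r = ln (1 + r powr (2 * \<theta>))"

lemma log_symbol_damping: "log_symbol \<theta> \<xi> = damping \<theta> (norm \<xi>)"
  by (simp add: log_symbol_def damping_def)

lemma damping_measurable [measurable]: "damping \<theta> \<in> borel_measurable borel"
  unfolding damping_def[abs_def] by measurable

lemma damping_nonneg: "0 \<le> damping \<theta> r"
  by (simp add: damping_def)

lemma damping_pos: "0 < r \<Longrightarrow> 0 < damping \<theta> r"
  unfolding damping_def by (rule ln_gt_zero) simp

lemma damping_mono: "0 < \<theta> \<Longrightarrow> 0 \<le> r \<Longrightarrow> r \<le> s \<Longrightarrow> damping \<theta> r \<le> damping \<theta> s"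
  unfolding damping_def by (subst ln_le_cancel_iff) (auto intro!: powr_mono2 add_pos_nonneg)

lemma damping_le_powr: "damping \<theta> r \<le> r powr (2 * \<theta>)"
  unfolding damping_def by (rule ln_add_one_self_le_self) simp

text \<open>This is where 2 theta > 1 is used near the origin: through
  \<open>damping_le_self\<close> it gives l <= r for r <= 1, so the discriminant l^2/4 - r^2 is
  negative.\<close>

lemma powr_le_self:
  fixes r \<theta> :: real
  assumes "1/2 < \<theta>" "0 \<le> r" "r \<le> 1"
  shows "r powr (2 * \<theta>) \<le> r"
  using assms powr_mono'[of 1 "2 * \<theta>" r] by simp

lemma damping_le_self: "1/2 < \<theta> \<Longrightarrow> 0 \<le> r \<Longrightarrow> r \<le> 1 \<Longrightarrow> damping \<theta> r \<le> r"
  using damping_le_powr powr_le_self order_trans by blast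

text \<open>Since 2 theta - 1 is nonnegative, 1 + r r^(2 theta - 1) <= (1 + r) (1 + r)^(2 theta -
  1), and then ln (1 + r) <= r. A linear bound valid for all r lets r^2 dominate a multiple of the
  damping at large frequencies.\<close>

lemma damping_le_linear:
  assumes \<theta>: "1/2 < \<theta>" and r: "0 \<le> r"
  shows "damping \<theta> r \<le> 2 * \<theta> * r"
proof (cases "r = 0")
  case False
  with r have r: "0 < r" by simp
  have "1 + r powr (2 * \<theta>) = 1 + r * r powr (2 * \<theta> - 1)"
    using r by (simp add: powr_diff)
  also have "\<dots> \<le> 1 * (1 + r) powr (2 * \<theta> - 1) + r * (1 + r) powr (2 * \<theta> - 1)"
    using r \<theta> by (intro add_mono mult_left_mono powr_mono2) (auto intro!: ge_one_powr_ge_zero)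
  also have "\<dots> = (1 + r) * (1 + r) powr (2 * \<theta> - 1)"
    by (simp only: distrib_right)
  also have "\<dots> = (1 + r) powr (2 * \<theta>)"
    using r powr_mult_base[of "1 + r" "2 * \<theta> - 1"] by simp
  finally have "damping \<theta> r \<le> ln ((1 + r) powr (2 * \<theta>))"
    unfolding damping_def using r by (subst ln_le_cancel_iff) (auto intro: add_pos_nonneg)
  also have "\<dots> = 2 * \<theta> * ln (1 + r)" using r by (simp add: ln_powr)
  also have "\<dots> \<le> 2 * \<theta> * r" using r \<theta> by (intro mult_left_mono ln_add_one_self_le_self) auto
  finally show ?thesis .
qed (use \<theta> in \<open>simp add: damping_def\<close>)

lemma lyapunov_constant:
  assumes \<theta>: "1/2 < \<theta>" and \<delta>: "0 < \<delta>"
  obtains a where "0 < a" "\<And>r. \<delta> \<le> r \<Longrightarrow> 4 * a \<le> damping \<theta> r \<and> 4 * a * damping \<theta> r \<le> r\<^sup>2"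
proof
  \<comment> \<open>The first entry gives 4 a <= damping at delta, and monotonicity extends this to
    r >= delta. The second is chosen so that 4 a times the linear bound 2 theta r is at most delta
    r, hence at most r^2.\<close>
  let ?a = "min (damping \<theta> \<delta> / 4) (\<delta> / (8 * \<theta>))"
  show a: "0 < ?a" using damping_pos[OF \<delta>] \<delta> \<theta> by simp
  fix r assume r: "\<delta> \<le> r"
  have "damping \<theta> \<delta> \<le> damping \<theta> r" using \<theta> \<delta> r by (intro damping_mono) auto
  then have 1: "4 * ?a \<le> damping \<theta> r" by linarith
  have "4 * ?a * damping \<theta> r \<le> 4 * (\<delta> / (8 * \<theta>)) * (2 * \<theta> * r)"
    using a \<theta> \<delta> r damping_le_linear[of \<theta> r] damping_nonneg[of \<theta> r] by (intro mult_mono) auto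
  also have "\<dots> = \<delta> * r" using \<theta> by simp
  also have "\<dots> \<le> r\<^sup>2" using r \<delta> by (simp add: power2_eq_square)
  finally show "4 * ?a \<le> damping \<theta> r \<and> 4 * ?a * damping \<theta> r \<le> r\<^sup>2" using 1 by simp
qed

section \<open>The low frequency propagator\<close>

text \<open>The argument of the root is positive for 0 < r <= 1, the only range in which the
  propagator is used apart from the origin.\<close>

definition frequency :: "real \<Rightarrow> real \<Rightarrow> real" where
  "frequency \<theta> r = sqrt (r\<^sup>2 - (damping \<theta> r)\<^sup>2 / 4)"

text \<open>The solution of the oscillator with data 0 and 1 for 0 < r <= 1. At r = 0 division by
  zero yields 0 instead of the limit t, which concerns a null set of frequencies only.\<close>

definition propagator :: "real \<Rightarrow> real \<Rightarrow> real \<Rightarrow> real" where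
  "propagator \<theta> t r = exp (- (damping \<theta> r * t / 2)) * (sin (frequency \<theta> r * t) / frequency \<theta> r)"

definition propagator' :: "real \<Rightarrow> real \<Rightarrow> real \<Rightarrow> real" where
  "propagator' \<theta> t r = exp (- (damping \<theta> r * t / 2)) *
    (cos (frequency \<theta> r * t) - damping \<theta> r / 2 * (sin (frequency \<theta> r * t) / frequency \<theta> r))"

lemma frequency_measurable [measurable]: "frequency \<theta> \<in> borel_measurable borel"
  unfolding frequency_def[abs_def] by measurable

lemma propagator_measurable [measurable]: "propagator \<theta> t \<in> borel_measurable borel"
  unfolding propagator_def[abs_def] by measurable

lemma propagator'_measurable [measurable]: "propagator' \<theta> t \<in> borel_measurable borel"
  unfolding propagator'_def[abs_def] by measurable

lemma frequency_bounds:
  assumes \<theta>: "1/2 < \<theta>" and r: "0 < r" "r \<le> 1"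
  shows "(frequency \<theta> r)\<^sup>2 = r\<^sup>2 - (damping \<theta> r)\<^sup>2 / 4" "3 / 4 * r\<^sup>2 \<le> (frequency \<theta> r)\<^sup>2"
    "r / 2 \<le> frequency \<theta> r" "0 < frequency \<theta> r" "frequency \<theta> r \<le> r"
proof -
  have d: "(damping \<theta> r)\<^sup>2 \<le> r\<^sup>2"
    using damping_le_self[OF \<theta>, of r] damping_nonneg r by (intro power_mono) auto
  then have nn: "0 \<le> r\<^sup>2 - (damping \<theta> r)\<^sup>2 / 4" using zero_le_power2[of r] by linarith
  then show 1: "(frequency \<theta> r)\<^sup>2 = r\<^sup>2 - (damping \<theta> r)\<^sup>2 / 4"
    by (simp add: frequency_def)
  show 2: "3 / 4 * r\<^sup>2 \<le> (frequency \<theta> r)\<^sup>2" unfolding 1 using d by simp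
  have f0: "0 \<le> frequency \<theta> r" using nn by (simp add: frequency_def)
  show 3: "r / 2 \<le> frequency \<theta> r"
  proof (rule power2_le_imp_le[OF _ f0])
    have "(r / 2)\<^sup>2 = r\<^sup>2 / 4" by (simp add: power_divide)
    then show "(r / 2)\<^sup>2 \<le> (frequency \<theta> r)\<^sup>2" using 2 zero_le_power2[of r] by linarith
  qed
  show "0 < frequency \<theta> r" using 3 r by simp
  show "frequency \<theta> r \<le> r" by (rule power2_le_imp_le) (use 1 r in auto)
qed

lemma propagator_deriv:
  assumes "1/2 < \<theta>" "0 < r" "r \<le> 1"
  shows "((\<lambda>t. propagator \<theta> t r) has_real_derivative propagator' \<theta> t r) (at t within S)"
    and "((\<lambda>t. propagator' \<theta> t r) has_real_derivative
      - (r\<^sup>2 * propagator \<theta> t r) - damping \<theta> r * propagator' \<theta> t r) (at t within S)"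
proof -
  define \<omega> where "\<omega> = frequency \<theta> r"
  define l where "l = damping \<theta> r"
  have \<omega>: "\<omega> \<noteq> 0" "r\<^sup>2 = \<omega>\<^sup>2 + l\<^sup>2 / 4"
    using frequency_bounds(1,4)[OF assms] by (auto simp: \<omega>_def l_def)
  show "((\<lambda>t. propagator \<theta> t r) has_real_derivative propagator' \<theta> t r) (at t within S)"
    unfolding propagator_def propagator'_def \<omega>_def[symmetric] l_def[symmetric]
    using \<omega>(1) by (auto intro!: derivative_eq_intros simp: field_simps)
  show "((\<lambda>t. propagator' \<theta> t r) has_real_derivative
      - (r\<^sup>2 * propagator \<theta> t r) - damping \<theta> r * propagator' \<theta> t r) (at t within S)"
    unfolding propagator_def propagator'_def \<omega>_def[symmetric] l_def[symmetric] \<omega>(2)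
    using \<omega>(1) by (auto intro!: derivative_eq_intros simp: field_simps power2_eq_square)
qed

text \<open>Two bounds of the propagator are kept because each is sharp in its own regime: t for r
  below 1/t, from |sin x| <= |x|, and 2/r above, from \<open>frequency\<close> being at least
  r/2.\<close>

lemma propagator_bounds:
  assumes \<theta>: "1/2 < \<theta>" and r: "0 < r" "r \<le> 1" and t: "0 \<le> t"
  shows "\<bar>propagator \<theta> t r\<bar> \<le> 2 / r" "\<bar>propagator' \<theta> t r\<bar> \<le> 1 + 2 / r" "\<bar>propagator \<theta> t r\<bar> \<le> t"
proof -
  note f = frequency_bounds[OF \<theta> r]
  have e: "exp (- (damping \<theta> r * t / 2)) \<le> 1" using damping_nonneg t by simp
  have "\<bar>sin (frequency \<theta> r * t) / frequency \<theta> r\<bar> \<le> 1 / frequency \<theta> r"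
    using f(4) by (simp add: abs_divide divide_right_mono)
  also have "\<dots> \<le> 1 / (r / 2)" using f(3) r by (intro divide_left_mono) auto
  finally have s: "\<bar>sin (frequency \<theta> r * t) / frequency \<theta> r\<bar> \<le> 2 / r" by simp
  have s': "\<bar>sin (frequency \<theta> r * t) / frequency \<theta> r\<bar> \<le> t"
    using abs_sin_x_le_abs_x[of "frequency \<theta> r * t"] f(4) t
    by (simp add: abs_divide abs_mult divide_le_eq mult.commute)
  have m: "\<bar>exp (- (damping \<theta> r * t / 2)) * b\<bar> \<le> B" if "\<bar>b\<bar> \<le> B" for b B
  proof -
    have "\<bar>exp (- (damping \<theta> r * t / 2)) * b\<bar> = exp (- (damping \<theta> r * t / 2)) * \<bar>b\<bar>" by (simp add: abs_mult)
    also have "\<dots> \<le> 1 * B" using e that by (intro mult_mono) auto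
    finally show ?thesis by simp
  qed
  show "\<bar>propagator \<theta> t r\<bar> \<le> 2 / r" "\<bar>propagator \<theta> t r\<bar> \<le> t"
    unfolding propagator_def by (rule m, rule s, rule m, rule s')
  show "\<bar>propagator' \<theta> t r\<bar> \<le> 1 + 2 / r"
    unfolding propagator'_def
  proof (rule m)
    have "\<bar>damping \<theta> r / 2 * (sin (frequency \<theta> r * t) / frequency \<theta> r)\<bar> \<le> 1 * (2 / r)"
      unfolding abs_mult using damping_le_self[OF \<theta>, of r] damping_nonneg[of \<theta> r] r s
      by (intro mult_mono) auto
    then show "\<bar>cos (frequency \<theta> r * t) - damping \<theta> r / 2 * (sin (frequency \<theta> r * t) / frequency \<theta> r)\<bar> \<le> 1 + 2 / r"
      using abs_cos_le_one[of "frequency \<theta> r * t"] by linarith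
  qed
qed

section \<open>Mild solutions on the Fourier side\<close>

lemma mult_l2_lincomb:
  assumes m: "bounded_symbol m" and k: "bounded_symbol k"
  shows "mult_l2 (\<lambda>\<xi>. - m \<xi> - k \<xi>) x = - mult_l2 m x - mult_l2 k x"
proof -
  have "- mult_l2 m x - mult_l2 k x = (-1) *\<^sub>R abs_l2 (\<lambda>\<xi>. m \<xi> *\<^sub>R rep_l2 x \<xi>) - abs_l2 (\<lambda>\<xi>. k \<xi> *\<^sub>R rep_l2 x \<xi>)"
    by (simp add: mult_l2_def)
  also have "\<dots> = abs_l2 (\<lambda>\<xi>. (-1) *\<^sub>R m \<xi> *\<^sub>R rep_l2 x \<xi> - k \<xi> *\<^sub>R rep_l2 x \<xi>)"
    by (simp only: abs_l2_scaleR abs_l2_diff in_L2_mult m k in_L2_rep in_L2_scaleR)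
  also have "\<dots> = mult_l2 (\<lambda>\<xi>. - m \<xi> - k \<xi>) x"
    by (simp add: mult_l2_def scaleR_diff_left)
  finally show ?thesis by (rule sym)
qed

lemma AE_mult_l2_indicator:
  assumes Z: "Z \<in> sets borel"
  shows "AE \<xi> in lborel. \<xi> \<notin> Z \<longrightarrow> rep_l2 (mult_l2 (indicator Z) x) \<xi> = 0"
proof -
  have b: "bounded_symbol (indicator Z :: 'a \<Rightarrow> real)"
    by (rule bounded_symbolI[where K = 1]) (use Z in \<open>auto simp: indicator_def\<close>)
  show ?thesis
    using rep_abs_l2[OF in_L2_mult[OF b in_L2_rep], of x]
    unfolding mult_l2_def by eventually_elim auto
qed

lemma bounded_symbol_indicator:
  assumes "Z \<in> sets borel"
  shows "bounded_symbol (indicator Z :: 'a::euclidean_space \<Rightarrow> real)"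
  by (rule bounded_symbolI[where K = 1]) (use assms in \<open>auto simp: indicator_def\<close>)

lemma bounded_symbol_cut:
  fixes g :: "real \<Rightarrow> real"
  assumes [measurable]: "Z \<in> sets (borel :: 'a::euclidean_space measure)" "g \<in> borel_measurable borel"
    and "\<And>\<xi>. \<xi> \<in> Z \<Longrightarrow> \<bar>g (norm \<xi>)\<bar> \<le> K"
  shows "bounded_symbol (\<lambda>\<xi>::'a. indicator Z \<xi> * g (norm \<xi>))"
proof (rule bounded_symbolI[where K = "max 0 K"])
  show "\<bar>indicator Z \<xi> * g (norm \<xi>)\<bar> \<le> max 0 K" for \<xi> :: 'a
    using assms(3)[of \<xi>] by (cases "\<xi> \<in> Z") auto
qed measurable

text \<open>Uncut, |xi|^2 is an unbounded multiplier and the term containing \<open>W\<close> need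
  not be differentiable in L^2. After cutting with \<open>Z\<close> every term is a constant or a
  bounded operator applied to a differentiable curve. Here \<open>W\<close> is the transform of the
  primitive in the definition of a mild solution and \<open>V\<close> the transform of the
  velocity.\<close>

lemma mild_solution_fourier:
  fixes u1 :: "'a::euclidean_space \<Rightarrow> complex"
  assumes u1: "in_L2 u1" and mild: "mild_solution \<theta> u1 u"
  obtains V W where
    "\<And>t. 0 \<le> t \<Longrightarrow> ((\<lambda>t. fourier_l2 (abs_l2 (u t))) has_vector_derivative V t) (at t within {0..})"
    "\<And>t. 0 \<le> t \<Longrightarrow> (W has_vector_derivative fourier_l2 (abs_l2 (u t))) (at t within {0..})"
    "fourier_l2 (abs_l2 (u 0)) = 0" "V 0 = fourier_l2 (abs_l2 u1)"
    "\<And>t Z. 0 \<le> t \<Longrightarrow> Z \<in> sets borel \<Longrightarrow>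
      bounded_symbol (\<lambda>\<xi>. indicator Z \<xi> * (norm \<xi>)\<^sup>2) \<Longrightarrow>
      bounded_symbol (\<lambda>\<xi>. indicator Z \<xi> * damping \<theta> (norm \<xi>)) \<Longrightarrow>
      mult_l2 (indicator Z) (V t) = mult_l2 (indicator Z) (fourier_l2 (abs_l2 u1))
        - mult_l2 (\<lambda>\<xi>. indicator Z \<xi> * (norm \<xi>)\<^sup>2) (W t)
        - mult_l2 (\<lambda>\<xi>. indicator Z \<xi> * damping \<theta> (norm \<xi>)) (fourier_l2 (abs_l2 (u t)))"
proof -
  interpret F: bounded_linear "fourier_l2 :: 'a l2 \<Rightarrow> 'a l2" by (rule bounded_linear_fourier_l2)
  from mild obtain v w where uv: "has_L2_derivative u v" and vc: "continuous_into_L2 v"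
    and u0: "AE x in lborel. u 0 x = 0" and v0: "AE x in lborel. v 0 x = u1 x"
    and wu: "has_L2_derivative w u"
    and H: "\<And>t. 0 \<le> t \<Longrightarrow> in_H 2 (w t)" and dom: "\<And>t. 0 \<le> t \<Longrightarrow> in_dom_L \<theta> (u t)"
    and eq: "\<And>t. 0 \<le> t \<Longrightarrow> AE x in lborel. v t x = u1 x + laplacian (w t) x - L_op \<theta> (u t) x"
    unfolding mild_solution_def by blast
  have L: "0 \<le> t \<Longrightarrow> in_L2 (u t)" "0 \<le> t \<Longrightarrow> in_L2 (v t)" "0 \<le> t \<Longrightarrow> in_L2 (w t)" for t
    using uv vc wu by (auto simp: has_L2_derivative_def continuous_into_L2_def)
  show thesis
  proof (rule that[of "\<lambda>t. fourier_l2 (abs_l2 (v t))" "\<lambda>t. fourier_l2 (abs_l2 (w t))"])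
    show "((\<lambda>t. fourier_l2 (abs_l2 (u t))) has_vector_derivative fourier_l2 (abs_l2 (v t))) (at t within {0..})"
      if "0 \<le> t" for t by (rule F.has_vector_derivative[OF has_L2_derivative_abs_l2[OF uv that]])
    show "((\<lambda>t. fourier_l2 (abs_l2 (w t))) has_vector_derivative fourier_l2 (abs_l2 (u t))) (at t within {0..})"
      if "0 \<le> t" for t by (rule F.has_vector_derivative[OF has_L2_derivative_abs_l2[OF wu that]])
    have "abs_l2 (u 0) = abs_l2 (\<lambda>x. 0)"
      by (rule abs_l2_cong[OF L(1)]) (use u0 in auto)
    moreover have "abs_l2 (\<lambda>x::'a. 0) = 0" using zero_l2_def by metis
    ultimately show "fourier_l2 (abs_l2 (u 0)) = 0" by (simp add: F.zero)
    have "abs_l2 (v 0) = abs_l2 u1"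
      using v0 L(2)[of 0] u1 by (simp add: abs_l2_eq_iff)
    then show "fourier_l2 (abs_l2 (v 0)) = fourier_l2 (abs_l2 u1)" by simp
    fix t :: real and Z :: "'a set"
    assume t: "0 \<le> t" and Z: "Z \<in> sets borel"
      and b2: "bounded_symbol (\<lambda>\<xi>. indicator Z \<xi> * (norm \<xi>)\<^sup>2)"
      and bd: "bounded_symbol (\<lambda>\<xi>. indicator Z \<xi> * damping \<theta> (norm \<xi>))"
    let ?w = "L2_fourier (w t)" and ?u = "L2_fourier (u t)"
    note b = bounded_symbol_indicator[OF Z]
    note hat = in_L2_L2_fourier[OF L(1)[OF t]] in_L2_L2_fourier[OF L(3)[OF t]]
    note [measurable] = in_L2_measurable[OF hat(1)] in_L2_measurable[OF hat(2)]
    \<comment> \<open>The specification of \<open>L2_inverse_fourier\<close> applies to square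
      integrable arguments only. For s = 2 the Sobolev weight is exactly 1 + |xi|^2, which dominates
      |xi|^2.\<close>
    have lapL: "in_L2 (\<lambda>\<xi>. - complex_of_real ((norm \<xi>)\<^sup>2) * ?w \<xi>)"
    proof (rule in_L2_bound[where c = 1])
      show "in_L2 (sobolev_weighted 2 (w t))" using H[OF t] by (simp add: in_H_def)
      show "(\<lambda>\<xi>. - complex_of_real ((norm \<xi>)\<^sup>2) * ?w \<xi>) \<in> borel_measurable borel" by measurable
      show "AE \<xi> in lborel. norm (- complex_of_real ((norm \<xi>)\<^sup>2) * ?w \<xi>) \<le> 1 * norm (sobolev_weighted 2 (w t) \<xi>)"
      proof (rule AE_I2)
        fix \<xi> :: 'a
        have p: "0 < 1 + (norm \<xi>)\<^sup>2" by (simp add: add_pos_nonneg)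
        have "norm (sobolev_weighted 2 (w t) \<xi>) = (1 + (norm \<xi>)\<^sup>2) * norm (?w \<xi>)"
          using p by (simp only: sobolev_weighted_def norm_mult norm_of_real) simp
        moreover have "norm (- complex_of_real ((norm \<xi>)\<^sup>2) * ?w \<xi>) = (norm \<xi>)\<^sup>2 * norm (?w \<xi>)"
          by (simp only: norm_mult norm_minus_cancel norm_of_real abs_power2)
        ultimately show "norm (- complex_of_real ((norm \<xi>)\<^sup>2) * ?w \<xi>) \<le> 1 * norm (sobolev_weighted 2 (w t) \<xi>)"
          by (simp add: mult_right_mono)
      qed
    qed
    have domL: "in_L2 (\<lambda>\<xi>. complex_of_real (log_symbol \<theta> \<xi>) * ?u \<xi>)"
      using dom[OF t] by (simp add: in_dom_L_def)
    note lap = L2_inverse_fourier[OF lapL, folded laplacian_def]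
    note lop = L2_inverse_fourier[OF domL, folded L_op_def]
    have "abs_l2 (v t) = abs_l2 (\<lambda>x. u1 x + laplacian (w t) x - L_op \<theta> (u t) x)"
      using eq[OF t] L(2)[OF t] u1 lap(1) lop(1) by (simp add: abs_l2_eq_iff in_L2_add in_L2_diff)
    also have "\<dots> = abs_l2 u1 + abs_l2 (laplacian (w t)) - abs_l2 (L_op \<theta> (u t))"
      by (simp only: abs_l2_add abs_l2_diff u1 lap(1) lop(1) in_L2_add)
    finally have "fourier_l2 (abs_l2 (v t)) = fourier_l2 (abs_l2 u1)
        + abs_l2 (\<lambda>\<xi>. - complex_of_real ((norm \<xi>)\<^sup>2) * ?w \<xi>) - abs_l2 (\<lambda>\<xi>. complex_of_real (log_symbol \<theta> \<xi>) * ?u \<xi>)"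
      by (simp only: F.add F.diff lap(2) lop(2))
    then have "mult_l2 (indicator Z) (fourier_l2 (abs_l2 (v t))) = mult_l2 (indicator Z) (fourier_l2 (abs_l2 u1))
        + mult_l2 (indicator Z) (abs_l2 (\<lambda>\<xi>. - complex_of_real ((norm \<xi>)\<^sup>2) * ?w \<xi>))
        - mult_l2 (indicator Z) (abs_l2 (\<lambda>\<xi>. complex_of_real (log_symbol \<theta> \<xi>) * ?u \<xi>))"
      by (simp only: linear_add[OF bounded_linear.linear[OF bounded_linear_mult_l2[OF b]]]
          linear_diff[OF bounded_linear.linear[OF bounded_linear_mult_l2[OF b]]])
    moreover have "mult_l2 (indicator Z) (abs_l2 (\<lambda>\<xi>. - complex_of_real ((norm \<xi>)\<^sup>2) * ?w \<xi>))
        = - mult_l2 (\<lambda>\<xi>. indicator Z \<xi> * (norm \<xi>)\<^sup>2) (fourier_l2 (abs_l2 (w t)))"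
    proof -
      have "- mult_l2 (\<lambda>\<xi>. indicator Z \<xi> * (norm \<xi>)\<^sup>2) (abs_l2 ?w)
          = (-1) *\<^sub>R abs_l2 (\<lambda>\<xi>. (indicator Z \<xi> * (norm \<xi>)\<^sup>2) *\<^sub>R ?w \<xi>)"
        by (simp add: mult_l2_abs[OF b2 hat(2)])
      also have "\<dots> = abs_l2 (\<lambda>\<xi>. (-1) *\<^sub>R (indicator Z \<xi> * (norm \<xi>)\<^sup>2) *\<^sub>R ?w \<xi>)"
        by (rule abs_l2_scaleR[OF in_L2_mult[OF b2 hat(2)]])
      also have "\<dots> = mult_l2 (indicator Z) (abs_l2 (\<lambda>\<xi>. - complex_of_real ((norm \<xi>)\<^sup>2) * ?w \<xi>))"
        unfolding mult_l2_abs[OF b lapL] by (simp add: scaleR_conv_of_real mult.assoc)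
      finally show ?thesis using fourier_l2_abs[OF L(3)[OF t]] by simp
    qed
    moreover have "mult_l2 (indicator Z) (abs_l2 (\<lambda>\<xi>. complex_of_real (log_symbol \<theta> \<xi>) * ?u \<xi>))
        = mult_l2 (\<lambda>\<xi>. indicator Z \<xi> * damping \<theta> (norm \<xi>)) (fourier_l2 (abs_l2 (u t)))"
      unfolding fourier_l2_abs[OF L(1)[OF t]] mult_l2_abs[OF b domL] mult_l2_abs[OF bd hat(1)]
      by (simp add: scaleR_conv_of_real mult.assoc log_symbol_damping)
    ultimately show "mult_l2 (indicator Z) (fourier_l2 (abs_l2 (v t))) = mult_l2 (indicator Z) (fourier_l2 (abs_l2 u1))
        - mult_l2 (\<lambda>\<xi>. indicator Z \<xi> * (norm \<xi>)\<^sup>2) (fourier_l2 (abs_l2 (w t)))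
        - mult_l2 (\<lambda>\<xi>. indicator Z \<xi> * damping \<theta> (norm \<xi>)) (fourier_l2 (abs_l2 (u t)))"
      by simp
  qed
qed

lemma annulus_symbols:
  assumes \<theta>: "0 < \<theta>"
  shows "{\<xi>::'a::euclidean_space. a \<le> norm \<xi> \<and> norm \<xi> \<le> b} \<in> sets borel"
    "bounded_symbol (\<lambda>\<xi>::'a. indicator {\<xi>. a \<le> norm \<xi> \<and> norm \<xi> \<le> b} \<xi> * (norm \<xi>)\<^sup>2)"
    "bounded_symbol (\<lambda>\<xi>::'a. indicator {\<xi>. a \<le> norm \<xi> \<and> norm \<xi> \<le> b} \<xi> * damping \<theta> (norm \<xi>))"
proof -
  show Z: "{\<xi>::'a. a \<le> norm \<xi> \<and> norm \<xi> \<le> b} \<in> sets borel" by measurable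
  show "bounded_symbol (\<lambda>\<xi>::'a. indicator {\<xi>. a \<le> norm \<xi> \<and> norm \<xi> \<le> b} \<xi> * (norm \<xi>)\<^sup>2)"
    by (rule bounded_symbol_cut[OF Z, where g = "\<lambda>r. r\<^sup>2" and K = "b\<^sup>2"]) (auto intro: power_mono)
  show "bounded_symbol (\<lambda>\<xi>::'a. indicator {\<xi>. a \<le> norm \<xi> \<and> norm \<xi> \<le> b} \<xi> * damping \<theta> (norm \<xi>))"
    by (rule bounded_symbol_cut[OF Z, where K = "damping \<theta> b"])
       (auto simp: damping_nonneg intro!: damping_mono \<theta>)
qed

text \<open>Nothing says that \<open>V\<close> itself is differentiable. The integrated equation,
  however, expresses its cut part through \<open>W\<close> and the transform of \<open>u\<close>,
  and differentiating that identity yields the second half of the system. One \<open>V\<close>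
  serves all annuli, so the initial velocity is fixed once.\<close>

lemma mild_solution_damped_system:
  fixes u1 :: "'a::euclidean_space \<Rightarrow> complex"
  assumes \<theta>: "0 < \<theta>" and u1: "in_L2 u1" and mild: "mild_solution \<theta> u1 u"
  shows "\<exists>V. fourier_l2 (abs_l2 (u 0)) = 0 \<and> V 0 = fourier_l2 (abs_l2 u1) \<and>
    (\<forall>a b. damped_system (\<lambda>\<xi>. indicator {\<xi>. a \<le> norm \<xi> \<and> norm \<xi> \<le> b} \<xi> * (norm \<xi>)\<^sup>2)
        (\<lambda>\<xi>. indicator {\<xi>. a \<le> norm \<xi> \<and> norm \<xi> \<le> b} \<xi> * damping \<theta> (norm \<xi>))
        (\<lambda>t. mult_l2 (indicator {\<xi>. a \<le> norm \<xi> \<and> norm \<xi> \<le> b}) (fourier_l2 (abs_l2 (u t))))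
        (\<lambda>t. mult_l2 (indicator {\<xi>. a \<le> norm \<xi> \<and> norm \<xi> \<le> b}) (V t)))"
proof -
  obtain V W where
    dU: "\<And>t. 0 \<le> t \<Longrightarrow> ((\<lambda>t. fourier_l2 (abs_l2 (u t))) has_vector_derivative V t) (at t within {0..})"
    and dW: "\<And>t. 0 \<le> t \<Longrightarrow> (W has_vector_derivative fourier_l2 (abs_l2 (u t))) (at t within {0..})"
    and 0: "fourier_l2 (abs_l2 (u 0)) = 0" "V 0 = fourier_l2 (abs_l2 u1)"
    and eq: "\<And>t Z. 0 \<le> t \<Longrightarrow> Z \<in> sets borel \<Longrightarrow>
      bounded_symbol (\<lambda>\<xi>. indicator Z \<xi> * (norm \<xi>)\<^sup>2) \<Longrightarrow>
      bounded_symbol (\<lambda>\<xi>. indicator Z \<xi> * damping \<theta> (norm \<xi>)) \<Longrightarrow>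
      mult_l2 (indicator Z) (V t) = mult_l2 (indicator Z) (fourier_l2 (abs_l2 u1))
        - mult_l2 (\<lambda>\<xi>. indicator Z \<xi> * (norm \<xi>)\<^sup>2) (W t)
        - mult_l2 (\<lambda>\<xi>. indicator Z \<xi> * damping \<theta> (norm \<xi>)) (fourier_l2 (abs_l2 (u t)))"
    using mild_solution_fourier[OF u1 mild] by blast
  show ?thesis
  proof (intro exI[of _ V] conjI allI)
    fix a b :: real
    let ?Z = "{\<xi>::'a. a \<le> norm \<xi> \<and> norm \<xi> \<le> b}"
    let ?p = "\<lambda>\<xi>. indicator ?Z \<xi> * (norm \<xi>)\<^sup>2" and ?q = "\<lambda>\<xi>. indicator ?Z \<xi> * damping \<theta> (norm \<xi>)"
    let ?U = "\<lambda>t. fourier_l2 (abs_l2 (u t))"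
    note Z = annulus_symbols(1)[OF \<theta>, of a b, where 'a = 'a] and p = annulus_symbols(2)[OF \<theta>, of a b, where 'a = 'a]
      and q = annulus_symbols(3)[OF \<theta>, of a b, where 'a = 'a]
    note b = bounded_symbol_indicator[OF Z]
    \<comment> \<open>The symbols already contain the indicator, so cutting the state beforehand
      changes nothing.\<close>
    have pp: "mult_l2 ?p (mult_l2 (indicator ?Z) x) = mult_l2 ?p x"
      and qq: "mult_l2 ?q (mult_l2 (indicator ?Z) x) = mult_l2 ?q x" for x
      by (simp_all only: mult_l2_mult[OF p b] mult_l2_mult[OF q b])
         (rule arg_cong[where f = "\<lambda>m. mult_l2 m x"], auto simp: indicator_def)+
    have "((\<lambda>t. mult_l2 (indicator ?Z) (V t)) has_vector_derivative
        - mult_l2 ?p (?U t) - mult_l2 ?q (V t)) (at t within {0..})" if t: "0 \<le> t" for t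
    proof (rule has_vector_derivative_transform[where f = "\<lambda>t. mult_l2 (indicator ?Z) (fourier_l2 (abs_l2 u1))
        - mult_l2 ?p (W t) - mult_l2 ?q (?U t)"])
      have "((\<lambda>t. mult_l2 (indicator ?Z) (fourier_l2 (abs_l2 u1)) - mult_l2 ?p (W t) - mult_l2 ?q (?U t))
          has_vector_derivative 0 - mult_l2 ?p (?U t) - mult_l2 ?q (V t)) (at t within {0..})"
        by (intro has_vector_derivative_diff has_vector_derivative_const
            bounded_linear.has_vector_derivative[OF bounded_linear_mult_l2[OF p] dW[OF t]]
            bounded_linear.has_vector_derivative[OF bounded_linear_mult_l2[OF q] dU[OF t]])
      then show "((\<lambda>t. mult_l2 (indicator ?Z) (fourier_l2 (abs_l2 u1)) - mult_l2 ?p (W t) - mult_l2 ?q (?U t))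
          has_vector_derivative - mult_l2 ?p (?U t) - mult_l2 ?q (V t)) (at t within {0..})" by simp
    qed (use t eq[OF _ Z p q] in auto)
    then show "damped_system ?p ?q (\<lambda>t. mult_l2 (indicator ?Z) (?U t)) (\<lambda>t. mult_l2 (indicator ?Z) (V t))"
      unfolding damped_system_def pp qq
      using p q bounded_linear.has_vector_derivative[OF bounded_linear_mult_l2[OF b] dU] by blast
  qed (rule 0)+
qed

section \<open>High frequency decay and the low frequency formula for the solution\<close>

lemma mult_l2_lower:
  fixes x :: "'a::euclidean_space l2"
  assumes p: "bounded_symbol p" and le: "\<And>\<xi>. \<xi> \<in> Z \<Longrightarrow> c \<le> p \<xi>"
    and supp: "AE \<xi> in lborel. \<xi> \<notin> Z \<longrightarrow> rep_l2 x \<xi> = 0"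
  shows "c * (norm x)\<^sup>2 \<le> mult_l2 p x \<bullet> x"
proof -
  have "(LINT \<xi>|lborel. c * (rep_l2 x \<xi> \<bullet> rep_l2 x \<xi>)) \<le> (LINT \<xi>|lborel. p \<xi> * (rep_l2 x \<xi> \<bullet> rep_l2 x \<xi>))"
  proof (rule integral_mono_AE)
    show "AE \<xi> in lborel. c * (rep_l2 x \<xi> \<bullet> rep_l2 x \<xi>) \<le> p \<xi> * (rep_l2 x \<xi> \<bullet> rep_l2 x \<xi>)"
      using supp
    proof eventually_elim
      case (elim \<xi>)
      then show ?case using le[of \<xi>] by (cases "\<xi> \<in> Z") (auto intro: mult_right_mono)
    qed
  qed (intro integrable_mult_right in_L2_inner_integrable mult_l2_inner_integrable p in_L2_rep)+
  then show ?thesis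
    by (simp only: mult_l2_inner[OF p] power2_norm_eq_inner inner_l2_rep[of x x] integral_mult_right_zero)
qed

text \<open>The rate is fixed before the outer radius R, which only keeps the symbols bounded and is
  sent to infinity later. On the annulus |xi|^2 >= 1, so the potential part of the energy controls
  the norm.\<close>

lemma high_frequency_decay:
  assumes \<theta>: "1/2 < \<theta>"
  obtains a where "0 < a" "\<And>(u1 :: 'a::euclidean_space \<Rightarrow> complex) u t R. in_L2 u1 \<Longrightarrow> mild_solution \<theta> u1 u \<Longrightarrow> 0 \<le> t \<Longrightarrow>
    (norm (mult_l2 (indicator {\<xi>. 1 \<le> norm \<xi> \<and> norm \<xi> \<le> R}) (fourier_l2 (abs_l2 (u t)))))\<^sup>2
      \<le> 2 * exp (- a * t) * (norm (fourier_l2 (abs_l2 u1)))\<^sup>2"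
proof -
  obtain a where a: "0 < a" "\<And>r. 1 \<le> r \<Longrightarrow> 4 * a \<le> damping \<theta> r \<and> 4 * a * damping \<theta> r \<le> r\<^sup>2"
    using lyapunov_constant[OF \<theta>, of 1] by auto
  show thesis
  proof (rule that[OF a(1)])
    fix u1 :: "'a \<Rightarrow> complex" and u and t R :: real
    assume u1: "in_L2 u1" and mild: "mild_solution \<theta> u1 u" and t: "0 \<le> t"
    let ?Z = "{\<xi>::'a. 1 \<le> norm \<xi> \<and> norm \<xi> \<le> R}"
    let ?U = "\<lambda>t. fourier_l2 (abs_l2 (u t))"
    have \<theta>0: "0 < \<theta>" using \<theta> by simp
    note Z = annulus_symbols[OF \<theta>0, of 1 R, where 'a = 'a]
    note b = bounded_symbol_indicator[OF Z(1)]
    obtain V where V: "?U 0 = 0" "V 0 = fourier_l2 (abs_l2 u1)"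
      "\<And>a b. damped_system (\<lambda>\<xi>. indicator {\<xi>. a \<le> norm \<xi> \<and> norm \<xi> \<le> b} \<xi> * (norm \<xi>)\<^sup>2)
        (\<lambda>\<xi>. indicator {\<xi>. a \<le> norm \<xi> \<and> norm \<xi> \<le> b} \<xi> * damping \<theta> (norm \<xi>))
        (\<lambda>t. mult_l2 (indicator {\<xi>. a \<le> norm \<xi> \<and> norm \<xi> \<le> b}) (fourier_l2 (abs_l2 (u t))))
        (\<lambda>t. mult_l2 (indicator {\<xi>. a \<le> norm \<xi> \<and> norm \<xi> \<le> b}) (V t))"
      using mild_solution_damped_system[OF \<theta>0 u1 mild] by blast
    have "(norm (mult_l2 (indicator ?Z) (V t)))\<^sup>2 + mult_l2 (\<lambda>\<xi>. indicator ?Z \<xi> * (norm \<xi>)\<^sup>2) (mult_l2 (indicator ?Z) (?U t))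
        \<bullet> mult_l2 (indicator ?Z) (?U t) \<le> 2 * exp (- a * t) * (norm (mult_l2 (indicator ?Z) (V 0)))\<^sup>2"
    proof (rule damped_system_decay[OF V(3)[of 1 R] a(1) _ _ _ t])
      show "4 * a \<le> indicator ?Z \<xi> * damping \<theta> (norm \<xi>) \<and>
          4 * a * (indicator ?Z \<xi> * damping \<theta> (norm \<xi>)) \<le> indicator ?Z \<xi> * (norm \<xi>)\<^sup>2"
        if "\<xi> \<in> ?Z" for \<xi> :: 'a using that a(2)[of "norm \<xi>"] by simp
      show "AE \<xi> in lborel. \<xi> \<notin> ?Z \<longrightarrow> rep_l2 (mult_l2 (indicator ?Z) (?U s)) \<xi> = 0
          \<and> rep_l2 (mult_l2 (indicator ?Z) (V s)) \<xi> = 0" for s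
        using AE_mult_l2_indicator[OF Z(1), of "?U s"] AE_mult_l2_indicator[OF Z(1), of "V s"]
        by eventually_elim auto
      show "mult_l2 (indicator ?Z) (?U 0) = 0"
        unfolding V(1) by (rule linear_0[OF bounded_linear.linear[OF bounded_linear_mult_l2[OF b]]])
    qed
    moreover have "1 * (norm (mult_l2 (indicator ?Z) (?U t)))\<^sup>2 \<le>
        mult_l2 (\<lambda>\<xi>. indicator ?Z \<xi> * (norm \<xi>)\<^sup>2) (mult_l2 (indicator ?Z) (?U t)) \<bullet> mult_l2 (indicator ?Z) (?U t)"
      by (rule mult_l2_lower[OF Z(2) _ AE_mult_l2_indicator[OF Z(1)]]) (auto intro: one_le_power)
    moreover have "(norm (mult_l2 (indicator ?Z) (V 0)))\<^sup>2 \<le> (norm (fourier_l2 (abs_l2 u1)))\<^sup>2"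
      unfolding V(2) using norm_mult_l2_le[OF b, of 1 "fourier_l2 (abs_l2 u1)"]
      by (intro power_mono) (auto simp: indicator_def)
    then have "2 * exp (- a * t) * (norm (mult_l2 (indicator ?Z) (V 0)))\<^sup>2
        \<le> 2 * exp (- a * t) * (norm (fourier_l2 (abs_l2 u1)))\<^sup>2" by (intro mult_left_mono) auto
    moreover have "0 \<le> (norm (mult_l2 (indicator ?Z) (V t)))\<^sup>2" by simp
    ultimately show "(norm (mult_l2 (indicator ?Z) (?U t)))\<^sup>2
        \<le> 2 * exp (- a * t) * (norm (fourier_l2 (abs_l2 u1)))\<^sup>2" by linarith
  qed
qed

text \<open>The cut solution and the explicit multiplier curve solve the same damped system with the
  same data. Their difference starts from zero state and zero velocity, so the energy estimate
  forces it to vanish. The inner radius delta > 0 supplies both a Lyapunov constant and bounded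
  symbols.\<close>

lemma low_frequency_formula_annulus:
  fixes u1 :: "'a::euclidean_space \<Rightarrow> complex"
  assumes \<theta>: "1/2 < \<theta>" and u1: "in_L2 u1" and mild: "mild_solution \<theta> u1 u" and t: "0 \<le> t" and \<delta>: "0 < \<delta>"
  shows "AE \<xi> in lborel. \<delta> \<le> norm \<xi> \<and> norm \<xi> \<le> 1 \<longrightarrow>
    rep_l2 (fourier_l2 (abs_l2 (u t))) \<xi> = propagator \<theta> t (norm \<xi>) *\<^sub>R rep_l2 (fourier_l2 (abs_l2 u1)) \<xi>"
proof -
  let ?Z = "{\<xi>::'a. \<delta> \<le> norm \<xi> \<and> norm \<xi> \<le> 1}"
  let ?U = "\<lambda>t. fourier_l2 (abs_l2 (u t))" and ?G = "fourier_l2 (abs_l2 u1)"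
  let ?p = "\<lambda>\<xi>. indicator ?Z \<xi> * (norm \<xi>)\<^sup>2" and ?q = "\<lambda>\<xi>. indicator ?Z \<xi> * damping \<theta> (norm \<xi>)"
  let ?e = "\<lambda>s \<xi>. indicator ?Z \<xi> * propagator \<theta> s (norm \<xi>)"
  let ?e1 = "\<lambda>s \<xi>. indicator ?Z \<xi> * propagator' \<theta> s (norm \<xi>)"
  let ?e2 = "\<lambda>s \<xi>. - (?p \<xi> * ?e s \<xi>) - ?q \<xi> * ?e1 s \<xi>"
  obtain a where a: "0 < a" "\<And>r. \<delta> \<le> r \<Longrightarrow> 4 * a \<le> damping \<theta> r \<and> 4 * a * damping \<theta> r \<le> r\<^sup>2"
    using lyapunov_constant[OF \<theta> \<delta>] by auto
  have \<theta>0: "0 < \<theta>" using \<theta> by simp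
  note Z = annulus_symbols[OF \<theta>0, of \<delta> 1, where 'a = 'a]
  note b = bounded_symbol_indicator[OF Z(1)]
  \<comment> \<open>The common bound for the propagator and its derivative, read off from
    \<open>propagator_bounds\<close> at r >= delta.\<close>
  define M where "M = 1 + 2 / \<delta>"
  have M: "1 \<le> M" using \<delta> by (simp add: M_def)
  have le: "1 + 2 / norm \<xi> \<le> M" if "\<xi> \<in> ?Z" for \<xi> :: 'a
    using that \<delta> by (auto simp: M_def intro!: divide_left_mono mult_pos_pos elim: less_le_trans)
  have n: "0 < norm \<xi>" "norm \<xi> \<le> 1" if "\<xi> \<in> ?Z" for \<xi> :: 'a
    using that \<delta> by (simp_all only: mem_Collect_eq) linarith
  have eM: "\<bar>propagator \<theta> s (norm \<xi>)\<bar> \<le> M" and e1M: "\<bar>propagator' \<theta> s (norm \<xi>)\<bar> \<le> M"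
    if "\<xi> \<in> ?Z" "0 \<le> s" for \<xi> :: 'a and s
  proof -
    show "\<bar>propagator \<theta> s (norm \<xi>)\<bar> \<le> M" "\<bar>propagator' \<theta> s (norm \<xi>)\<bar> \<le> M"
      using propagator_bounds(1,2)[OF \<theta> n[OF that(1)] that(2)] le[OF that(1)] by linarith+
  qed
  have eb: "bounded_symbol (?e s)" and e1b: "bounded_symbol (?e1 s)" if "0 \<le> s" for s
    using eM e1M that by (auto intro!: bounded_symbol_cut[OF Z(1), where K = M])
  have sys1: "damped_system ?p ?q (\<lambda>s. mult_l2 (?e s) ?G) (\<lambda>s. mult_l2 (?e1 s) ?G)"
    unfolding damped_system_def
  proof (intro conjI allI impI Z)
    fix s :: real assume s: "0 \<le> s"
    have sb: "\<bar>indicator ?Z \<xi> * c\<bar> \<le> C" if "\<xi> \<in> ?Z \<Longrightarrow> \<bar>c\<bar> \<le> C" "0 \<le> C" for \<xi> :: 'a and c C :: real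
      using that by (cases "\<xi> \<in> ?Z") auto
    show "((\<lambda>s. mult_l2 (?e s) ?G) has_vector_derivative mult_l2 (?e1 s) ?G) (at s within {0..})"
    proof (rule has_vector_derivative_mult_symbol[where C = M, OF eb _ _ _ s])
      show "((\<lambda>s. ?e s \<xi>) has_real_derivative ?e1 s \<xi>) (at s within {0..})" for s and \<xi> :: 'a
        using propagator_deriv(1)[OF \<theta>, of "norm \<xi>"] n[of \<xi>]
        by (cases "\<xi> \<in> ?Z") (auto simp del: mem_Collect_eq)
      show "\<bar>?e1 s \<xi>\<bar> \<le> M" if "0 \<le> s" for s and \<xi> :: 'a
        using sb[OF e1M[OF _ that]] M by simp
      show "?e1 s \<in> borel_measurable borel" if "0 \<le> s" for s
        by (rule bounded_symbol_measurable[OF e1b[OF that]])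
    qed
    have "((\<lambda>s. mult_l2 (?e1 s) ?G) has_vector_derivative mult_l2 (?e2 s) ?G) (at s within {0..})"
    proof (rule has_vector_derivative_mult_symbol[where C = "2 * M", OF e1b _ _ _ s])
      show "((\<lambda>s. ?e1 s \<xi>) has_real_derivative ?e2 s \<xi>) (at s within {0..})" for s and \<xi> :: 'a
        using propagator_deriv(2)[OF \<theta>, of "norm \<xi>"] n[of \<xi>]
        by (cases "\<xi> \<in> ?Z") (auto simp del: mem_Collect_eq)
      show "?e2 s \<in> borel_measurable borel" if "0 \<le> s" for s
        using bounded_symbol_measurable[OF e1b[OF that]] bounded_symbol_measurable[OF eb[OF that]]
          bounded_symbol_measurable[OF Z(2)] bounded_symbol_measurable[OF Z(3)] by simp
      show "\<bar>?e2 s \<xi>\<bar> \<le> 2 * M" if s: "0 \<le> s" for s and \<xi> :: 'a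
      proof (cases "\<xi> \<in> ?Z")
        case True
        have "\<bar>(norm \<xi>)\<^sup>2 * propagator \<theta> s (norm \<xi>)\<bar> \<le> 1 * M"
          unfolding abs_mult using True eM[OF True s] by (intro mult_mono) (auto simp: power_le_one)
        moreover have "\<bar>damping \<theta> (norm \<xi>) * propagator' \<theta> s (norm \<xi>)\<bar> \<le> 1 * M"
          unfolding abs_mult
          using True e1M[OF True s] damping_le_self[OF \<theta>, of "norm \<xi>"] damping_nonneg[of \<theta> "norm \<xi>"]
          by (intro mult_mono) auto
        ultimately show ?thesis using True by (simp add: abs_le_iff)
      qed (use M in simp)
    qed
    moreover have "mult_l2 (?e2 s) ?G = - mult_l2 ?p (mult_l2 (?e s) ?G) - mult_l2 ?q (mult_l2 (?e1 s) ?G)"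
      unfolding mult_l2_mult[OF Z(2) eb[OF s]] mult_l2_mult[OF Z(3) e1b[OF s]]
    proof (rule mult_l2_lincomb)
      have "\<bar>?p \<xi> * ?e s \<xi>\<bar> \<le> M" for \<xi>
      proof (cases "\<xi> \<in> ?Z")
        case True
        have "\<bar>(norm \<xi>)\<^sup>2 * propagator \<theta> s (norm \<xi>)\<bar> \<le> 1 * M"
          unfolding abs_mult using True eM[OF True s] by (intro mult_mono) (auto simp: power_le_one)
        with True show ?thesis by simp
      qed (use M in simp)
      then show "bounded_symbol (\<lambda>\<xi>. ?p \<xi> * ?e s \<xi>)"
        by (rule bounded_symbolI[rotated])
           (use bounded_symbol_measurable[OF eb[OF s]] bounded_symbol_measurable[OF Z(2)] in simp)
      have "\<bar>?q \<xi> * ?e1 s \<xi>\<bar> \<le> M" for \<xi>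
      proof (cases "\<xi> \<in> ?Z")
        case True
        have "\<bar>damping \<theta> (norm \<xi>) * propagator' \<theta> s (norm \<xi>)\<bar> \<le> 1 * M"
          unfolding abs_mult
          using True e1M[OF True s] damping_le_self[OF \<theta>, of "norm \<xi>"] damping_nonneg[of \<theta> "norm \<xi>"]
          by (intro mult_mono) auto
        with True show ?thesis by simp
      qed (use M in simp)
      then show "bounded_symbol (\<lambda>\<xi>. ?q \<xi> * ?e1 s \<xi>)"
        by (rule bounded_symbolI[rotated])
           (use bounded_symbol_measurable[OF e1b[OF s]] bounded_symbol_measurable[OF Z(3)] in simp)
    qed
    ultimately show "((\<lambda>s. mult_l2 (?e1 s) ?G) has_vector_derivative
        - mult_l2 ?p (mult_l2 (?e s) ?G) - mult_l2 ?q (mult_l2 (?e1 s) ?G)) (at s within {0..})" by simp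
  qed
  obtain V where V: "?U 0 = 0" "V 0 = ?G"
    "\<And>a b. damped_system (\<lambda>\<xi>. indicator {\<xi>. a \<le> norm \<xi> \<and> norm \<xi> \<le> b} \<xi> * (norm \<xi>)\<^sup>2)
        (\<lambda>\<xi>. indicator {\<xi>. a \<le> norm \<xi> \<and> norm \<xi> \<le> b} \<xi> * damping \<theta> (norm \<xi>))
        (\<lambda>t. mult_l2 (indicator {\<xi>. a \<le> norm \<xi> \<and> norm \<xi> \<le> b}) (fourier_l2 (abs_l2 (u t))))
        (\<lambda>t. mult_l2 (indicator {\<xi>. a \<le> norm \<xi> \<and> norm \<xi> \<le> b}) (V t))"
    using mild_solution_damped_system[OF \<theta>0 u1 mild] by blast
  define X where "X s = mult_l2 (indicator ?Z) (?U s) - mult_l2 (?e s) ?G" for s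
  define Y where "Y s = mult_l2 (indicator ?Z) (V s) - mult_l2 (?e1 s) ?G" for s
  have sys: "damped_system ?p ?q X Y"
    unfolding X_def Y_def by (rule damped_system_diff[OF V(3)[of \<delta> 1] sys1])
  \<comment> \<open>The differences \<open>X\<close> and \<open>Y\<close> are unchanged by another
    cut, which shows that they vanish outside the annulus.\<close>
  have proj: "mult_l2 (indicator ?Z) (mult_l2 (indicator ?Z) x - mult_l2 (\<lambda>\<xi>. indicator ?Z \<xi> * m \<xi>) y)
      = mult_l2 (indicator ?Z) x - mult_l2 (\<lambda>\<xi>. indicator ?Z \<xi> * m \<xi>) y"
    if m: "bounded_symbol (\<lambda>\<xi>. indicator ?Z \<xi> * m \<xi>)" for m x y
    unfolding linear_diff[OF bounded_linear.linear[OF bounded_linear_mult_l2[OF b]]]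
      mult_l2_mult[OF b b] mult_l2_mult[OF b m]
    by (simp add: mult.assoc[symmetric] indicator_inter_arith[symmetric])
  have supp: "AE \<xi> in lborel. \<xi> \<notin> ?Z \<longrightarrow> rep_l2 (X s) \<xi> = 0 \<and> rep_l2 (Y s) \<xi> = 0" if s: "0 \<le> s" for s
    using AE_mult_l2_indicator[OF Z(1), of "X s"] AE_mult_l2_indicator[OF Z(1), of "Y s"]
    unfolding X_def Y_def proj[OF eb[OF s]] proj[OF e1b[OF s]] by eventually_elim auto
  have "X 0 = 0"
  proof -
    have "(\<lambda>\<xi>. ?e 0 \<xi>) = (\<lambda>\<xi>. 0)" by (auto simp: propagator_def)
    moreover have "mult_l2 (\<lambda>\<xi>. 0) ?G = 0"
      using norm_mult_l2_le[OF bounded_symbolI[of "\<lambda>\<xi>. 0" 0], of 0 ?G] by simp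
    ultimately show ?thesis
      unfolding X_def V(1) by (simp add: linear_0[OF bounded_linear.linear[OF bounded_linear_mult_l2[OF b]]])
  qed
  moreover have "Y 0 = 0"
  proof -
    have "(\<lambda>\<xi>. ?e1 0 \<xi>) = indicator ?Z" by (auto simp: propagator'_def)
    then show ?thesis unfolding Y_def V(2) by simp
  qed
  ultimately have "(norm (Y t))\<^sup>2 + mult_l2 ?p (X t) \<bullet> X t \<le> 0"
    using damped_system_decay[OF sys a(1) _ supp _ t] a(2) by auto
  moreover have "\<delta>\<^sup>2 * (norm (X t))\<^sup>2 \<le> mult_l2 ?p (X t) \<bullet> X t"
  proof (rule mult_l2_lower[OF Z(2)])
    show "AE \<xi> in lborel. \<xi> \<notin> ?Z \<longrightarrow> rep_l2 (X t) \<xi> = 0" using supp[OF t] by eventually_elim auto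
  qed (use \<delta> in \<open>auto intro: power_mono\<close>)
  moreover have "0 \<le> (norm (Y t))\<^sup>2" by simp
  ultimately have "\<delta>\<^sup>2 * (norm (X t))\<^sup>2 \<le> 0" by linarith
  then have "X t = 0" using \<delta> by (simp add: mult_le_0_iff)
  then have "mult_l2 (indicator ?Z) (?U t) = mult_l2 (?e t) ?G" by (simp add: X_def)
  then have "AE \<xi> in lborel. indicator ?Z \<xi> *\<^sub>R rep_l2 (?U t) \<xi> = ?e t \<xi> *\<^sub>R rep_l2 ?G \<xi>"
    by (simp only: mult_l2_eq_iff[OF b eb[OF t]])
  then show ?thesis by eventually_elim auto
qed

text \<open>The annuli with inner radii 1/(k+1) exhaust the punctured ball. Countably many
  exceptional null sets and the origin form a null set.\<close>

lemma low_frequency_formula: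
  fixes u1 :: "'a::euclidean_space \<Rightarrow> complex"
  assumes \<theta>: "1/2 < \<theta>" and u1: "in_L2 u1" and i1: "integrable lborel u1"
    and mild: "mild_solution \<theta> u1 u" and t: "0 \<le> t"
  shows "AE \<xi> in lborel. norm \<xi> < 1 \<longrightarrow>
    rep_l2 (fourier_l2 (abs_l2 (u t))) \<xi> = propagator \<theta> t (norm \<xi>) *\<^sub>R fourier_integral u1 \<xi>"
proof -
  have "AE \<xi> in lborel. \<forall>k::nat. 1 / real (Suc k) \<le> norm \<xi> \<and> norm \<xi> \<le> 1 \<longrightarrow>
      rep_l2 (fourier_l2 (abs_l2 (u t))) \<xi> = propagator \<theta> t (norm \<xi>) *\<^sub>R rep_l2 (fourier_l2 (abs_l2 u1)) \<xi>"
    unfolding AE_all_countable by (intro allI low_frequency_formula_annulus[OF \<theta> u1 mild t]) simp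
  moreover have "AE \<xi> in lborel. rep_l2 (fourier_l2 (abs_l2 u1)) \<xi> = fourier_integral u1 \<xi>"
    unfolding fourier_l2_integral[OF i1 u1] by (rule rep_abs_l2[OF fourier_integral_L2(1)[OF i1 u1]])
  moreover have "AE \<xi> in lborel. \<xi> \<noteq> (0::'a)" by (rule AE_lborel_singleton)
  ultimately show ?thesis
  proof eventually_elim
    case (elim \<xi>)
    then have "0 < norm \<xi>" by simp
    then obtain k where "inverse (real (Suc k)) < norm \<xi>" using reals_Archimedean by blast
    then have "1 / real (Suc k) \<le> norm \<xi>" by (simp add: inverse_eq_divide)
    with elim show ?case by auto
  qed
qed

definition low_frequency_energy :: "real \<Rightarrow> real \<Rightarrow> ('a::euclidean_space \<Rightarrow> complex) \<Rightarrow> real" where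
  "low_frequency_energy \<theta> t f =
    (LINT \<xi>|lborel. indicator (ball 0 1) \<xi> * ((propagator \<theta> t (norm \<xi>))\<^sup>2 * (norm (fourier_integral f \<xi>))\<^sup>2))"

text \<open>Plancherel turns the norm into a frequency integral, split at |xi| = 1. The outer part
  is nonnegative, which gives the lower bound, and exponentially small, which gives the upper
  one.\<close>

lemma solution_norm_bounds:
  assumes \<theta>: "1/2 < \<theta>"
  shows "\<exists>a>0. \<forall>(u1 :: 'a::euclidean_space \<Rightarrow> complex) u t.
    in_L2 u1 \<and> integrable lborel u1 \<and> mild_solution \<theta> u1 u \<and> 0 \<le> t \<longrightarrow>
      low_frequency_energy \<theta> t u1 \<le> plancherel_const TYPE('a) * (L2_norm (u t))\<^sup>2 \<and>
      plancherel_const TYPE('a) * (L2_norm (u t))\<^sup>2 \<le> low_frequency_energy \<theta> t u1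
        + 2 * exp (- a * t) * (plancherel_const TYPE('a) * (L2_norm u1)\<^sup>2)"
proof -
  let ?c = "plancherel_const TYPE('a)"
  obtain a where a: "0 < a" and high: "\<And>(u1 :: 'a \<Rightarrow> complex) u t R. in_L2 u1 \<Longrightarrow> mild_solution \<theta> u1 u \<Longrightarrow> 0 \<le> t \<Longrightarrow>
    (norm (mult_l2 (indicator {\<xi>. 1 \<le> norm \<xi> \<and> norm \<xi> \<le> R}) (fourier_l2 (abs_l2 (u t)))))\<^sup>2
      \<le> 2 * exp (- a * t) * (norm (fourier_l2 (abs_l2 u1)))\<^sup>2"
    by (rule high_frequency_decay[OF \<theta>, where 'a = 'a]) blast
  have "low_frequency_energy \<theta> t u1 \<le> ?c * (L2_norm (u t))\<^sup>2 \<and>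
      ?c * (L2_norm (u t))\<^sup>2 \<le> low_frequency_energy \<theta> t u1 + 2 * exp (- a * t) * (?c * (L2_norm u1)\<^sup>2)"
    if u1: "in_L2 u1" and i1: "integrable lborel u1" and mild: "mild_solution \<theta> u1 u" and t: "0 \<le> t"
    for u1 :: "'a \<Rightarrow> complex" and u t
  proof -
    have \<theta>0: "0 < \<theta>" using \<theta> by simp
    have uL: "in_L2 (u t)" using mild t by (auto simp: mild_solution_def continuous_into_H_def in_H_def)
    let ?U = "fourier_l2 (abs_l2 (u t))"
    define r where "r = rep_l2 ?U"
    have rL: "in_L2 r" by (simp add: r_def)
    note [measurable] = in_L2_measurable[OF rL]
    note i = in_L2_integrable[OF rL]
    have sq: "(norm (fourier_l2 (abs_l2 f)))\<^sup>2 = ?c * (L2_norm f)\<^sup>2" if "in_L2 f" for f :: "'a \<Rightarrow> complex"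
      using plancherel_const_pos[where 'a = 'a] by (simp add: plancherel power_mult_distrib norm_abs_l2 that)
    have ilow: "integrable lborel (\<lambda>\<xi>. indicator (ball 0 1) \<xi> * (norm (r \<xi>))\<^sup>2)"
      and ihigh: "integrable lborel (\<lambda>\<xi>. indicator (- ball 0 1) \<xi> * (norm (r \<xi>))\<^sup>2)"
      by (rule Bochner_Integration.integrable_bound[OF i]; simp add: indicator_def)+
    have "?c * (L2_norm (u t))\<^sup>2 = (LINT \<xi>|lborel. (norm (r \<xi>))\<^sup>2)"
      using sq[OF uL] by (simp only: norm_l2_rep[of ?U] L2_norm_power2 r_def)
    also have "\<dots> = (LINT \<xi>|lborel. indicator (ball 0 1) \<xi> * (norm (r \<xi>))\<^sup>2 + indicator (- ball 0 1) \<xi> * (norm (r \<xi>))\<^sup>2)"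
      by (intro Bochner_Integration.integral_cong) (auto simp: indicator_def)
    also have "\<dots> = (LINT \<xi>|lborel. indicator (ball 0 1) \<xi> * (norm (r \<xi>))\<^sup>2)
        + (LINT \<xi>|lborel. indicator (- ball 0 1) \<xi> * (norm (r \<xi>))\<^sup>2)"
      by (rule Bochner_Integration.integral_add[OF ilow ihigh])
    also have "(LINT \<xi>|lborel. indicator (ball 0 1) \<xi> * (norm (r \<xi>))\<^sup>2) = low_frequency_energy \<theta> t u1"
      unfolding low_frequency_energy_def
    proof (rule integral_cong_AE)
      have "(\<lambda>\<xi>::'a. propagator \<theta> t (norm \<xi>)) \<in> borel_measurable borel" by measurable
      then show "(\<lambda>\<xi>. indicator (ball 0 1) \<xi> * ((propagator \<theta> t (norm \<xi>))\<^sup>2 * (norm (fourier_integral u1 \<xi>))\<^sup>2))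
          \<in> borel_measurable lborel"
        unfolding measurable_lborel2
        by (intro borel_measurable_times borel_measurable_power borel_measurable_indicator
            measurable_compose[OF fourier_integral_measurable[OF i1], where g = norm]) auto
      show "(\<lambda>\<xi>. indicator (ball 0 1) \<xi> * (norm (r \<xi>))\<^sup>2) \<in> borel_measurable lborel"
        using borel_measurable_integrable[OF ilow] .
      show "AE \<xi> in lborel. indicator (ball 0 1) \<xi> * (norm (r \<xi>))\<^sup>2
          = indicator (ball 0 1) \<xi> * ((propagator \<theta> t (norm \<xi>))\<^sup>2 * (norm (fourier_integral u1 \<xi>))\<^sup>2)"
        using low_frequency_formula[OF \<theta> u1 i1 mild t, folded r_def]
        by eventually_elim (auto simp: indicator_def power_mult_distrib)
    qed
    finally have split: "?c * (L2_norm (u t))\<^sup>2 = low_frequency_energy \<theta> t u1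
        + (LINT \<xi>|lborel. indicator (- ball 0 1) \<xi> * (norm (r \<xi>))\<^sup>2)" .
    have "0 \<le> (LINT \<xi>|lborel. indicator (- ball 0 1) \<xi> * (norm (r \<xi>))\<^sup>2)"
      by (rule Bochner_Integration.integral_nonneg) simp
    moreover have "(LINT \<xi>|lborel. indicator (- ball 0 1) \<xi> * (norm (r \<xi>))\<^sup>2)
        \<le> 2 * exp (- a * t) * (?c * (L2_norm u1)\<^sup>2)"
    \<comment> \<open>The decay estimate is available on annuli of finite outer radius k only; the
      bound is uniform in k and survives the limit.\<close>
    proof (rule LIMSEQ_le_const2)
      let ?Z = "\<lambda>k::nat. {\<xi>::'a. 1 \<le> norm \<xi> \<and> norm \<xi> \<le> real k}"
      note Z = annulus_symbols(1)[OF \<theta>0, of 1, where 'a = 'a]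
      have [measurable]: "?Z k \<in> sets borel" for k by (rule Z)
      show "(\<lambda>k. LINT \<xi>|lborel. indicator (?Z k) \<xi> * (norm (r \<xi>))\<^sup>2)
          \<longlonglongrightarrow> (LINT \<xi>|lborel. indicator (- ball 0 1) \<xi> * (norm (r \<xi>))\<^sup>2)"
      proof (rule integral_dominated_convergence[OF _ _ i])
        show "AE \<xi> in lborel. (\<lambda>k. indicator (?Z k) \<xi> * (norm (r \<xi>))\<^sup>2) \<longlonglongrightarrow> indicator (- ball 0 1) \<xi> * (norm (r \<xi>))\<^sup>2"
        proof (rule AE_I2, rule tendsto_eventually)
          fix \<xi> :: 'a
          obtain N where N: "norm \<xi> \<le> real N" using real_arch_simple by blast
          have "indicator (?Z k) \<xi> = (indicator (- ball 0 1) \<xi> :: real)" if "N \<le> k" for k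
            using N that by (auto simp: indicator_def)
          then show "\<forall>\<^sub>F k in sequentially. indicator (?Z k) \<xi> * (norm (r \<xi>))\<^sup>2 = indicator (- ball 0 1) \<xi> * (norm (r \<xi>))\<^sup>2"
            by (intro eventually_sequentiallyI[of N]) simp
        qed
        show "AE \<xi> in lborel. norm (indicator (?Z k) \<xi> * (norm (r \<xi>))\<^sup>2) \<le> (norm (r \<xi>))\<^sup>2" for k
          by (rule AE_I2) (simp add: indicator_def)
      qed measurable
      show "\<exists>N. \<forall>k\<ge>N. (LINT \<xi>|lborel. indicator (?Z k) \<xi> * (norm (r \<xi>))\<^sup>2) \<le> 2 * exp (- a * t) * (?c * (L2_norm u1)\<^sup>2)"
      proof (intro exI allI impI)
        fix k
        note b = bounded_symbol_indicator[OF Z, of "real k"]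
        have "(LINT \<xi>|lborel. indicator (?Z k) \<xi> * (norm (r \<xi>))\<^sup>2)
            = (LINT \<xi>|lborel. (norm (indicator (?Z k) \<xi> *\<^sub>R r \<xi>))\<^sup>2)"
          by (intro Bochner_Integration.integral_cong) (auto simp: indicator_def)
        also have "\<dots> = (norm (mult_l2 (indicator (?Z k)) ?U))\<^sup>2"
          unfolding mult_l2_def norm_abs_l2[OF in_L2_mult[OF b in_L2_rep]] L2_norm_power2 r_def by (rule refl)
        also have "\<dots> \<le> 2 * exp (- a * t) * (?c * (L2_norm u1)\<^sup>2)"
          using high[OF u1 mild t, of "real k"] by (simp only: sq[OF u1])
        finally show "(LINT \<xi>|lborel. indicator (?Z k) \<xi> * (norm (r \<xi>))\<^sup>2) \<le> 2 * exp (- a * t) * (?c * (L2_norm u1)\<^sup>2)" .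
      qed
    qed
    ultimately show ?thesis using split by linarith
  qed
  with a show ?thesis by blast
qed

section \<open>Radial integrals\<close>

definition sphere_area :: "'a::euclidean_space itself \<Rightarrow> real" where
  "sphere_area _ = real DIM('a) * unit_ball_vol (real DIM('a))"

lemma sphere_area_pos: "0 < sphere_area TYPE('a::euclidean_space)"
  by (simp add: sphere_area_def)

text \<open>Polar coordinates for radial functions: two measures on the line are compared on the
  half-lines up to a, where one side is the volume of a ball of radius a and the other its value by
  the fundamental theorem of calculus.\<close>

lemma distr_norm_lborel:
  "distr lborel borel (norm :: 'a::euclidean_space \<Rightarrow> real)
    = density lborel (\<lambda>r. ennreal (sphere_area TYPE('a) * r ^ (DIM('a) - 1)) * indicator {0..} r)"
  (is "?M = ?N")
proof (rule measure_eqI_generator_eq)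
  let ?n = "DIM('a)" and ?V = "unit_ball_vol (real DIM('a))"
  let ?E = "range (\<lambda>a::real. {..a})"
  show "Int_stable ?E" by (auto simp: Int_stable_def)
  show "?E \<subseteq> Pow UNIV" by simp
  show "sets ?M = sigma_sets UNIV ?E" "sets ?N = sigma_sets UNIV ?E"
    by (simp_all add: borel_eq_atMost)
  show "range (\<lambda>i. {..real i}) \<subseteq> ?E" by auto
  show "(\<Union>i. {..real i}) = UNIV" using real_arch_simple by auto
  have M: "emeasure ?M {..a} = emeasure lborel (cball (0::'a) a)" for a
    by (subst emeasure_distr) (auto simp: vimage_def cball_def)
  show "emeasure ?M {..real i} \<noteq> \<infinity>" for i
    unfolding M using emeasure_lborel_cball_finite[of "0::'a" "real i"] by simp
  fix X assume "X \<in> ?E"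
  then obtain a where X: "X = {..a}" by auto
  show "emeasure ?M X = emeasure ?N X"
  proof (cases "0 \<le> a")
    case True
    have "emeasure ?N X = (\<integral>\<^sup>+r. ennreal (sphere_area TYPE('a) * r ^ (?n - 1)) * indicator {0..a} r \<partial>lborel)"
      unfolding X by (subst emeasure_density) (auto intro!: nn_integral_cong simp: indicator_def)
    also have "\<dots> = ennreal (?V * a ^ ?n - ?V * 0 ^ ?n)"
    proof (rule nn_integral_FTC_Icc[OF _ _ _ True])
      show "((\<lambda>r. ?V * r ^ ?n) has_real_derivative sphere_area TYPE('a) * r ^ (?n - 1)) (at r)" for r
        by (auto intro!: derivative_eq_intros simp: sphere_area_def)
      show "0 \<le> sphere_area TYPE('a) * r ^ (?n - 1)" if "r \<in> {0..a}" for r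
        using that sphere_area_pos[where 'a = 'a] by simp
    qed simp
    also have "\<dots> = emeasure ?M X"
      unfolding X M using True by (simp add: emeasure_cball)
    finally show ?thesis by (rule sym)
  next
    case False
    have "emeasure ?N X = (\<integral>\<^sup>+r. ennreal (sphere_area TYPE('a) * r ^ (?n - 1)) * indicator {0..} r * indicator {..a} r \<partial>lborel)"
      unfolding X by (subst emeasure_density) auto
    also have "\<dots> = (\<integral>\<^sup>+r. 0 \<partial>(lborel :: real measure))"
      using False by (intro nn_integral_cong) (simp add: indicator_def)
    finally have "emeasure ?N X = (\<integral>\<^sup>+r. 0 \<partial>(lborel :: real measure))" .
    moreover have "emeasure ?M X = 0" unfolding X M using False by (simp add: cball_empty)
    ultimately show ?thesis by simp
  qed
qed

lemma nn_integral_radial: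
  fixes f :: "real \<Rightarrow> ennreal"
  assumes [measurable]: "f \<in> borel_measurable borel"
  shows "(\<integral>\<^sup>+x. f (norm (x::'a::euclidean_space)) \<partial>lborel)
    = (\<integral>\<^sup>+r. ennreal (sphere_area TYPE('a) * r ^ (DIM('a) - 1)) * indicator {0..} r * f r \<partial>lborel)"
proof -
  have "(\<integral>\<^sup>+x. f (norm (x::'a)) \<partial>lborel) = (\<integral>\<^sup>+r. f r \<partial>distr lborel borel (norm :: 'a \<Rightarrow> real))"
    by (simp add: nn_integral_distr)
  then show ?thesis
    unfolding distr_norm_lborel by (simp add: nn_integral_density)
qed

lemma nn_integral_radial_ball:
  fixes g :: "real \<Rightarrow> ennreal"
  assumes [measurable]: "g \<in> borel_measurable borel"
  shows "(\<integral>\<^sup>+x. indicator (ball 0 \<rho>) x * g (norm (x::'a::euclidean_space)) \<partial>lborel) = ennreal (sphere_area TYPE('a)) *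
    (\<integral>\<^sup>+r. ennreal (r ^ (DIM('a) - 1)) * indicator {0..} r * (indicator {..<\<rho>} r * g r) \<partial>lborel)"
proof -
  let ?n = "DIM('a)" and ?S = "sphere_area TYPE('a)"
  have "(\<integral>\<^sup>+x. indicator (ball 0 \<rho>) x * g (norm (x::'a)) \<partial>lborel)
      = (\<integral>\<^sup>+x. indicator {..<\<rho>} (norm (x::'a)) * g (norm x) \<partial>lborel)"
    by (intro nn_integral_cong) (auto simp: indicator_def)
  also have "\<dots> = (\<integral>\<^sup>+r. ennreal (?S * r ^ (?n - 1)) * indicator {0..} r * (indicator {..<\<rho>} r * g r) \<partial>lborel)"
    by (rule nn_integral_radial) measurable
  also have "\<dots> = (\<integral>\<^sup>+r. ennreal ?S * (ennreal (r ^ (?n - 1)) * indicator {0..} r * (indicator {..<\<rho>} r * g r)) \<partial>lborel)"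
    using sphere_area_pos[where 'a = 'a]
    by (intro nn_integral_cong) (auto simp: indicator_def ennreal_mult mult.assoc)
  also have "\<dots> = ennreal ?S * (\<integral>\<^sup>+r. ennreal (r ^ (?n - 1)) * indicator {0..} r * (indicator {..<\<rho>} r * g r) \<partial>lborel)"
    by (rule nn_integral_cmult) measurable
  finally show ?thesis .
qed

section \<open>Upper bounds for the low frequency energy\<close>

text \<open>This is the rate of the squared norm, so square roots are taken at the very end.\<close>

definition decay_rate :: "real \<Rightarrow> nat \<Rightarrow> real \<Rightarrow> real" where
  "decay_rate \<theta> n t = (if n \<ge> 3 then t powr (- (real n - 2) / (2 * \<theta>)) else if n = 2 then ln t else t)"

lemma powr_at_top:
  assumes "0 < (p::real)"
  shows "filterlim (\<lambda>x. x powr p) at_top at_top"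
proof (subst filterlim_cong[OF refl refl])
  show "LIM x at_top. exp (p * ln x) :> at_top"
    by (rule filterlim_compose[OF exp_at_top filterlim_tendsto_pos_mult_at_top[OF tendsto_const]])
       (simp_all add: ln_at_top assms)
  show "eventually (\<lambda>x. x powr p = exp (p * ln x)) at_top"
    using eventually_gt_at_top[of 0] by eventually_elim (simp add: powr_def)
qed

text \<open>With x = r^(2 theta) in [0, 1], exp (x/2) <= 1 + x/2 + x^2/4 <= 1 + x, and the logarithm
  is monotone.\<close>

lemma damping_ge:
  assumes "1/2 < \<theta>" "0 \<le> r" "r \<le> 1"
  shows "r powr (2 * \<theta>) / 2 \<le> damping \<theta> r"
proof -
  define x where "x = r powr (2 * \<theta>)"
  have x: "0 \<le> x" "x \<le> 1" using powr_le_self[OF assms] assms by (auto simp: x_def)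
  have "exp (x / 2) \<le> 1 + x / 2 + (x / 2)\<^sup>2" using x by (intro exp_bound) auto
  also have "\<dots> \<le> 1 + x"
    using x mult_left_le[of x x] by (simp add: power2_eq_square)
  finally have "x / 2 \<le> ln (1 + x)" by (rule iffD2[OF ln_ge_iff, rotated]) (use x in simp)
  then show ?thesis by (simp add: damping_def x_def)
qed

lemma propagator_sq_le:
  assumes \<theta>: "1/2 < \<theta>" and r: "0 < r" "r \<le> 1" and t: "0 \<le> t"
  shows "(propagator \<theta> t r)\<^sup>2 \<le> exp (- (t * r powr (2 * \<theta>)) / 2) * (4 / r\<^sup>2)"
proof -
  note f = frequency_bounds[OF \<theta> r]
  have "(sin (frequency \<theta> r * t))\<^sup>2 \<le> 1" by (simp add: abs_square_le_1)
  then have "(sin (frequency \<theta> r * t) / frequency \<theta> r)\<^sup>2 \<le> 1 / (frequency \<theta> r)\<^sup>2"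
    by (simp add: power_divide divide_right_mono)
  also have "\<dots> \<le> 1 / (r\<^sup>2 / 4)"
  proof (rule divide_left_mono)
    show "r\<^sup>2 / 4 \<le> (frequency \<theta> r)\<^sup>2" using f(2) zero_le_power2[of r] by linarith
  qed (use r f(4) in auto)
  finally have s: "(sin (frequency \<theta> r * t) / frequency \<theta> r)\<^sup>2 \<le> 4 / r\<^sup>2" by simp
  have "(exp (- (damping \<theta> r * t / 2)))\<^sup>2 = exp (- (damping \<theta> r * t))"
    by (simp add: power2_eq_square exp_add[symmetric])
  also have "\<dots> \<le> exp (- (t * r powr (2 * \<theta>)) / 2)"
    using mult_left_mono[OF damping_ge[OF \<theta>, of r] t] r by (simp add: mult.commute)
  finally show ?thesis
    unfolding propagator_def power_mult_distrib using s by (intro mult_mono) auto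
qed

lemma propagator_sq_le':
  assumes \<theta>: "1/2 < \<theta>" and r: "0 < r" "r \<le> 1" and t: "0 \<le> t"
  shows "(propagator \<theta> t r)\<^sup>2 \<le> 4 / r\<^sup>2" "(propagator \<theta> t r)\<^sup>2 \<le> t\<^sup>2"
proof -
  have "(propagator \<theta> t r)\<^sup>2 \<le> exp (- (t * r powr (2 * \<theta>)) / 2) * (4 / r\<^sup>2)"
    by (rule propagator_sq_le[OF assms])
  also have "\<dots> \<le> 1 * (4 / r\<^sup>2)" using t by (intro mult_right_mono) auto
  finally show "(propagator \<theta> t r)\<^sup>2 \<le> 4 / r\<^sup>2" by simp
  show "(propagator \<theta> t r)\<^sup>2 \<le> t\<^sup>2"
    using propagator_bounds(3)[OF assms] t by (intro abs_le_square_iff[THEN iffD1]) simp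
qed

text \<open>On [0, 1] the integrand is at most 1. Beyond 1, s^(2 theta) >= s reduces the integral to
  a Gamma integral.\<close>

lemma stretched_exp_moment_finite:
  assumes \<theta>: "1/2 < \<theta>"
  shows "(\<integral>\<^sup>+s. ennreal (s ^ m * exp (- (s powr (2 * \<theta>)) / 2)) * indicator {0..} s \<partial>lborel) < \<infinity>"
proof -
  have "(\<integral>\<^sup>+s. ennreal (s ^ m * exp (- (s powr (2 * \<theta>)) / 2)) * indicator {0..} s \<partial>lborel)
      \<le> (\<integral>\<^sup>+s. indicator {0..1} s + ennreal (s ^ m * exp (- s / 2)) * indicator {0..} s \<partial>lborel)"
  proof (rule nn_integral_mono)
    fix s :: real
    show "ennreal (s ^ m * exp (- (s powr (2 * \<theta>)) / 2)) * indicator {0..} s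
        \<le> indicator {0..1} s + ennreal (s ^ m * exp (- s / 2)) * indicator {0..} s"
    proof (cases "0 \<le> s \<and> s \<le> 1")
      case True
      then have "s ^ m * exp (- (s powr (2 * \<theta>)) / 2) \<le> 1 * 1"
        by (intro mult_mono) (auto simp: power_le_one)
      then have "ennreal (s ^ m * exp (- (s powr (2 * \<theta>)) / 2)) \<le> 1" by simp
      with True show ?thesis by (simp add: add_increasing2)
    next
      case False
      show ?thesis
      proof (cases "0 \<le> s")
        case True
        with False have "s powr 1 \<le> s powr (2 * \<theta>)" using \<theta> by (intro powr_mono) auto
        then have "s ^ m * exp (- (s powr (2 * \<theta>)) / 2) \<le> s ^ m * exp (- s / 2)"
          using True by (intro mult_left_mono) auto
        with True show ?thesis by (simp add: add_increasing ennreal_leI)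
      qed simp
    qed
  qed
  also have "\<dots> = 1 + (\<integral>\<^sup>+s. ennreal (s ^ m * exp (- s / 2)) * indicator {0..} s \<partial>lborel)"
    by (subst nn_integral_add) auto
  also have "(\<integral>\<^sup>+s. ennreal (s ^ m * exp (- s / 2)) * indicator {0..} s \<partial>lborel)
      = ennreal 2 * (\<integral>\<^sup>+s. ennreal ((2 * s) ^ m * exp (- (2 * s) / 2)) * indicator {0..} (2 * s) \<partial>lborel)"
    by (subst nn_integral_real_affine[where c = 2 and t = 0]) auto
  also have "(\<integral>\<^sup>+s. ennreal ((2 * s) ^ m * exp (- (2 * s) / 2)) * indicator {0..} (2 * s) \<partial>lborel)
      = (\<integral>\<^sup>+s. ennreal (2 ^ m) * (ennreal (s ^ m * exp (- s)) * indicator {0..} s) \<partial>lborel)"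
    by (intro nn_integral_cong) (auto simp: power_mult_distrib ennreal_mult'[symmetric] mult.assoc indicator_def)
  also have "\<dots> = ennreal (2 ^ m) * ennreal (fact m)"
    by (subst nn_integral_cmult) (auto simp: nn_intergal_power_times_exp_Ici)
  also have "1 + ennreal 2 * (ennreal (2 ^ m) * ennreal (fact m)) < \<infinity>"
    by (simp add: ennreal_mult_less_top)
  finally show ?thesis .
qed

text \<open>The factor 4/r^2 of the propagator bound turns r^(n-1) into r^m with m = n - 3 >= 0, so
  the origin causes no divergence and the damping alone determines the rate.\<close>

lemma propagator_energy_upper_high_dim:
  assumes \<theta>: "1/2 < \<theta>" and n: "n = m + 3"
  shows "\<exists>K>0. \<forall>t>0. (\<integral>\<^sup>+r. ennreal (r ^ (n - 1)) * indicator {0..} r * (indicator {..<1} r * ennreal ((propagator \<theta> t r)\<^sup>2)) \<partial>lborel)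
    \<le> ennreal (K * decay_rate \<theta> n t)"
proof -
  let ?I = "\<integral>\<^sup>+s. ennreal (s ^ m * exp (- (s powr (2 * \<theta>)) / 2)) * indicator {0..} s \<partial>lborel"
  obtain K0 where K0: "?I = ennreal K0" "0 \<le> K0"
    using stretched_exp_moment_finite[OF \<theta>, of m] by (cases ?I) auto
  have "(\<integral>\<^sup>+r. ennreal (r ^ (n - 1)) * indicator {0..} r * (indicator {..<1} r * ennreal ((propagator \<theta> t r)\<^sup>2)) \<partial>lborel)
    \<le> ennreal ((4 * K0 + 1) * decay_rate \<theta> n t)" if t: "0 < t" for t
  proof -
    \<comment> \<open>With r = tau s the exponent t r^(2 theta) becomes s^(2 theta), free of time.
      The substitution leaves tau^(m+1), which is the rate.\<close>
    define \<tau> where "\<tau> = t powr (- 1 / (2 * \<theta>))"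
    have \<tau>: "0 < \<tau>" using t by (simp add: \<tau>_def)
    have "(\<integral>\<^sup>+r. ennreal (r ^ (n - 1)) * indicator {0..} r * (indicator {..<1} r * ennreal ((propagator \<theta> t r)\<^sup>2)) \<partial>lborel)
        \<le> (\<integral>\<^sup>+r. ennreal 4 * (ennreal (r ^ m * exp (- (t * r powr (2 * \<theta>)) / 2)) * indicator {0..} r) \<partial>lborel)"
    proof (rule nn_integral_mono)
      fix r :: real
      show "ennreal (r ^ (n - 1)) * indicator {0..} r * (indicator {..<1} r * ennreal ((propagator \<theta> t r)\<^sup>2))
          \<le> ennreal 4 * (ennreal (r ^ m * exp (- (t * r powr (2 * \<theta>)) / 2)) * indicator {0..} r)"
      proof (cases "0 < r \<and> r < 1")
        case True
        have pw: "r ^ (n - 1) = r ^ m * r\<^sup>2" by (simp add: n power_add[symmetric])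
        have "r ^ m * r\<^sup>2 * (propagator \<theta> t r)\<^sup>2 \<le> r ^ m * r\<^sup>2 * (exp (- (t * r powr (2 * \<theta>)) / 2) * (4 / r\<^sup>2))"
          using t True by (intro mult_left_mono propagator_sq_le[OF \<theta>]) auto
        also have "r ^ m * r\<^sup>2 * (exp (- (t * r powr (2 * \<theta>)) / 2) * (4 / r\<^sup>2))
            = 4 * (r ^ m * exp (- (t * r powr (2 * \<theta>)) / 2))" using True by simp
        finally have "ennreal (r ^ (n - 1) * (propagator \<theta> t r)\<^sup>2) \<le> ennreal (4 * (r ^ m * exp (- (t * r powr (2 * \<theta>)) / 2)))"
          unfolding pw by (rule ennreal_leI)
        with True show ?thesis by (simp add: ennreal_mult)
      next
        case False
        then show ?thesis by (cases "r = 0") (auto simp: n indicator_def)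
      qed
    qed
    also have "\<dots> = ennreal 4 * (\<integral>\<^sup>+r. ennreal (r ^ m * exp (- (t * r powr (2 * \<theta>)) / 2)) * indicator {0..} r \<partial>lborel)"
      by (rule nn_integral_cmult) measurable
    also have "(\<integral>\<^sup>+r. ennreal (r ^ m * exp (- (t * r powr (2 * \<theta>)) / 2)) * indicator {0..} r \<partial>lborel)
        = ennreal \<tau> * (\<integral>\<^sup>+s. ennreal ((\<tau> * s) ^ m * exp (- (t * (\<tau> * s) powr (2 * \<theta>)) / 2)) * indicator {0..} (\<tau> * s) \<partial>lborel)"
      using \<tau> by (subst nn_integral_real_affine[where c = \<tau> and t = 0]) auto
    also have "(\<integral>\<^sup>+s. ennreal ((\<tau> * s) ^ m * exp (- (t * (\<tau> * s) powr (2 * \<theta>)) / 2)) * indicator {0..} (\<tau> * s) \<partial>lborel)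
        = (\<integral>\<^sup>+s. ennreal (\<tau> ^ m) * (ennreal (s ^ m * exp (- (s powr (2 * \<theta>)) / 2)) * indicator {0..} s) \<partial>lborel)"
    proof (rule nn_integral_cong)
      fix s :: real
      have "t * (\<tau> * s) powr (2 * \<theta>) = s powr (2 * \<theta>)" if "0 \<le> s"
      proof -
        have "t * (\<tau> * s) powr (2 * \<theta>) = t * (t powr (-1)) * s powr (2 * \<theta>)"
          using that \<tau> \<theta> by (simp add: powr_mult \<tau>_def powr_powr)
        then show ?thesis using t by (simp add: powr_minus)
      qed
      then show "ennreal ((\<tau> * s) ^ m * exp (- (t * (\<tau> * s) powr (2 * \<theta>)) / 2)) * indicator {0..} (\<tau> * s)
          = ennreal (\<tau> ^ m) * (ennreal (s ^ m * exp (- (s powr (2 * \<theta>)) / 2)) * indicator {0..} s)"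
        using \<tau> by (auto simp: indicator_def zero_le_mult_iff power_mult_distrib ennreal_mult'[symmetric] mult.assoc)
    qed
    also have "\<dots> = ennreal (\<tau> ^ m) * ennreal K0"
      by (subst nn_integral_cmult) (measurable, simp only: K0)
    also have "ennreal 4 * (ennreal \<tau> * (ennreal (\<tau> ^ m) * ennreal K0)) = ennreal (4 * (\<tau> * (\<tau> ^ m * K0)))"
      using \<tau> K0(2)
      by (simp only: ennreal_mult[symmetric] zero_le_numeral zero_le_power mult_nonneg_nonneg less_imp_le)
    also have "4 * (\<tau> * (\<tau> ^ m * K0)) = 4 * K0 * \<tau> ^ Suc m" by simp
    also have "\<tau> ^ Suc m = decay_rate \<theta> n t"
    proof -
      have "\<tau> ^ Suc m = \<tau> powr real (Suc m)" by (rule powr_realpow[OF \<tau>, symmetric])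
      also have "\<dots> = t powr (- 1 / (2 * \<theta>) * real (Suc m))" by (simp only: \<tau>_def powr_powr)
      also have "- 1 / (2 * \<theta>) * real (Suc m) = - (real n - 2) / (2 * \<theta>)"
        using \<theta> by (simp add: n field_simps)
      finally show ?thesis by (simp add: decay_rate_def n)
    qed
    also have "ennreal (4 * K0 * decay_rate \<theta> n t) \<le> ennreal ((4 * K0 + 1) * decay_rate \<theta> n t)"
      by (intro ennreal_leI mult_right_mono) (auto simp: decay_rate_def n)
    finally show ?thesis .
  qed
  then show ?thesis using K0(2) by (intro exI[of _ "4 * K0 + 1"]) auto
qed

text \<open>Without enough powers of r the bound 4/r^2 is too singular at 0. The integral is split
  at r = 1/t, with t^2 used below and 4/r^2 above.\<close>

lemma propagator_energy_upper_low_dim: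
  assumes \<theta>: "1/2 < \<theta>" and n: "n = 1 \<or> n = 2"
  shows "\<exists>K>0. \<forall>t\<ge>exp 1. (\<integral>\<^sup>+r. ennreal (r ^ (n - 1)) * indicator {0..} r * (indicator {..<1} r * ennreal ((propagator \<theta> t r)\<^sup>2)) \<partial>lborel)
    \<le> ennreal (K * decay_rate \<theta> n t)"
proof -
  have "(\<integral>\<^sup>+r. ennreal (r ^ (n - 1)) * indicator {0..} r * (indicator {..<1} r * ennreal ((propagator \<theta> t r)\<^sup>2)) \<partial>lborel)
    \<le> ennreal (5 * decay_rate \<theta> n t)" if te: "exp 1 \<le> t" for t
  proof -
    have t1: "1 < t" using te exp_ge_add_one_self[of 1] by simp
    then have t: "0 < t" "0 < 1 / t" "1 / t \<le> 1" by auto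
    define g where "g r = 4 * r ^ (n - 1) / r\<^sup>2" for r :: real
    \<comment> \<open>An antiderivative of \<open>g\<close>, which is 4/r^2 in dimension 1 and 4/r
      in dimension 2.\<close>
    define F where "F r = (if n = 1 then - 4 / r else 4 * ln r)" for r :: real
    have g0: "0 \<le> g r" if "0 < r" for r using that by (simp add: g_def)
    have [measurable]: "g \<in> borel_measurable borel" unfolding g_def by measurable
    have "(\<integral>\<^sup>+r. ennreal (r ^ (n - 1)) * indicator {0..} r * (indicator {..<1} r * ennreal ((propagator \<theta> t r)\<^sup>2)) \<partial>lborel)
        \<le> (\<integral>\<^sup>+r. ennreal ((1 / t) ^ (n - 1) * t\<^sup>2) * indicator {0..1 / t} r + ennreal (g r) * indicator {1 / t..1} r \<partial>lborel)"
    proof (rule nn_integral_mono_AE)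
      have "AE r in lborel. r \<noteq> (0::real)" by (rule AE_lborel_singleton)
      then show "AE r in lborel. ennreal (r ^ (n - 1)) * indicator {0..} r * (indicator {..<1} r * ennreal ((propagator \<theta> t r)\<^sup>2))
          \<le> ennreal ((1 / t) ^ (n - 1) * t\<^sup>2) * indicator {0..1 / t} r + ennreal (g r) * indicator {1 / t..1} r"
      proof eventually_elim
        case (elim r)
        show ?case
        proof (cases "0 < r \<and> r < 1")
          case True
          then have eq: "ennreal (r ^ (n - 1)) * indicator {0..} r * (indicator {..<1} r * ennreal ((propagator \<theta> t r)\<^sup>2))
              = ennreal (r ^ (n - 1) * (propagator \<theta> t r)\<^sup>2)" by (simp add: ennreal_mult)
          show ?thesis
          proof (cases "r \<le> 1 / t")
            case r: True
            have "r ^ (n - 1) * (propagator \<theta> t r)\<^sup>2 \<le> (1 / t) ^ (n - 1) * t\<^sup>2"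
              using True r t by (intro mult_mono power_mono propagator_sq_le'(2)[OF \<theta>]) auto
            then have "ennreal (r ^ (n - 1) * (propagator \<theta> t r)\<^sup>2) \<le> ennreal ((1 / t) ^ (n - 1) * t\<^sup>2)" by (rule ennreal_leI)
            then show ?thesis unfolding eq using True r by (simp add: add_increasing2)
          next
            case r: False
            have "r ^ (n - 1) * (propagator \<theta> t r)\<^sup>2 \<le> r ^ (n - 1) * (4 / r\<^sup>2)"
              using True t by (intro mult_left_mono propagator_sq_le'(1)[OF \<theta>]) auto
            then have "ennreal (r ^ (n - 1) * (propagator \<theta> t r)\<^sup>2) \<le> ennreal (g r)"
              by (intro ennreal_leI) (simp add: g_def mult.commute)
            then show ?thesis unfolding eq using True r by (simp add: add_increasing)
          qed
        next
          case False
          with elim show ?thesis by (auto simp: indicator_def)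
        qed
      qed
    qed
    also have "\<dots> = ennreal ((1 / t) ^ (n - 1) * t\<^sup>2) * ennreal (1 / t) + (\<integral>\<^sup>+r. ennreal (g r) * indicator {1 / t..1} r \<partial>lborel)"
      using t by (subst nn_integral_add) (auto simp: nn_integral_cmult)
    also have "(\<integral>\<^sup>+r. ennreal (g r) * indicator {1 / t..1} r \<partial>lborel) = ennreal (F 1 - F (1 / t))"
    proof (rule nn_integral_FTC_Icc[OF _ _ _ t(3)])
      show "(F has_real_derivative g r) (at r)" if "r \<in> {1 / t..1}" for r
      proof -
        have "1 / t \<le> r" using that by simp
        then have "0 < r" using t by linarith
        then show ?thesis
          unfolding F_def g_def using n
          by (auto intro!: derivative_eq_intros simp: power2_eq_square field_simps)
      qed
      show "0 \<le> g r" if "r \<in> {1 / t..1}" for r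
      proof (rule g0)
        have "1 / t \<le> r" using that by simp
        then show "0 < r" using t by linarith
      qed
    qed measurable
    also have "ennreal ((1 / t) ^ (n - 1) * t\<^sup>2) * ennreal (1 / t) + ennreal (F 1 - F (1 / t))
        = ennreal ((1 / t) ^ (n - 1) * t\<^sup>2 * (1 / t) + (F 1 - F (1 / t)))"
      using t t1 n by (simp add: ennreal_mult'[symmetric] ennreal_plus[symmetric] F_def ln_div del: ennreal_plus)
    also have "\<dots> \<le> ennreal (5 * decay_rate \<theta> n t)"
    proof (rule ennreal_leI)
      \<comment> \<open>The total is t + 4 t - 4 in dimension 1 and 1 + 4 ln t in dimension 2. The
        second is at most 5 ln t because t >= e.\<close>
      have "1 \<le> ln t" using te t by (simp add: ln_ge_iff)
      then show "(1 / t) ^ (n - 1) * t\<^sup>2 * (1 / t) + (F 1 - F (1 / t)) \<le> 5 * decay_rate \<theta> n t"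
        using n t t1 by (auto simp: F_def decay_rate_def power2_eq_square ln_div)
    qed
    finally show ?thesis .
  qed
  then show ?thesis by (intro exI[of _ 5]) auto
qed

lemma propagator_energy_upper_1d:
  assumes \<theta>: "1/2 < \<theta>" and n: "1 \<le> n"
  shows "\<exists>K>0. \<forall>\<^sub>F t in at_top. (\<integral>\<^sup>+r. ennreal (r ^ (n - 1)) * indicator {0..} r * (indicator {..<1} r * ennreal ((propagator \<theta> t r)\<^sup>2)) \<partial>lborel)
    \<le> ennreal (K * decay_rate \<theta> n t)"
proof (cases "3 \<le> n")
  case True
  let ?J = "\<lambda>t. \<integral>\<^sup>+r. ennreal (r ^ (n - 1)) * indicator {0..} r * (indicator {..<1} r * ennreal ((propagator \<theta> t r)\<^sup>2)) \<partial>lborel"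
  from True have "n = (n - 3) + 3" by simp
  from propagator_energy_upper_high_dim[OF \<theta> this]
  obtain K where K: "0 < K" "\<forall>t>0. ?J t \<le> ennreal (K * decay_rate \<theta> n t)" by (elim exE conjE)
  have "\<forall>\<^sub>F t in at_top. ?J t \<le> ennreal (K * decay_rate \<theta> n t)"
    by (rule eventually_mono[OF eventually_gt_at_top[of 0]]) (rule K(2)[rule_format])
  with K(1) show ?thesis by (intro exI[of _ K] conjI)
next
  case False
  let ?J = "\<lambda>t. \<integral>\<^sup>+r. ennreal (r ^ (n - 1)) * indicator {0..} r * (indicator {..<1} r * ennreal ((propagator \<theta> t r)\<^sup>2)) \<partial>lborel"
  from False n have "n = 1 \<or> n = 2" by linarith
  from propagator_energy_upper_low_dim[OF \<theta> this]
  obtain K where K: "0 < K" "\<forall>t\<ge>exp 1. ?J t \<le> ennreal (K * decay_rate \<theta> n t)" by (elim exE conjE)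
  have "\<forall>\<^sub>F t in at_top. ?J t \<le> ennreal (K * decay_rate \<theta> n t)"
    by (rule eventually_mono[OF eventually_ge_at_top[of "exp 1"]]) (rule K(2)[rule_format])
  with K(1) show ?thesis by (intro exI[of _ K] conjI)
qed

lemma propagator_energy_upper:
  assumes \<theta>: "1/2 < \<theta>"
  shows "\<exists>K>0. \<forall>\<^sub>F t in at_top. (\<integral>\<^sup>+x. indicator (ball 0 1) x * ennreal ((propagator \<theta> t (norm (x::'a::euclidean_space)))\<^sup>2) \<partial>lborel)
    \<le> ennreal (K * decay_rate \<theta> DIM('a) t)"
proof -
  let ?n = "DIM('a)" and ?S = "sphere_area TYPE('a)"
  let ?J = "\<lambda>t. \<integral>\<^sup>+r. ennreal (r ^ (?n - 1)) * indicator {0..} r * (indicator {..<1} r * ennreal ((propagator \<theta> t r)\<^sup>2)) \<partial>lborel"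
  have "1 \<le> ?n" using DIM_positive[where 'a = 'a] by linarith
  from propagator_energy_upper_1d[OF \<theta> this]
  obtain K where K: "0 < K" "\<forall>\<^sub>F t in at_top. ?J t \<le> ennreal (K * decay_rate \<theta> ?n t)"
    by (elim exE conjE)
  have eq: "(\<integral>\<^sup>+x. indicator (ball 0 1) x * ennreal ((propagator \<theta> t (norm (x::'a)))\<^sup>2) \<partial>lborel) = ennreal ?S * ?J t" for t
    by (rule nn_integral_radial_ball) measurable
  have "\<forall>\<^sub>F t in at_top. (\<integral>\<^sup>+x. indicator (ball 0 1) x * ennreal ((propagator \<theta> t (norm (x::'a)))\<^sup>2) \<partial>lborel)
      \<le> ennreal (?S * K * decay_rate \<theta> ?n t)"
    using K(2)
  proof eventually_elim
    case (elim t)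
    have "ennreal ?S * ?J t \<le> ennreal ?S * ennreal (K * decay_rate \<theta> ?n t)"
      using elim by (rule mult_left_mono) simp
    also have "\<dots> = ennreal (?S * K * decay_rate \<theta> ?n t)"
      using sphere_area_pos[where 'a = 'a] by (simp add: ennreal_mult'[symmetric] mult.assoc)
    finally show ?case unfolding eq .
  qed
  then show ?thesis using K(1) sphere_area_pos[where 'a = 'a] by (intro exI[of _ "?S * K"]) auto
qed

section \<open>Lower bounds for the low frequency energy\<close>

text \<open>The coercion truncates negative values to 0 and so can only enlarge the integral. This
  admits minorants of changing sign in the lower bounds.\<close>

lemma integral_le_nn_integral:
  fixes h :: "'a \<Rightarrow> real"
  assumes h: "integrable M h"
  shows "ennreal (integral\<^sup>L M h) \<le> (\<integral>\<^sup>+x. ennreal (h x) \<partial>M)"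
proof -
  have m: "integrable M (\<lambda>x. max 0 (h x))" using h by simp
  have "ennreal (integral\<^sup>L M h) \<le> ennreal (\<integral>x. max 0 (h x) \<partial>M)"
    by (intro ennreal_leI integral_mono h m) simp
  also have "\<dots> = (\<integral>\<^sup>+x. ennreal (max 0 (h x)) \<partial>M)"
    by (rule nn_integral_eq_integral[symmetric, OF m]) simp
  also have "\<dots> = (\<integral>\<^sup>+x. ennreal (h x) \<partial>M)"
    by (intro nn_integral_cong) (auto simp: max_def ennreal_neg)
  finally show ?thesis .
qed

text \<open>The sine is 1-Lipschitz, and expanding (sin b - 2 sin a)^2 >= 0 gives sin^2 b <= 2 sin^2
  a + 2 (sin b - sin a)^2.\<close>

lemma sin_sq_perturb:
  assumes "\<bar>a - b\<bar> \<le> (d::real)"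
  shows "(sin b)\<^sup>2 / 2 - d\<^sup>2 \<le> (sin a)\<^sup>2"
proof -
  have "\<bar>sin b - sin a\<bar> = 2 * \<bar>sin ((b - a) / 2)\<bar> * \<bar>cos ((b + a) / 2)\<bar>"
    by (simp add: sin_diff_sin abs_mult)
  also have "\<dots> \<le> 2 * \<bar>(b - a) / 2\<bar> * 1"
    by (intro mult_mono mult_left_mono abs_sin_x_le_abs_x abs_cos_le_one) auto
  also have "\<dots> \<le> d" using assms by (simp add: abs_minus_commute)
  finally have "\<bar>sin b - sin a\<bar> \<le> d" .
  then have d: "(sin b - sin a)\<^sup>2 \<le> d\<^sup>2" using power_mono[of "\<bar>sin b - sin a\<bar>" d 2] by simp
  have "0 \<le> (sin b - 2 * sin a)\<^sup>2" by simp
  then have "(sin b)\<^sup>2 \<le> 2 * (sin a)\<^sup>2 + 2 * (sin b - sin a)\<^sup>2"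
    by (simp add: power2_eq_square algebra_simps)
  with d show ?thesis by linarith
qed

text \<open>On \<open>r \<le> t\<^sup>-\<^sup>1\<^sup>/\<^sup>2\<^sup>\<theta>\<close> the damping exponent stays below 1, and since also \<open>damping \<theta> r \<le> r\<close>
  the phase error \<open>t (r - frequency \<theta> r)\<close> is at most \<open>1/4\<close>.\<close>

lemma propagator_sq_ge:
  assumes \<theta>: "1/2 < \<theta>" and t: "1 \<le> t" and r: "0 < r" "r \<le> t powr (- 1 / (2 * \<theta>))"
  shows "exp (- 1) * (((sin (r * t))\<^sup>2 / 2 - 1 / 16) / r\<^sup>2) \<le> (propagator \<theta> t r)\<^sup>2"
proof -
  have "t powr (- 1 / (2 * \<theta>)) \<le> t powr 0" using t \<theta> by (intro powr_mono) auto
  with r t have r1: "r \<le> 1" by simp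
  note f = frequency_bounds[OF \<theta> r(1) r1]
  define w where "w = frequency \<theta> r"
  define l where "l = damping \<theta> r"
  have l: "0 \<le> l" "l \<le> r" unfolding l_def using damping_nonneg damping_le_self[OF \<theta>, of r] r r1 by auto
  have "r powr (2 * \<theta>) \<le> (t powr (- 1 / (2 * \<theta>))) powr (2 * \<theta>)"
    using r \<theta> by (intro powr_mono2) auto
  also have "\<dots> = t powr (- 1)" using \<theta> by (simp add: powr_powr)
  also have "\<dots> = 1 / t" using t by (simp add: powr_minus_divide)
  finally have "l \<le> 1 / t" using damping_le_powr[of \<theta> r] by (simp add: l_def)
  then have lt: "l * t \<le> 1" using t by (simp add: field_simps)
  have w: "0 < w" "w \<le> r" "w\<^sup>2 = r\<^sup>2 - l\<^sup>2 / 4" using f by (auto simp: w_def l_def)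
  \<comment> \<open>From r^2 - w^2 = l^2/4 and l <= r one gets r - w <= l/4; with l t <= 1 this
    bounds the phase error, whose square is the 1/16 in the statement.\<close>
  have "(r - w) * r \<le> (r - w) * (r + w)" using w by (intro mult_left_mono) auto
  also have "\<dots> = l\<^sup>2 / 4" using w(3) by (simp add: power2_eq_square algebra_simps)
  also have "\<dots> \<le> l * r / 4" using l by (simp add: power2_eq_square mult_left_mono)
  finally have "(r - w) * r \<le> (l / 4) * r" by simp
  then have "r - w \<le> l / 4" using r by simp
  then have "(r - w) * t \<le> l / 4 * t" using t by (intro mult_right_mono) auto
  also have "\<dots> \<le> 1 / 4" using lt by simp
  finally have "\<bar>w * t - r * t\<bar> \<le> 1 / 4"
    using w t mult_right_mono[of w r t] by (simp add: left_diff_distrib)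
  from sin_sq_perturb[OF this] have s: "(sin (r * t))\<^sup>2 / 2 - 1 / 16 \<le> (sin (w * t))\<^sup>2"
    by (simp add: power2_eq_square)
  have "exp (- 1) * (((sin (r * t))\<^sup>2 / 2 - 1 / 16) / r\<^sup>2) \<le> exp (- 1) * ((sin (w * t))\<^sup>2 / r\<^sup>2)"
    using s by (intro mult_left_mono divide_right_mono) auto
  also have "\<dots> \<le> exp (- (l * t)) * ((sin (w * t))\<^sup>2 / w\<^sup>2)"
    using lt w(1,2) by (intro mult_mono divide_left_mono power_mono) auto
  also have "\<dots> = (propagator \<theta> t r)\<^sup>2"
    unfolding propagator_def w_def[symmetric] l_def[symmetric] power_mult_distrib power_divide
    by (simp add: power2_eq_square exp_add[symmetric])
  finally show ?thesis .
qed

text \<open>The integral of \<open>sin\<^sup>2 (r t) / r\<close> is bounded below through the explicit function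
  \<open>3/16 ln r + (1 - sin (2 t r)) / (8 t r)\<close>, whose derivative lies below
  \<open>(sin\<^sup>2 (r t) / 2 - 1/16) / r\<close>.\<close>

lemma propagator_shell_lower:
  assumes \<theta>: "1/2 < \<theta>" and t: "1 \<le> t" and r: "0 < r1" "r1 \<le> r2" "r2 \<le> t powr (- 1 / (2 * \<theta>))"
  shows "ennreal (exp (- 1) * (3 / 16 * ln (r2 / r1) - 1 / (4 * t * r1)))
    \<le> (\<integral>\<^sup>+r. ennreal (r * (propagator \<theta> t r)\<^sup>2) * indicator {r1..r2} r \<partial>lborel)"
proof -
  define F where "F r = exp (- 1) * (3 / 16 * ln r + (1 - sin (2 * t * r)) / (8 * t * r))" for r :: real
  define f where "f r = exp (- 1) * (3 / (16 * r) - cos (2 * t * r) / (4 * r) - (1 - sin (2 * t * r)) / (8 * t * r\<^sup>2))" for r :: real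
  have df: "(F has_real_derivative f r) (at r)" if "r1 \<le> r" for r
  proof -
    have "r \<noteq> 0" "0 < r" "t \<noteq> 0" using that r t by auto
    then show ?thesis unfolding F_def f_def
      by (auto intro!: derivative_eq_intros simp: field_simps power2_eq_square)
  qed
  have cf: "isCont f r" if "r1 \<le> r" for r
  proof -
    have "r \<noteq> 0" "t \<noteq> 0" using that r t by auto
    then show ?thesis unfolding f_def by (auto intro!: continuous_intros)
  qed
  have hb: "has_bochner_integral lborel (\<lambda>r. f r * indicator {r1..r2} r) (F r2 - F r1)"
    by (rule has_bochner_integral_FTC_Icc_real[OF r(2)]) (auto intro: df cf)
  have "ennreal (exp (- 1) * (3 / 16 * ln (r2 / r1) - 1 / (4 * t * r1))) \<le> ennreal (F r2 - F r1)"
  proof (rule ennreal_leI)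
    have "0 \<le> (1 - sin (2 * t * r2)) / (8 * t * r2)" using r t by (intro divide_nonneg_pos) auto
    moreover have "(1 - sin (2 * t * r1)) / (8 * t * r1) \<le> 2 / (8 * t * r1)"
      using r t sin_ge_minus_one[of "2 * t * r1"] by (intro divide_right_mono) auto
    moreover have "2 / (8 * t * r1) = 1 / (4 * t * r1)" using r t by (simp add: field_simps)
    moreover have "ln (r2 / r1) = ln r2 - ln r1" using r by (simp add: ln_div)
    ultimately have "3 / 16 * ln (r2 / r1) - 1 / (4 * t * r1)
        \<le> (3 / 16 * ln r2 + (1 - sin (2 * t * r2)) / (8 * t * r2)) - (3 / 16 * ln r1 + (1 - sin (2 * t * r1)) / (8 * t * r1))"
      by linarith
    then show "exp (- 1) * (3 / 16 * ln (r2 / r1) - 1 / (4 * t * r1)) \<le> F r2 - F r1"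
      unfolding F_def right_diff_distrib[symmetric] by (intro mult_left_mono) auto
  qed
  also have "F r2 - F r1 = (LINT r|lborel. f r * indicator {r1..r2} r)"
    using has_bochner_integral_integral_eq[OF hb] by simp
  also have "ennreal \<dots> \<le> (\<integral>\<^sup>+r. ennreal (f r * indicator {r1..r2} r) \<partial>lborel)"
    by (rule integral_le_nn_integral) (use hb in \<open>simp add: has_bochner_integral_iff\<close>)
  also have "\<dots> \<le> (\<integral>\<^sup>+r. ennreal (r * (propagator \<theta> t r)\<^sup>2) * indicator {r1..r2} r \<partial>lborel)"
  proof (rule nn_integral_mono)
    fix r :: real
    show "ennreal (f r * indicator {r1..r2} r) \<le> ennreal (r * (propagator \<theta> t r)\<^sup>2) * indicator {r1..r2} r"
    proof (cases "r \<in> {r1..r2}")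
      case True
      then have r': "0 < r" "r \<le> t powr (- 1 / (2 * \<theta>))" using r by auto
      \<comment> \<open>The double angle formula turns sin^2/2 - 1/16 into 3/16 - cos/4, which
        explains the coefficient 3/16.\<close>
      have c: "cos (2 * t * r) = 1 - 2 * (sin (r * t))\<^sup>2"
        using cos_double_sin[of "r * t"] by (simp add: mult_ac)
      have "f r \<le> exp (- 1) * (3 / (16 * r) - cos (2 * t * r) / (4 * r))"
        unfolding f_def using r' t by (intro mult_left_mono) auto
      also have "\<dots> = r * (exp (- 1) * (((sin (r * t))\<^sup>2 / 2 - 1 / 16) / r\<^sup>2))"
        unfolding c using r' by (simp add: field_simps power2_eq_square)
      also have "\<dots> \<le> r * (propagator \<theta> t r)\<^sup>2"
        using r' by (intro mult_left_mono propagator_sq_ge[OF \<theta> t]) auto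
      finally show ?thesis using True by (simp add: ennreal_leI)
    qed simp
  qed
  finally show ?thesis .
qed

text \<open>One template for all dimensions: \<open>m\<close> is a lower bound of r^(n-2) on the
  shell, which reduces the weight r^(n-1) to the weight r of dimension two.\<close>

lemma propagator_energy_shell:
  assumes \<theta>: "1/2 < \<theta>" and t: "1 \<le> t" and r: "0 < r1" "r1 \<le> r2" "r2 \<le> t powr (- 1 / (2 * \<theta>))"
    and \<rho>: "r2 < \<rho>" and m: "0 \<le> m" "\<And>r. r1 \<le> r \<Longrightarrow> r \<le> r2 \<Longrightarrow> m * r \<le> r ^ (n - 1)"
    and B: "0 \<le> B" "B \<le> 3 / 16 * ln (r2 / r1) - 1 / (4 * t * r1)"
  shows "ennreal (m * (exp (- 1) * B)) \<le> (\<integral>\<^sup>+r. ennreal (r ^ (n - 1)) * indicator {0..} r *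
      (indicator {..<\<rho>} r * ennreal ((propagator \<theta> t r)\<^sup>2)) \<partial>lborel)"
proof -
  have "ennreal (m * (exp (- 1) * B)) = ennreal m * ennreal (exp (- 1) * B)"
    using m(1) B(1) by (intro ennreal_mult) auto
  also have "\<dots> \<le> ennreal m * ennreal (exp (- 1) * (3 / 16 * ln (r2 / r1) - 1 / (4 * t * r1)))"
    using B by (intro mult_left_mono ennreal_leI) auto
  also have "\<dots> \<le> ennreal m * (\<integral>\<^sup>+r. ennreal (r * (propagator \<theta> t r)\<^sup>2) * indicator {r1..r2} r \<partial>lborel)"
    by (intro mult_left_mono propagator_shell_lower[OF \<theta> t r]) simp
  also have "\<dots> = (\<integral>\<^sup>+r. ennreal m * (ennreal (r * (propagator \<theta> t r)\<^sup>2) * indicator {r1..r2} r) \<partial>lborel)"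
    by (rule nn_integral_cmult[symmetric]) measurable
  also have "\<dots> \<le> (\<integral>\<^sup>+r. ennreal (r ^ (n - 1)) * indicator {0..} r *
      (indicator {..<\<rho>} r * ennreal ((propagator \<theta> t r)\<^sup>2)) \<partial>lborel)"
  proof (rule nn_integral_mono)
    fix r :: real
    show "ennreal m * (ennreal (r * (propagator \<theta> t r)\<^sup>2) * indicator {r1..r2} r) \<le> ennreal (r ^ (n - 1)) * indicator {0..} r *
      (indicator {..<\<rho>} r * ennreal ((propagator \<theta> t r)\<^sup>2))"
    proof (cases "r \<in> {r1..r2}")
      case True
      then have r': "0 < r" "r < \<rho>" using r \<rho> by auto
      have "m * r * (propagator \<theta> t r)\<^sup>2 \<le> r ^ (n - 1) * (propagator \<theta> t r)\<^sup>2"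
        using True by (intro mult_right_mono m(2)) auto
      then have "ennreal (m * (r * (propagator \<theta> t r)\<^sup>2)) \<le> ennreal (r ^ (n - 1) * (propagator \<theta> t r)\<^sup>2)"
        by (intro ennreal_leI) (simp only: mult.assoc)
      then show ?thesis using True r' m(1) by (simp add: ennreal_mult)
    qed simp
  qed
  finally show ?thesis .
qed

text \<open>The constant is chosen before the radius rho. The shells used shrink to the origin as t
  grows and are therefore eventually inside any ball.\<close>

lemma propagator_energy_lower_1d:
  assumes \<theta>: "1/2 < \<theta>" and n: "1 \<le> n"
  shows "\<exists>\<kappa>>0. \<forall>\<rho>. 0 < \<rho> \<longrightarrow> (\<forall>\<^sub>F t in at_top. ennreal (\<kappa> * decay_rate \<theta> n t) \<le>
    (\<integral>\<^sup>+r. ennreal (r ^ (n - 1)) * indicator {0..} r * (indicator {..<\<rho>} r * ennreal ((propagator \<theta> t r)\<^sup>2)) \<partial>lborel))"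
proof -
  let ?J = "\<lambda>\<rho> t. \<integral>\<^sup>+r. ennreal (r ^ (n - 1)) * indicator {0..} r * (indicator {..<\<rho>} r * ennreal ((propagator \<theta> t r)\<^sup>2)) \<partial>lborel"
  \<comment> \<open>With tau = t^(-1/(2 theta)), the product t tau equals t^beta, so beta > 0
    expresses that tau is eventually much larger than 1/t.\<close>
  define \<beta> where "\<beta> = 1 - 1 / (2 * \<theta>)"
  have \<beta>: "0 < \<beta>" using \<theta> by (simp add: \<beta>_def)
  \<comment> \<open>The factor exp (-1) is the damping loss. The others are \<open>m\<close> times
    the lower bound \<open>B\<close> of each shell, divided by the rate.\<close>
  define \<kappa> where "\<kappa> = exp (- 1) * (if 3 \<le> n then 1 / (2 ^ (n - 2) * 16) else if n = 2 then \<beta> / 8 else 1 / 64)"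
  have \<kappa>: "0 < \<kappa>" using \<beta> by (simp add: \<kappa>_def)
  have "\<forall>\<^sub>F t in at_top. ennreal (\<kappa> * decay_rate \<theta> n t) \<le> ?J \<rho> t" if \<rho>: "0 < \<rho>" for \<rho>
  proof -
    have "((\<lambda>t. t powr (- 1 / (2 * \<theta>))) \<longlongrightarrow> 0) at_top"
      using \<theta> by (intro tendsto_neg_powr filterlim_ident) auto
    then have e1: "\<forall>\<^sub>F t in at_top. t powr (- 1 / (2 * \<theta>)) < \<rho>" using \<rho> by (rule order_tendstoD(2))
    \<comment> \<open>The value 16 lets [1/t, 16/t] fit below tau for n = 1 and makes the boundary
      error at most 1/32 for n >= 3. The value exp 4 gives beta ln t >= 4, so for n = 2 the error
      1/4 costs at most (beta/16) ln t.\<close>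
    have e2: "\<forall>\<^sub>F t in at_top. max 16 (exp 4) \<le> t powr \<beta>"
      using powr_at_top[OF \<beta>] by (simp only: filterlim_at_top)
    show ?thesis
      using e1 e2 eventually_ge_at_top[of 1]
    proof eventually_elim
      case (elim t)
      define \<tau> where "\<tau> = t powr (- 1 / (2 * \<theta>))"
      have t: "1 \<le> t" "0 < t" using elim by auto
      have \<tau>: "0 < \<tau>" "\<tau> < \<rho>" using elim t by (auto simp: \<tau>_def)
      have t\<tau>: "t * \<tau> = t powr \<beta>"
        using t powr_mult_base[of t "- 1 / (2 * \<theta>)"] by (simp add: \<tau>_def \<beta>_def)
      have big: "16 \<le> t * \<tau>" "exp 4 \<le> t * \<tau>" using elim by (auto simp: t\<tau>)
      have tau: "16 / t \<le> \<tau>" using big(1) t(2) by (simp add: pos_divide_le_eq mult.commute[of \<tau> t])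
      consider "3 \<le> n" | "n = 2" | "n = 1" using n by linarith
      then show ?case
      proof cases
        case 1
        \<comment> \<open>The shell is [tau/2, tau], where r is comparable to tau. The bound follows
          from (3/16) ln 2 >= 1/8 and the error 1/32.\<close>
        have B: "1 / 16 \<le> 3 / 16 * ln (\<tau> / (\<tau> / 2)) - 1 / (4 * t * (\<tau> / 2))"
        proof -
          have "1 / (4 * t * (\<tau> / 2)) = 1 / (2 * (t * \<tau>))" by simp
          also have "\<dots> \<le> 1 / (2 * 16)"
          proof (rule divide_left_mono)
            show "2 * 16 \<le> 2 * (t * \<tau>)" using big(1) by linarith
            show "0 < 2 * (t * \<tau>) * (2 * 16)" using t \<tau> by simp
          qed simp
          finally have "1 / (4 * t * (\<tau> / 2)) \<le> 1 / 32" by simp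
          moreover have "ln (\<tau> / (\<tau> / 2)) = ln 2" using \<tau> by simp
          moreover have "2 / 3 \<le> ln (2::real)" by (rule ln2_ge_two_thirds)
          ultimately show ?thesis by linarith
        qed
        have m: "(\<tau> / 2) ^ (n - 2) * r \<le> r ^ (n - 1)" if "\<tau> / 2 \<le> r" for r
        proof -
          have "(\<tau> / 2) ^ (n - 2) * r \<le> r ^ (n - 2) * r"
            using that \<tau> by (intro mult_right_mono power_mono) auto
          also have "\<dots> = r ^ Suc (n - 2)" by simp
          also have "Suc (n - 2) = n - 1" using 1 by simp
          finally show ?thesis .
        qed
        have eq: "\<kappa> * decay_rate \<theta> n t = (\<tau> / 2) ^ (n - 2) * (exp (- 1) * (1 / 16))"
        proof -
          have "\<tau> ^ (n - 2) = \<tau> powr real (n - 2)" by (rule powr_realpow[OF \<tau>(1), symmetric])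
          also have "\<dots> = t powr (- 1 / (2 * \<theta>) * real (n - 2))" by (simp only: \<tau>_def powr_powr)
          also have "- 1 / (2 * \<theta>) * real (n - 2) = - (real n - 2) / (2 * \<theta>)"
            using \<theta> 1 by (simp add: of_nat_diff field_simps)
          finally show ?thesis using 1 by (simp add: \<kappa>_def decay_rate_def power_divide)
        qed
        show ?thesis
          unfolding eq
        proof (rule propagator_energy_shell[OF \<theta> t(1) _ _ _ \<tau>(2) _ _ _ B])
          show "(\<tau> / 2) ^ (n - 2) * r \<le> r ^ (n - 1)" if "\<tau> / 2 \<le> r" for r by (rule m[OF that])
          show "\<tau> \<le> t powr (- 1 / (2 * \<theta>))" by (simp only: \<tau>_def)
        qed (use \<tau> in auto)
      next
        case 2
        \<comment> \<open>The shell is [1/t, tau], and its logarithmic length is the source of the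
          rate ln t.\<close>
        have lnt: "ln (\<tau> / (1 / t)) = \<beta> * ln t"
          using t by (simp add: mult.commute[of \<tau>] t\<tau> ln_powr)
        have "ln (exp 4) \<le> ln (t * \<tau>)" using big \<tau> t by (intro ln_mono) auto
        then have "4 \<le> \<beta> * ln t" using t by (simp add: t\<tau> ln_powr)
        then have B: "\<beta> / 8 * ln t \<le> 3 / 16 * ln (\<tau> / (1 / t)) - 1 / (4 * t * (1 / t))" "0 \<le> \<beta> / 8 * ln t"
          unfolding lnt using t by auto
        have le: "1 / t \<le> \<tau>" using tau t by (simp add: field_simps)
        have eq: "\<kappa> * decay_rate \<theta> n t = 1 * (exp (- 1) * (\<beta> / 8 * ln t))"
          using 2 by (simp add: \<kappa>_def decay_rate_def)
        show ?thesis
          unfolding eq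
        proof (rule propagator_energy_shell[OF \<theta> t(1) _ le _ \<tau>(2) _ _ B(2) B(1)])
          show "\<tau> \<le> t powr (- 1 / (2 * \<theta>))" by (simp only: \<tau>_def)
        qed (use t 2 in auto)
      next
        case 3
        \<comment> \<open>The shell is [1/t, 16/t], where r <= 16/t allows m = t/16. The ratio 16
          makes the main term (3/4) ln 2 >= 1/2 exceed the error 1/4 by 1/4.\<close>
        have "ln ((16 / t) / (1 / t)) = ln (2 ^ 4 :: real)" using t by simp
        also have "\<dots> = 4 * ln 2" by (simp only: ln_realpow)
        finally have B: "1 / 4 \<le> 3 / 16 * ln ((16 / t) / (1 / t)) - 1 / (4 * t * (1 / t))"
          using ln2_ge_two_thirds t by simp
        have lt: "16 / t < \<rho>" using tau \<tau> by linarith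
        have eq: "\<kappa> * decay_rate \<theta> n t = t / 16 * (exp (- 1) * (1 / 4))"
          using 3 by (simp add: \<kappa>_def decay_rate_def)
        show ?thesis
          unfolding eq
        proof (rule propagator_energy_shell[OF \<theta> t(1) _ _ _ lt _ _ _ B])
          show "16 / t \<le> t powr (- 1 / (2 * \<theta>))" using tau by (simp only: \<tau>_def)
          show "1 / t \<le> 16 / t" using t by (intro divide_right_mono) auto
          show "t / 16 * r \<le> r ^ (n - 1)" if "r \<le> 16 / t" for r
            using that t 3 by (simp add: field_simps)
        qed (use t in auto)
      qed
    qed
  qed
  with \<kappa> show ?thesis by (intro exI[of _ \<kappa>] conjI allI impI)
qed

lemma propagator_energy_lower:
  assumes \<theta>: "1/2 < \<theta>"
  shows "\<exists>\<kappa>>0. \<forall>\<rho>. 0 < \<rho> \<longrightarrow> (\<forall>\<^sub>F t in at_top. ennreal (\<kappa> * decay_rate \<theta> DIM('a::euclidean_space) t) \<le>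
    (\<integral>\<^sup>+x. indicator (ball 0 \<rho>) x * ennreal ((propagator \<theta> t (norm (x::'a)))\<^sup>2) \<partial>lborel))"
proof -
  let ?n = "DIM('a)" and ?S = "sphere_area TYPE('a)"
  let ?J = "\<lambda>\<rho> t. \<integral>\<^sup>+r. ennreal (r ^ (?n - 1)) * indicator {0..} r * (indicator {..<\<rho>} r * ennreal ((propagator \<theta> t r)\<^sup>2)) \<partial>lborel"
  have "1 \<le> ?n" using DIM_positive[where 'a = 'a] by linarith
  from propagator_energy_lower_1d[OF \<theta> this]
  obtain \<kappa> where \<kappa>: "0 < \<kappa>" "\<forall>\<rho>. 0 < \<rho> \<longrightarrow> (\<forall>\<^sub>F t in at_top. ennreal (\<kappa> * decay_rate \<theta> ?n t) \<le> ?J \<rho> t)"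
    by (elim exE conjE)
  have "\<forall>\<^sub>F t in at_top. ennreal (?S * \<kappa> * decay_rate \<theta> ?n t) \<le>
      (\<integral>\<^sup>+x. indicator (ball 0 \<rho>) x * ennreal ((propagator \<theta> t (norm (x::'a)))\<^sup>2) \<partial>lborel)" if \<rho>: "0 < \<rho>" for \<rho>
    using \<kappa>(2)[rule_format, OF \<rho>]
  proof eventually_elim
    case (elim t)
    have "ennreal (?S * \<kappa> * decay_rate \<theta> ?n t) = ennreal ?S * ennreal (\<kappa> * decay_rate \<theta> ?n t)"
      using sphere_area_pos[where 'a = 'a] by (simp add: ennreal_mult'[symmetric] mult.assoc)
    also have "\<dots> \<le> ennreal ?S * ?J \<rho> t" using elim by (rule mult_left_mono) simp
    also have "\<dots> = (\<integral>\<^sup>+x. indicator (ball 0 \<rho>) x * ennreal ((propagator \<theta> t (norm (x::'a)))\<^sup>2) \<partial>lborel)"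
      by (rule nn_integral_radial_ball[symmetric]) measurable
    finally show ?case .
  qed
  then show ?thesis
    using \<kappa>(1) sphere_area_pos[where 'a = 'a] by (intro exI[of _ "?S * \<kappa>"]) auto
qed

section \<open>The decay rate of the solution\<close>

lemma L11_norm_bounds:
  assumes f: "in_L11 f"
  shows "integrable lborel f" "(LINT x|lborel. norm (f x)) \<le> L11_norm f" "0 \<le> L11_norm f"
    "norm (LINT x|lborel. f x) \<le> L11_norm f"
proof -
  show i: "integrable lborel f" using f by (simp add: in_L11_def)
  show 1: "(LINT x|lborel. norm (f x)) \<le> L11_norm f"
    unfolding L11_norm_def using f
    by (intro integral_mono) (auto simp: in_L11_def distrib_right)
  then show "norm (LINT x|lborel. f x) \<le> L11_norm f"
    using integral_norm_bound[of lborel f] by linarith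
  show "0 \<le> L11_norm f"
    unfolding L11_norm_def by (rule Bochner_Integration.integral_nonneg) simp
qed

text \<open>Here the weighted norm is needed: |exp (-i y) - 1| <= |y| with y = x . xi makes the
  transform Lipschitz at the origin with a first moment as constant.\<close>

lemma fourier_integral_near_zero:
  fixes f :: "'a::euclidean_space \<Rightarrow> complex"
  assumes f: "in_L11 f"
  shows "norm (fourier_integral f \<xi> - (LINT x|lborel. f x)) \<le> norm \<xi> * L11_norm f"
proof -
  have i: "integrable lborel f" and iw: "integrable lborel (\<lambda>x. (1 + norm x) * norm (f x))"
    using f by (auto simp: in_L11_def)
  note k = fourier_kernel_integrable[OF i, of \<xi>]
  have "fourier_integral f \<xi> - (LINT x|lborel. f x)
      = (LINT x|lborel. exp (- (\<i> * complex_of_real (x \<bullet> \<xi>))) * f x - f x)"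
    unfolding fourier_integral_def by (rule Bochner_Integration.integral_diff[OF k i, symmetric])
  also have "norm \<dots> \<le> (LINT x|lborel. norm (exp (- (\<i> * complex_of_real (x \<bullet> \<xi>))) * f x - f x))"
    by (rule integral_norm_bound)
  also have "\<dots> \<le> (LINT x|lborel. norm \<xi> * ((1 + norm x) * norm (f x)))"
  proof (rule integral_mono)
    show "integrable lborel (\<lambda>x. norm (exp (- (\<i> * complex_of_real (x \<bullet> \<xi>))) * f x - f x))"
      by (rule integrable_norm[OF Bochner_Integration.integrable_diff[OF k i]])
    show "integrable lborel (\<lambda>x. norm \<xi> * ((1 + norm x) * norm (f x)))"
      by (rule integrable_mult_right[OF iw])
    fix x :: 'a
    have "norm (exp (- (\<i> * complex_of_real (x \<bullet> \<xi>))) - 1) \<le> \<bar>x \<bullet> \<xi>\<bar>"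
      using iexp_approx1[of "- (x \<bullet> \<xi>)" 0] by simp
    also have "\<dots> \<le> norm x * norm \<xi>" by (rule Cauchy_Schwarz_ineq2)
    also have "\<dots> \<le> norm \<xi> * (1 + norm x)" by (simp add: algebra_simps)
    finally have "norm (exp (- (\<i> * complex_of_real (x \<bullet> \<xi>))) - 1) * norm (f x) \<le> norm \<xi> * (1 + norm x) * norm (f x)"
      by (rule mult_right_mono) simp
    moreover have "exp (- (\<i> * complex_of_real (x \<bullet> \<xi>))) * f x - f x = (exp (- (\<i> * complex_of_real (x \<bullet> \<xi>))) - 1) * f x"
      by (simp add: left_diff_distrib)
    ultimately show "norm (exp (- (\<i> * complex_of_real (x \<bullet> \<xi>))) * f x - f x) \<le> norm \<xi> * ((1 + norm x) * norm (f x))"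
      by (simp only: norm_mult mult.assoc)
  qed
  also have "\<dots> = norm \<xi> * L11_norm f" by (simp only: integral_mult_right_zero L11_norm_def)
  finally show ?thesis .
qed

text \<open>Passing from the Bochner integral to the nonnegative one requires integrability, which
  comes from bounding the propagator by t and from the transform being square integrable. At the
  origin the propagator has its default value 0.\<close>

lemma ennreal_low_frequency_energy:
  fixes f :: "'a::euclidean_space \<Rightarrow> complex"
  assumes \<theta>: "1/2 < \<theta>" and t: "0 \<le> t" and f1: "integrable lborel f" and f2: "in_L2 f"
  shows "ennreal (low_frequency_energy \<theta> t f) = (\<integral>\<^sup>+\<xi>. indicator (ball 0 1) \<xi> *
    ennreal ((propagator \<theta> t (norm \<xi>))\<^sup>2) * ennreal ((norm (fourier_integral f \<xi>))\<^sup>2) \<partial>lborel)"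
proof -
  let ?h = "\<lambda>\<xi>. indicator (ball 0 1) \<xi> * ((propagator \<theta> t (norm \<xi>))\<^sup>2 * (norm (fourier_integral f \<xi>))\<^sup>2)"
  have m1: "(\<lambda>\<xi>::'a. propagator \<theta> t (norm \<xi>)) \<in> borel_measurable borel" by measurable
  have m2: "?h \<in> borel_measurable borel"
    by (intro borel_measurable_times borel_measurable_power borel_measurable_indicator m1
        measurable_compose[OF fourier_integral_measurable[OF f1], where g = norm]) auto
  have "integrable lborel ?h"
  proof (rule Bochner_Integration.integrable_bound)
    show "integrable lborel (\<lambda>\<xi>. t\<^sup>2 * (norm (fourier_integral f \<xi>))\<^sup>2)"
      by (intro integrable_mult_right in_L2_integrable fourier_integral_L2(1)[OF f1 f2])
    show "AE \<xi> in lborel. norm (?h \<xi>) \<le> norm (t\<^sup>2 * (norm (fourier_integral f \<xi>))\<^sup>2)"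
    proof (rule AE_I2)
      fix \<xi> :: 'a
      show "norm (?h \<xi>) \<le> norm (t\<^sup>2 * (norm (fourier_integral f \<xi>))\<^sup>2)"
      proof (cases "0 < norm \<xi> \<and> norm \<xi> < 1")
        case True
        then have "(propagator \<theta> t (norm \<xi>))\<^sup>2 \<le> t\<^sup>2"
          by (intro propagator_sq_le'(2)[OF \<theta> _ _ t]) auto
        then have "(propagator \<theta> t (norm \<xi>))\<^sup>2 * (norm (fourier_integral f \<xi>))\<^sup>2 \<le> t\<^sup>2 * (norm (fourier_integral f \<xi>))\<^sup>2"
          by (rule mult_right_mono) simp
        then show ?thesis using True by (simp add: abs_mult)
      next
        case False
        then have "?h \<xi> = 0"
          by (cases "\<xi> = 0") (auto simp: propagator_def frequency_def damping_def)
        then have "norm (?h \<xi>) = 0" by (simp only: norm_zero)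
        then show ?thesis by (simp only: norm_ge_zero)
      qed
    qed
  qed (use m2 in simp)
  then have "ennreal (low_frequency_energy \<theta> t f) = (\<integral>\<^sup>+\<xi>. ennreal (?h \<xi>) \<partial>lborel)"
    unfolding low_frequency_energy_def by (rule nn_integral_eq_integral[symmetric]) simp
  also have "\<dots> = (\<integral>\<^sup>+\<xi>. indicator (ball 0 1) \<xi> *
      ennreal ((propagator \<theta> t (norm \<xi>))\<^sup>2) * ennreal ((norm (fourier_integral f \<xi>))\<^sup>2) \<partial>lborel)"
    by (intro nn_integral_cong) (auto simp: indicator_def ennreal_mult)
  finally show ?thesis .
qed

lemma propagator_ball_measurable:
  "(\<lambda>x::'a::euclidean_space. indicator (ball 0 \<rho>) x * ennreal ((propagator \<theta> t (norm x))\<^sup>2)) \<in> borel_measurable borel"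
proof (rule borel_measurable_times_ennreal)
  show "(indicator (ball 0 \<rho>) :: 'a \<Rightarrow> ennreal) \<in> borel_measurable borel"
    by (intro borel_measurable_indicator) simp
  show "(\<lambda>x::'a. ennreal ((propagator \<theta> t (norm x))\<^sup>2)) \<in> borel_measurable borel" by measurable
qed

lemma decay_rate_nonneg: "1 \<le> t \<Longrightarrow> 0 \<le> decay_rate \<theta> n t"
  by (simp add: decay_rate_def)

text \<open>The transform is bounded by the L^1 norm at every frequency, so the data factor out of
  the integral and the time threshold is uniform in \<open>f\<close>.\<close>

lemma low_frequency_energy_upper:
  assumes \<theta>: "1/2 < \<theta>"
  shows "\<exists>K>0. \<forall>\<^sub>F t in at_top. \<forall>f :: 'a::euclidean_space \<Rightarrow> complex. in_L2 f \<and> in_L11 f \<longrightarrow>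
    low_frequency_energy \<theta> t f \<le> (L11_norm f)\<^sup>2 * (K * decay_rate \<theta> DIM('a) t)"
proof -
  let ?J = "\<lambda>t. \<integral>\<^sup>+x. indicator (ball 0 1) x * ennreal ((propagator \<theta> t (norm (x::'a)))\<^sup>2) \<partial>lborel"
  from propagator_energy_upper[OF \<theta>, where 'a = 'a]
  obtain K where K: "0 < K" "\<forall>\<^sub>F t in at_top. ?J t \<le> ennreal (K * decay_rate \<theta> DIM('a) t)"
    by (elim exE conjE)
  have "\<forall>\<^sub>F t in at_top. \<forall>f :: 'a \<Rightarrow> complex. in_L2 f \<and> in_L11 f \<longrightarrow>
      low_frequency_energy \<theta> t f \<le> (L11_norm f)\<^sup>2 * (K * decay_rate \<theta> DIM('a) t)"
    using K(2) eventually_ge_at_top[of 1]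
  proof eventually_elim
    case (elim t)
    show ?case
    proof (intro allI impI, elim conjE)
      fix f :: "'a \<Rightarrow> complex"
      assume f2: "in_L2 f" and f: "in_L11 f"
      note f1 = L11_norm_bounds(1)[OF f]
      have "ennreal (low_frequency_energy \<theta> t f) = (\<integral>\<^sup>+\<xi>. indicator (ball 0 1) \<xi> *
          ennreal ((propagator \<theta> t (norm \<xi>))\<^sup>2) * ennreal ((norm (fourier_integral f \<xi>))\<^sup>2) \<partial>lborel)"
        by (rule ennreal_low_frequency_energy[OF \<theta> _ f1 f2]) (use elim in simp)
      also have "\<dots> \<le> (\<integral>\<^sup>+\<xi>. indicator (ball 0 1) \<xi> * ennreal ((propagator \<theta> t (norm (\<xi>::'a)))\<^sup>2) * ennreal ((L11_norm f)\<^sup>2) \<partial>lborel)"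
      proof (rule nn_integral_mono)
        fix \<xi> :: 'a
        have "norm (fourier_integral f \<xi>) \<le> L11_norm f"
          using norm_fourier_integral_le[OF f1, of \<xi>] L11_norm_bounds(2)[OF f] by linarith
        then have "ennreal ((norm (fourier_integral f \<xi>))\<^sup>2) \<le> ennreal ((L11_norm f)\<^sup>2)"
          by (intro ennreal_leI power_mono) auto
        then show "indicator (ball 0 1) \<xi> * ennreal ((propagator \<theta> t (norm \<xi>))\<^sup>2) * ennreal ((norm (fourier_integral f \<xi>))\<^sup>2)
            \<le> indicator (ball 0 1) \<xi> * ennreal ((propagator \<theta> t (norm \<xi>))\<^sup>2) * ennreal ((L11_norm f)\<^sup>2)"
          by (rule mult_left_mono) simp
      qed
      also have "\<dots> = ?J t * ennreal ((L11_norm f)\<^sup>2)"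
        by (rule nn_integral_multc) (simp add: propagator_ball_measurable)
      also have "\<dots> \<le> ennreal (K * decay_rate \<theta> DIM('a) t) * ennreal ((L11_norm f)\<^sup>2)"
        using elim(1) by (rule mult_right_mono) simp
      also have "\<dots> = ennreal ((L11_norm f)\<^sup>2 * (K * decay_rate \<theta> DIM('a) t))"
        by (subst mult.commute) (simp only: ennreal_mult'[OF zero_le_power2])
      finally show "low_frequency_energy \<theta> t f \<le> (L11_norm f)\<^sup>2 * (K * decay_rate \<theta> DIM('a) t)"
        using K(1) decay_rate_nonneg[OF elim(2), of \<theta> "DIM('a)"] by (simp add: ennreal_le_iff)
    qed
  qed
  with K(1) show ?thesis by (intro exI[of _ K] conjI)
qed

text \<open>Here the time threshold depends on \<open>f\<close>, since the ball on which the
  transform stays above half of |P1| does. The constant does not: it is a quarter of the constant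
  for the propagator alone.\<close>

lemma low_frequency_energy_lower:
  assumes \<theta>: "1/2 < \<theta>"
  shows "\<exists>\<kappa>>0. \<forall>f :: 'a::euclidean_space \<Rightarrow> complex. in_L2 f \<and> in_L11 f \<longrightarrow>
    (\<forall>\<^sub>F t in at_top. (norm (LINT x|lborel. f x))\<^sup>2 * (\<kappa> * decay_rate \<theta> DIM('a) t) \<le> low_frequency_energy \<theta> t f)"
proof -
  let ?J = "\<lambda>\<rho> t. \<integral>\<^sup>+x. indicator (ball 0 \<rho>) x * ennreal ((propagator \<theta> t (norm (x::'a)))\<^sup>2) \<partial>lborel"
  from propagator_energy_lower[OF \<theta>, where 'a = 'a]
  obtain \<kappa> where \<kappa>: "0 < \<kappa>" "\<forall>\<rho>. 0 < \<rho> \<longrightarrow> (\<forall>\<^sub>F t in at_top. ennreal (\<kappa> * decay_rate \<theta> DIM('a) t) \<le> ?J \<rho> t)"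
    by (elim exE conjE)
  have "\<forall>\<^sub>F t in at_top. (norm (LINT x|lborel. f x))\<^sup>2 * (\<kappa> / 4 * decay_rate \<theta> DIM('a) t) \<le> low_frequency_energy \<theta> t f"
    if f2: "in_L2 f" and f: "in_L11 f" for f :: "'a \<Rightarrow> complex"
  proof (cases "(LINT x|lborel. f x) = 0")
    case True
    have "0 \<le> low_frequency_energy \<theta> t f" for t
      unfolding low_frequency_energy_def by (rule Bochner_Integration.integral_nonneg) simp
    with True show ?thesis by simp
  next
    case False
    define p where "p = norm (LINT x|lborel. f x)"
    have p: "0 < p" using False by (simp add: p_def)
    \<comment> \<open>The radius makes rho (L + 1) at most p/2, where L is the weighted norm. The
      cap 1 keeps the ball inside the low frequency region, and the 1 added to L keeps the divisor
      positive.\<close>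
    define \<rho> where "\<rho> = min 1 (p / (2 * (L11_norm f + 1)))"
    have L: "0 < 2 * (L11_norm f + 1)" using L11_norm_bounds(3)[OF f] by simp
    have \<rho>: "0 < \<rho>" "\<rho> \<le> 1" "\<rho> * (L11_norm f + 1) \<le> p / 2"
    proof -
      show "0 < \<rho>" "\<rho> \<le> 1" using p L by (auto simp: \<rho>_def)
      have "\<rho> \<le> p / (2 * (L11_norm f + 1))" by (simp add: \<rho>_def)
      then have "\<rho> * (2 * (L11_norm f + 1)) \<le> p" using L by (simp only: pos_le_divide_eq)
      then have "2 * (\<rho> * (L11_norm f + 1)) \<le> p" by (simp only: mult.left_commute)
      then show "\<rho> * (L11_norm f + 1) \<le> p / 2" by linarith
    qed
    have near: "p / 2 \<le> norm (fourier_integral f \<xi>)" if "norm \<xi> < \<rho>" for \<xi> :: 'a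
    proof -
      have "p - norm (fourier_integral f \<xi>) \<le> norm (fourier_integral f \<xi> - (LINT x|lborel. f x))"
        unfolding p_def using norm_triangle_ineq2[of "LINT x|lborel. f x" "fourier_integral f \<xi>"]
        by (simp add: norm_minus_commute)
      also have "\<dots> \<le> norm \<xi> * L11_norm f" by (rule fourier_integral_near_zero[OF f])
      also have "\<dots> \<le> \<rho> * (L11_norm f + 1)"
        using that L11_norm_bounds(3)[OF f] \<rho>(1) by (intro mult_mono) auto
      also have "\<dots> \<le> p / 2" by (rule \<rho>(3))
      finally show ?thesis by simp
    qed
    show ?thesis
      using \<kappa>(2)[rule_format, OF \<rho>(1)] eventually_ge_at_top[of 1]
    proof eventually_elim
      case (elim t)
      note f1 = L11_norm_bounds(1)[OF f]
      have "ennreal (p\<^sup>2 * (\<kappa> / 4 * decay_rate \<theta> DIM('a) t)) = ennreal (\<kappa> * decay_rate \<theta> DIM('a) t) * ennreal ((p / 2)\<^sup>2)"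
        by (subst ennreal_mult''[symmetric]) (auto simp: power_divide mult_ac)
      also have "\<dots> \<le> ?J \<rho> t * ennreal ((p / 2)\<^sup>2)" using elim(1) by (rule mult_right_mono) simp
      also have "\<dots> = (\<integral>\<^sup>+\<xi>. indicator (ball 0 \<rho>) \<xi> * ennreal ((propagator \<theta> t (norm (\<xi>::'a)))\<^sup>2) * ennreal ((p / 2)\<^sup>2) \<partial>lborel)"
        by (rule nn_integral_multc[symmetric]) (simp add: propagator_ball_measurable)
      also have "\<dots> \<le> (\<integral>\<^sup>+\<xi>. indicator (ball 0 1) \<xi> *
          ennreal ((propagator \<theta> t (norm \<xi>))\<^sup>2) * ennreal ((norm (fourier_integral f \<xi>))\<^sup>2) \<partial>lborel)"
      proof (rule nn_integral_mono)
        fix \<xi> :: 'a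
        show "indicator (ball 0 \<rho>) \<xi> * ennreal ((propagator \<theta> t (norm \<xi>))\<^sup>2) * ennreal ((p / 2)\<^sup>2)
            \<le> indicator (ball 0 1) \<xi> * ennreal ((propagator \<theta> t (norm \<xi>))\<^sup>2) * ennreal ((norm (fourier_integral f \<xi>))\<^sup>2)"
        proof (cases "norm \<xi> < \<rho>")
          case True
          then have "indicator (ball 0 \<rho>) \<xi> = (1::ennreal)" "indicator (ball 0 1) \<xi> = (1::ennreal)"
            using \<rho> by auto
          moreover have "ennreal ((p / 2)\<^sup>2) \<le> ennreal ((norm (fourier_integral f \<xi>))\<^sup>2)"
            using near[OF True] p by (intro ennreal_leI power_mono) auto
          ultimately show ?thesis by (simp add: mult_left_mono)
        qed simp
      qed
      also have "\<dots> = ennreal (low_frequency_energy \<theta> t f)"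
        by (rule ennreal_low_frequency_energy[OF \<theta> _ f1 f2, symmetric]) (use elim in simp)
      finally have "ennreal (p\<^sup>2 * (\<kappa> / 4 * decay_rate \<theta> DIM('a) t)) \<le> ennreal (low_frequency_energy \<theta> t f)" .
      moreover have "0 \<le> low_frequency_energy \<theta> t f"
        unfolding low_frequency_energy_def by (rule Bochner_Integration.integral_nonneg) simp
      ultimately show ?case by (simp add: ennreal_le_iff p_def)
    qed
  qed
  with \<kappa>(1) show ?thesis by (intro exI[of _ "\<kappa> / 4"]) auto
qed

text \<open>The exponential beats t^-n. For n >= 3, 2 theta > 1 puts the exponent of the rate above
  -n; in dimensions 1 and 2 the rate is at least 1 once t >= e.\<close>

lemma exp_decay_le_rate:
  assumes a: "0 < a" and \<theta>: "1/2 < \<theta>" and n: "1 \<le> n"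
  shows "\<forall>\<^sub>F t in at_top. 2 * exp (- a * t) \<le> decay_rate \<theta> n t"
proof -
  have "((\<lambda>t. (a * t) ^ n / exp (a * t)) \<longlongrightarrow> 0) at_top"
    using tendsto_power_div_exp_0[of n]
    by (rule filterlim_compose) (rule filterlim_tendsto_pos_mult_at_top[OF tendsto_const a filterlim_ident])
  then have "\<forall>\<^sub>F t in at_top. (a * t) ^ n / exp (a * t) < a ^ n / 2"
    using a by (intro order_tendstoD(2)) auto
  then show ?thesis
    using eventually_ge_at_top[of "exp 1"]
  proof eventually_elim
    case (elim t)
    have t: "1 \<le> t" using elim(2) exp_ge_add_one_self[of 1] by linarith
    have "a ^ n * (2 * (t ^ n * exp (- a * t))) = 2 * ((a * t) ^ n / exp (a * t))"
      by (simp add: power_mult_distrib exp_minus field_simps)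
    also have "\<dots> \<le> a ^ n * 1" using elim(1) by (simp only: mult_1_right)
    finally have le: "2 * (t ^ n * exp (- a * t)) \<le> 1" using a by simp
    show ?case
    proof (cases "3 \<le> n")
      case True
      have "(real n - 2) / (2 * \<theta>) \<le> (real n - 2) / 1"
        using True \<theta> by (intro divide_left_mono) auto
      then have "- real n \<le> - ((real n - 2) / (2 * \<theta>))" by simp
      then have "t powr (- real n) \<le> t powr (- (real n - 2) / (2 * \<theta>))"
        unfolding minus_divide_left using t by (rule powr_mono)
      moreover have "2 * exp (- a * t) \<le> t powr (- real n)"
      proof -
        have "2 * exp (- a * t) = (2 * (t ^ n * exp (- a * t))) / t ^ n" using t by simp
        also have "\<dots> \<le> 1 / t ^ n" using le t by (intro divide_right_mono) auto
        also have "\<dots> = t powr (- real n)" using t by (simp add: powr_minus_divide powr_realpow)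
        finally show ?thesis .
      qed
      ultimately show ?thesis using True by (simp add: decay_rate_def)
    next
      case False
      have "1 * exp (- a * t) \<le> t ^ n * exp (- a * t)" using t by (intro mult_right_mono) auto
      then have "2 * exp (- a * t) \<le> 1" using le by linarith
      moreover have "1 \<le> ln t" using elim(2) t by (simp add: ln_ge_iff)
      ultimately show ?thesis using False t by (auto simp: decay_rate_def)
    qed
  qed
qed

theorem solution_decay_rate:
  assumes \<theta>: "1/2 < \<theta>"
  shows "\<exists>C>0. \<forall>(u1 :: 'a::euclidean_space \<Rightarrow> complex) u. in_L2 u1 \<and> in_L11 u1 \<and> mild_solution \<theta> u1 u \<longrightarrow>
    (\<forall>\<^sub>F t in at_top.
      C * norm (LINT x|lborel. u1 x) * sqrt (decay_rate \<theta> DIM('a) t) \<le> L2_norm (u t) \<and>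
      L2_norm (u t) \<le> inverse C * (L11_norm u1 + L2_norm u1) * sqrt (decay_rate \<theta> DIM('a) t))"
proof -
  let ?c = "plancherel_const TYPE('a)" and ?n = "DIM('a)"
  have c: "0 < ?c" by (rule plancherel_const_pos)
  have n: "1 \<le> ?n" using DIM_positive[where 'a = 'a] by linarith
  obtain a where a: "0 < a" and bounds: "\<And>(u1 :: 'a \<Rightarrow> complex) u t.
    in_L2 u1 \<Longrightarrow> integrable lborel u1 \<Longrightarrow> mild_solution \<theta> u1 u \<Longrightarrow> 0 \<le> t \<Longrightarrow>
      low_frequency_energy \<theta> t u1 \<le> ?c * (L2_norm (u t))\<^sup>2 \<and>
      ?c * (L2_norm (u t))\<^sup>2 \<le> low_frequency_energy \<theta> t u1 + 2 * exp (- a * t) * (?c * (L2_norm u1)\<^sup>2)"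
    using solution_norm_bounds[OF \<theta>, where 'a = 'a] by blast
  obtain K where K: "0 < K" and upper: "\<forall>\<^sub>F t in at_top. \<forall>f :: 'a \<Rightarrow> complex. in_L2 f \<and> in_L11 f \<longrightarrow>
    low_frequency_energy \<theta> t f \<le> (L11_norm f)\<^sup>2 * (K * decay_rate \<theta> ?n t)"
    using low_frequency_energy_upper[OF \<theta>, where 'a = 'a] by blast
  obtain \<kappa> where \<kappa>: "0 < \<kappa>" and lower: "\<And>f :: 'a \<Rightarrow> complex. in_L2 f \<Longrightarrow> in_L11 f \<Longrightarrow>
    \<forall>\<^sub>F t in at_top. (norm (LINT x|lborel. f x))\<^sup>2 * (\<kappa> * decay_rate \<theta> ?n t) \<le> low_frequency_energy \<theta> t f"
    using low_frequency_energy_lower[OF \<theta>, where 'a = 'a] by blast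
  \<comment> \<open>Both constants are divided by the Plancherel factor. In C2 the term K stems from
    the low frequencies; the second term is the Plancherel factor of the high frequency part, whose
    exponential is absorbed into the rate. The minimum then makes one C serve both sides.\<close>
  define C1 where "C1 = sqrt (\<kappa> / ?c)"
  define C2 where "C2 = sqrt ((K + ?c) / ?c)"
  define C where "C = min C1 (inverse C2)"
  have C12: "0 < C1" "0 < C2" using \<kappa> K c by (auto simp: C1_def C2_def)
  have C: "0 < C" "C \<le> C1" "C2 \<le> inverse C"
  proof -
    show C: "0 < C" "C \<le> C1" using C12 by (auto simp: C_def)
    have "inverse (inverse C2) \<le> inverse C"
      by (rule le_imp_inverse_le) (use C in \<open>auto simp: C_def\<close>)
    then show "C2 \<le> inverse C" by simp
  qed
  have "\<forall>\<^sub>F t in at_top.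
      C * norm (LINT x|lborel. u1 x) * sqrt (decay_rate \<theta> ?n t) \<le> L2_norm (u t) \<and>
      L2_norm (u t) \<le> inverse C * (L11_norm u1 + L2_norm u1) * sqrt (decay_rate \<theta> ?n t)"
    if u2: "in_L2 u1" and u11: "in_L11 u1" and mild: "mild_solution \<theta> u1 u" for u1 :: "'a \<Rightarrow> complex" and u
    using upper lower[OF u2 u11] exp_decay_le_rate[OF a \<theta> n] eventually_ge_at_top[of 1]
  proof eventually_elim
    case (elim t)
    let ?d = "decay_rate \<theta> ?n t" and ?I = "L11_norm u1 + L2_norm u1"
    define E where "E = low_frequency_energy \<theta> t u1"
    define N where "N = L2_norm (u t)"
    define p where "p = norm (LINT x|lborel. u1 x)"
    have d: "0 \<le> ?d" by (rule decay_rate_nonneg[OF elim(4)])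
    have E: "E \<le> ?c * N\<^sup>2" "?c * N\<^sup>2 \<le> E + 2 * exp (- a * t) * (?c * (L2_norm u1)\<^sup>2)"
      using bounds[OF u2 L11_norm_bounds(1)[OF u11] mild, of t] elim(4) by (auto simp: E_def N_def)
    have N: "0 \<le> N" by (simp add: N_def)
    have L: "0 \<le> L11_norm u1" by (rule L11_norm_bounds(3)[OF u11])
    have "p\<^sup>2 * (\<kappa> * ?d) \<le> ?c * N\<^sup>2" using elim(2) E(1) by (simp add: E_def p_def)
    then have "(C1 * p * sqrt ?d)\<^sup>2 \<le> N\<^sup>2"
      using \<kappa> c d by (simp add: C1_def power_mult_distrib field_simps)
    then have "C1 * p * sqrt ?d \<le> N" using N by (rule power2_le_imp_le)
    moreover have "C * p * sqrt ?d \<le> C1 * p * sqrt ?d"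
      using C d by (intro mult_right_mono) (auto simp: p_def)
    ultimately have low: "C * p * sqrt ?d \<le> N" by linarith
    have I2: "(L11_norm u1)\<^sup>2 \<le> ?I\<^sup>2" "(L2_norm u1)\<^sup>2 \<le> ?I\<^sup>2"
      using L by (auto intro!: power_mono)
    have "E \<le> (L11_norm u1)\<^sup>2 * (K * ?d)" using elim(1) u2 u11 by (simp add: E_def)
    also have "\<dots> \<le> ?I\<^sup>2 * (K * ?d)" using I2 K d by (intro mult_right_mono) auto
    finally have E1: "E \<le> ?I\<^sup>2 * (K * ?d)" .
    have E2: "2 * exp (- a * t) * (?c * (L2_norm u1)\<^sup>2) \<le> ?d * (?c * ?I\<^sup>2)"
      using elim(3) I2 c d by (intro mult_mono) auto
    have "?c * N\<^sup>2 \<le> ?I\<^sup>2 * (K * ?d) + ?d * (?c * ?I\<^sup>2)" using E(2) E1 E2 by linarith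
    also have "\<dots> = (K + ?c) * ?I\<^sup>2 * ?d" by (simp add: algebra_simps)
    finally have "N\<^sup>2 \<le> ((K + ?c) * ?I\<^sup>2 * ?d) / ?c" using c by (simp add: pos_le_divide_eq mult.commute)
    also have "\<dots> = (C2 * ?I * sqrt ?d)\<^sup>2"
      using K c d by (simp add: C2_def power_mult_distrib)
    finally have "N\<^sup>2 \<le> (C2 * ?I * sqrt ?d)\<^sup>2" .
    then have "N \<le> C2 * ?I * sqrt ?d"
      by (rule power2_le_imp_le) (use C12 L d in auto)
    also have "\<dots> \<le> inverse C * ?I * sqrt ?d"
      using C L d by (intro mult_right_mono) auto
    finally show ?case using low by (simp add: N_def p_def)
  qed
  with C(1) show ?thesis by (intro exI[of _ C]) blast
qed

theorem theorem1p2: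
  fixes \<theta> :: real
  assumes "\<theta> > 1/2"
  shows "\<exists>C>0. \<forall>(u1 :: real ^ 'n \<Rightarrow> complex) (u :: real \<Rightarrow> real ^ 'n \<Rightarrow> complex).
    in_L2 u1 \<and> in_L11 u1 \<and> mild_solution \<theta> u1 u \<longrightarrow>
    (let n = real CARD('n);
         P1 = (LINT x|lborel. u1 x);
         I0 = L11_norm u1 + L2_norm u1
     in \<forall>\<^sub>F t in at_top.
       (CARD('n) \<ge> 3 \<longrightarrow>
          C * norm P1 * t powr (- (n - 2) / (4 * \<theta>)) \<le> L2_norm (u t) \<and>
          L2_norm (u t) \<le> inverse C * I0 * t powr (- (n - 2) / (4 * \<theta>))) \<and>
       (CARD('n) = 2 \<longrightarrow>
          C * norm P1 * sqrt (ln t) \<le> L2_norm (u t) \<and>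
          L2_norm (u t) \<le> inverse C * I0 * sqrt (ln t)) \<and>
       (CARD('n) = 1 \<longrightarrow>
          C * norm P1 * sqrt t \<le> L2_norm (u t) \<and>
          L2_norm (u t) \<le> inverse C * I0 * sqrt t))"
proof -
  \<comment> \<open>The rate refers to the square of the norm, so the root turns 2 theta into 4
    theta in the exponent.\<close>
  have rate: "CARD('n) \<ge> 3 \<Longrightarrow> sqrt (decay_rate \<theta> CARD('n) t) = t powr (- (real CARD('n) - 2) / (4 * \<theta>))"
    "CARD('n) = 2 \<Longrightarrow> decay_rate \<theta> CARD('n) t = ln t"
    "CARD('n) = 1 \<Longrightarrow> decay_rate \<theta> CARD('n) t = t" for t
    by (auto simp: decay_rate_def powr_half_sqrt[symmetric] powr_powr)
  obtain C where C: "0 < C" and rates: "\<And>(u1 :: real ^ 'n \<Rightarrow> complex) u.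
    in_L2 u1 \<Longrightarrow> in_L11 u1 \<Longrightarrow> mild_solution \<theta> u1 u \<Longrightarrow> (\<forall>\<^sub>F t in at_top.
      C * norm (LINT x|lborel. u1 x) * sqrt (decay_rate \<theta> CARD('n) t) \<le> L2_norm (u t) \<and>
      L2_norm (u t) \<le> inverse C * (L11_norm u1 + L2_norm u1) * sqrt (decay_rate \<theta> CARD('n) t))"
    using solution_decay_rate[OF assms, where 'a = "real ^ 'n"] by auto
  show ?thesis
  proof (intro exI[of _ C] conjI C allI impI, elim conjE, unfold Let_def)
    fix u1 :: "real ^ 'n \<Rightarrow> complex" and u :: "real \<Rightarrow> real ^ 'n \<Rightarrow> complex"
    assume u: "in_L2 u1" "in_L11 u1" "mild_solution \<theta> u1 u"
    show "\<forall>\<^sub>F t in at_top.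
       (CARD('n) \<ge> 3 \<longrightarrow>
          C * norm (LINT x|lborel. u1 x) * t powr (- (real CARD('n) - 2) / (4 * \<theta>)) \<le> L2_norm (u t) \<and>
          L2_norm (u t) \<le> inverse C * (L11_norm u1 + L2_norm u1) * t powr (- (real CARD('n) - 2) / (4 * \<theta>))) \<and>
       (CARD('n) = 2 \<longrightarrow>
          C * norm (LINT x|lborel. u1 x) * sqrt (ln t) \<le> L2_norm (u t) \<and>
          L2_norm (u t) \<le> inverse C * (L11_norm u1 + L2_norm u1) * sqrt (ln t)) \<and>
       (CARD('n) = 1 \<longrightarrow>
          C * norm (LINT x|lborel. u1 x) * sqrt t \<le> L2_norm (u t) \<and>
          L2_norm (u t) \<le> inverse C * (L11_norm u1 + L2_norm u1) * sqrt t)"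
      using rates[OF u]
    proof eventually_elim
      case (elim t)
      then show ?case using rate[of t] by (auto simp only: simp_thms)
    qed
  qed
qed

end
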